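(* Let $n\ge 2$ and let $\varphi:\Delta_n\to\mathbb{R}$ be a smooth exponentially concave function such that the Euclidean Hessian of $e^{\varphi}$ is strictly negative definite everywhere on $\Delta_n$. Equip $\Delta_n$ with the geometric structure $(g,\nabla,\nabla^* )$ induced by the L-divergence $T$ of $\varphi$. Let $p,q,r\in\Delta_n$. (i) The primal flow $\gamma(t)$, i.e. the solution of $\dot\gamma(t)=-\mathrm{grad}\,T(r\mid\cdot)(\gamma(t))$, $\gamma(0)=q$, is a time change of the primal geodesic from $q$ to $r$. (ii) The dual flow $\gamma^*(t)$, i.e. the solution of $\dot\gamma^*(t)=-\mathrm{grad}\,T(\cdot\mid p)(\gamma^*(t))$, $\gamma^*(0)=q$, is a time change of the dual geodesic from $q$ to $p$.
   Context: $\Delta_n=\{p\in\mathbb{R}^n: p_i>0,\ \sum_{i=1}^n p_i=1\}$, a smooth $(n-1)$-dimensional manifold. $\nabla\varphi(p)\cdot v$ denotes the directional derivative of $\varphi$ at $p$ along $v\in\mathbb{R}^n$ with $\sum_i v_i=0$; definiteness of the Hessian is with respect to nonzero such $v$. $\varphi$ is exponentially concave if $e^{\varphi}$ is concave. L-divergence: $T(q\mid p)=\log(1+\nabla\varphi(p)\cdot(q-p))-(\varphi(q)-\varphi(p))$. Geometric structure: in any coordinate system $\xi$ of $\Delta_n$, $g_{ij}(\xi)=-\partial_{\xi_i}\partial_{\xi'_j}T(\xi\mid\xi')|_{\xi=\xi'}$ (a Riemannian metric); primal connection $\nabla$: $\Gamma_{ijk}(\xi)=-\partial_{\xi_i}\partial_{\xi_j}\partial_{\xi'_k}T(\xi\mid\xi')|_{\xi=\xi'}$;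 dual connection $\nabla^*$: $\Gamma^*_{ijk}(\xi)=-\partial_{\xi_k}\partial_{\xi'_i}\partial_{\xi'_j}T(\xi\mid\xi')|_{\xi=\xi'}$; $\Gamma_{ij}^k=\sum_m\Gamma_{ijm}g^{mk}$, $\Gamma_{ij}^{*k}=\sum_m\Gamma^*_{ijm}g^{mk}$ with $(g^{ij})=(g_{ij})^{-1}$. A smooth curve is a primal (resp. dual) geodesic if in coordinates $\ddot\xi_k+\sum_{i,j}\Gamma_{ij}^k(\xi)\dot\xi_i\dot\xi_j=0$ (resp. with $\Gamma_{ij}^{*k}$) for all $k$. $\mathrm{grad}$ is the Riemannian gradient with respect to $g$; $T(r\mid\cdot)$ and $T(\cdot\mid p)$ are regarded as functions on $\Delta_n$ of the free argument. "The primal (dual) geodesic from $a$ to $b$" is the primal (dual) geodesic $\sigma:[0,1]\to\Delta_n$ with $\sigma(0)=a$, $\sigma(1)=b$. The flows are defined for $t\in[0,\infty)$, and a flow $\gamma$ is a time change of $\sigma$ if $\gamma(t)=\sigma(\tau(t))$ for a continuous strictly increasing $\tau:[0,\infty)\to[0,1)$ with $\tau(0)=0$ and $\tau(t)\to 1$ as $t\to\infty$.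
   Formalization: In (ii) the dual flow on [0,∞) and the dual geodesic from q to p need not exist for every such φ; it is proved that one exists if and only if the other does, and that the flow is then a time change of the geodesic. *)

theory Defs
  imports "HOL-Analysis.Analysis"
begin

definition simplex_int :: "(real ^ 'n::finite) set" where
  "simplex_int = {p. (\<forall>i. p $ i > 0) \<and> (\<Sum>i\<in>UNIV. p $ i) = 1}"

definition tangent_space :: "(real ^ 'n::finite) set" where
  "tangent_space = {v. (\<Sum>i\<in>UNIV. v $ i) = 0}"

text \<open>For \<open>f\<close> on the simplex, \<open>p\<close> in the simplex and \<open>v\<close> in \<^const>\<open>tangent_space\<close>, the
  derivative \<open>dirderiv f p v\<close> depends only on the values of \<open>f\<close> on the simplex.\<close>

definition dirderiv :: "('a::real_normed_vector \<Rightarrow> real) \<Rightarrow> 'a \<Rightarrow> 'a \<Rightarrow> real" where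
  "dirderiv f p v = deriv (\<lambda>h. f (p + h *\<^sub>R v)) 0"

definition hess :: "('a::real_normed_vector \<Rightarrow> real) \<Rightarrow> 'a \<Rightarrow> 'a \<Rightarrow> 'a \<Rightarrow> real" where
  "hess f p u v = dirderiv (\<lambda>a. dirderiv f a v) p u"

definition partial :: "'m \<Rightarrow> (real ^ 'm::finite \<Rightarrow> real) \<Rightarrow> real ^ 'm \<Rightarrow> real" where
  "partial i f a = dirderiv f a (axis i 1)"


section \<open>Smoothness\<close>

text \<open>\<open>Ck_on\<close> and \<open>smooth_on\<close> are meant for open sets.\<close>

primrec Ck_on :: "nat \<Rightarrow> 'a::real_normed_vector set \<Rightarrow> ('a \<Rightarrow> 'b::real_normed_vector) \<Rightarrow> bool" where
  "Ck_on 0 S f \<longleftrightarrow> continuous_on S f"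
| "Ck_on (Suc k) S f \<longleftrightarrow>
     (\<forall>a\<in>S. f differentiable (at a)) \<and> (\<forall>v. Ck_on k S (\<lambda>a. frechet_derivative f (at a) v))"

definition smooth_on :: "'a::real_normed_vector set \<Rightarrow> ('a \<Rightarrow> 'b::real_normed_vector) \<Rightarrow> bool" where
  "smooth_on S f \<longleftrightarrow> (\<forall>k. Ck_on k S f)"

text \<open>Smooth curves on an interval that may contain its endpoints (one-sided derivatives there);
  \<open>d k\<close> is the \<open>k\<close>-th derivative.\<close>

definition smooth_curve_on :: "real set \<Rightarrow> (real \<Rightarrow> 'a::real_normed_vector) \<Rightarrow> bool" where
  "smooth_curve_on I c \<longleftrightarrow>
     (\<exists>d. (\<forall>t\<in>I. d 0 t = c t) \<and>
          (\<forall>k. \<forall>t\<in>I. (d k has_vector_derivative d (Suc k) t) (at t within I)))"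

text \<open>A coordinate system of the simplex, with coordinates in an open set \<open>\<Omega>\<close> of \<open>real ^ 'm\<close>, where
  \<open>CARD('m) = CARD('n) - 1\<close>: \<open>\<xi>\<close> is the coordinate map, defined on the relatively open set \<open>x ` \<Omega>\<close>,
  and \<open>x\<close> is its inverse, a smooth immersion.  (By the inverse function theorem \<open>\<xi>\<close> is then smooth.)\<close>

definition coordinate_system ::
    "(real ^ 'm::finite) set \<Rightarrow> (real ^ 'm \<Rightarrow> real ^ 'n::finite) \<Rightarrow> (real ^ 'n \<Rightarrow> real ^ 'm) \<Rightarrow> bool" where
  "coordinate_system \<Omega> x \<xi> \<longleftrightarrow>
     open \<Omega> \<and> openin (top_of_set simplex_int) (x ` \<Omega>) \<and>
     homeomorphism \<Omega> (x ` \<Omega>) x \<xi> \<and>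
     smooth_on \<Omega> x \<and> (\<forall>a\<in>\<Omega>. inj (frechet_derivative x (at a)))"

text \<open>The coordinate dimension \<open>'m\<close> does not occur in the type of functions and curves on the
  simplex, so notions that quantify over all coordinate systems take it as a type argument.\<close>

definition smooth_on_simplex :: "'m::finite itself \<Rightarrow> (real ^ 'n::finite \<Rightarrow> real) \<Rightarrow> bool" where
  "smooth_on_simplex _ f \<longleftrightarrow>
     (\<forall>(\<Omega> :: (real ^ 'm) set) x \<xi>. coordinate_system \<Omega> x \<xi> \<longrightarrow> smooth_on \<Omega> (\<lambda>a. f (x a)))"


section \<open>The L-divergence and its geometric structure\<close>

text \<open>\<open>L_div \<phi> q p\<close> is \<open>T(q | p)\<close>.\<close>

definition L_div :: "(real ^ 'n::finite \<Rightarrow> real) \<Rightarrow> real ^ 'n \<Rightarrow> real ^ 'n \<Rightarrow> real" where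
  "L_div \<phi> q p = ln (1 + dirderiv \<phi> p (q - p)) - (\<phi> q - \<phi> p)"

text \<open>Below, \<open>x\<close> is the parametrization belonging to a coordinate system.  In each mixed derivative
  the variable \<open>a\<close> is \<open>\<xi>\<close> (first argument of \<open>T\<close>) and \<open>b\<close> is \<open>\<xi>'\<close> (second argument).\<close>

definition metric ::
    "(real ^ 'n::finite \<Rightarrow> real) \<Rightarrow> (real ^ 'm::finite \<Rightarrow> real ^ 'n) \<Rightarrow> real ^ 'm \<Rightarrow> real ^ 'm ^ 'm" where
  "metric \<phi> x c =
     (\<chi> i j. - partial i (\<lambda>a. partial j (\<lambda>b. L_div \<phi> (x a) (x b)) c) c)"

definition inv_metric ::
    "(real ^ 'n::finite \<Rightarrow> real) \<Rightarrow> (real ^ 'm::finite \<Rightarrow> real ^ 'n) \<Rightarrow> real ^ 'm \<Rightarrow> real ^ 'm ^ 'm" where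
  "inv_metric \<phi> x c = matrix_inv (metric \<phi> x c)"

definition primal_Gamma_low ::
    "(real ^ 'n::finite \<Rightarrow> real) \<Rightarrow> (real ^ 'm::finite \<Rightarrow> real ^ 'n) \<Rightarrow> real ^ 'm \<Rightarrow> 'm \<Rightarrow> 'm \<Rightarrow> 'm \<Rightarrow> real" where
  "primal_Gamma_low \<phi> x c i j k =
     - partial i (\<lambda>a. partial j (\<lambda>a'. partial k (\<lambda>b. L_div \<phi> (x a') (x b)) c) a) c"

definition dual_Gamma_low ::
    "(real ^ 'n::finite \<Rightarrow> real) \<Rightarrow> (real ^ 'm::finite \<Rightarrow> real ^ 'n) \<Rightarrow> real ^ 'm \<Rightarrow> 'm \<Rightarrow> 'm \<Rightarrow> 'm \<Rightarrow> real" where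
  "dual_Gamma_low \<phi> x c i j k =
     - partial k (\<lambda>a. partial i (\<lambda>b. partial j (\<lambda>b'. L_div \<phi> (x a) (x b')) b) c) c"

text \<open>\<open>primal_Gamma \<phi> x c i j k\<close> is the coefficient with lower indices \<open>i\<close>, \<open>j\<close> and upper index \<open>k\<close>.\<close>

definition primal_Gamma ::
    "(real ^ 'n::finite \<Rightarrow> real) \<Rightarrow> (real ^ 'm::finite \<Rightarrow> real ^ 'n) \<Rightarrow> real ^ 'm \<Rightarrow> 'm \<Rightarrow> 'm \<Rightarrow> 'm \<Rightarrow> real" where
  "primal_Gamma \<phi> x c i j k =
     (\<Sum>m\<in>UNIV. primal_Gamma_low \<phi> x c i j m * inv_metric \<phi> x c $ m $ k)"

definition dual_Gamma ::
    "(real ^ 'n::finite \<Rightarrow> real) \<Rightarrow> (real ^ 'm::finite \<Rightarrow> real ^ 'n) \<Rightarrow> real ^ 'm \<Rightarrow> 'm \<Rightarrow> 'm \<Rightarrow> 'm \<Rightarrow> real" where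
  "dual_Gamma \<phi> x c i j k =
     (\<Sum>m\<in>UNIV. dual_Gamma_low \<phi> x c i j m * inv_metric \<phi> x c $ m $ k)"


section \<open>Geodesics and gradient flows\<close>

definition velocity :: "real set \<Rightarrow> (real \<Rightarrow> 'a::real_normed_vector) \<Rightarrow> real \<Rightarrow> 'a" where
  "velocity I c t = vector_derivative c (at t within I)"

text \<open>\<open>G\<close> assigns connection coefficients to each parametrization.  The coordinate curve \<open>\<xi> \<circ> c\<close> is
  only meaningful while \<open>c\<close> stays in \<open>x ` \<Omega>\<close>; as that set is relatively open and \<open>c\<close> is continuous,
  this holds near every \<open>t\<close> with \<open>c t \<in> x ` \<Omega>\<close>.\<close>

definition geodesic ::
    "((real ^ 'm::finite \<Rightarrow> real ^ 'n::finite) \<Rightarrow> real ^ 'm \<Rightarrow> 'm \<Rightarrow> 'm \<Rightarrow> 'm \<Rightarrow> real)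
      \<Rightarrow> real set \<Rightarrow> (real \<Rightarrow> real ^ 'n) \<Rightarrow> bool" where
  "geodesic G I c \<longleftrightarrow>
     smooth_curve_on I c \<and> c ` I \<subseteq> simplex_int \<and>
     (\<forall>\<Omega> x \<xi>. coordinate_system \<Omega> x \<xi> \<longrightarrow>
        (\<forall>t\<in>I. c t \<in> x ` \<Omega> \<longrightarrow>
           (\<forall>k. velocity I (velocity I (\<xi> \<circ> c)) t $ k
              + (\<Sum>i\<in>UNIV. \<Sum>j\<in>UNIV. G x (\<xi> (c t)) i j k
                   * velocity I (\<xi> \<circ> c) t $ i * velocity I (\<xi> \<circ> c) t $ j) = 0)))"

definition primal_geodesic_from_to ::
    "'m::finite itself \<Rightarrow> (real ^ 'n::finite \<Rightarrow> real) \<Rightarrow> real ^ 'n \<Rightarrow> real ^ 'n \<Rightarrow> (real \<Rightarrow> real ^ 'n) \<Rightarrow> bool" where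
  "primal_geodesic_from_to _ \<phi> p q \<sigma> \<longleftrightarrow>
     geodesic (primal_Gamma \<phi> :: (real ^ 'm \<Rightarrow> _) \<Rightarrow> _) {0..1} \<sigma> \<and> \<sigma> 0 = p \<and> \<sigma> 1 = q"

definition dual_geodesic_from_to ::
    "'m::finite itself \<Rightarrow> (real ^ 'n::finite \<Rightarrow> real) \<Rightarrow> real ^ 'n \<Rightarrow> real ^ 'n \<Rightarrow> (real \<Rightarrow> real ^ 'n) \<Rightarrow> bool" where
  "dual_geodesic_from_to _ \<phi> p q \<sigma> \<longleftrightarrow>
     geodesic (dual_Gamma \<phi> :: (real ^ 'm \<Rightarrow> _) \<Rightarrow> _) {0..1} \<sigma> \<and> \<sigma> 0 = p \<and> \<sigma> 1 = q"

text \<open>The coordinate vector of the Riemannian gradient of \<open>f\<close>.\<close>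

definition riem_grad ::
    "(real ^ 'n::finite \<Rightarrow> real) \<Rightarrow> (real ^ 'm::finite \<Rightarrow> real ^ 'n) \<Rightarrow> (real ^ 'n \<Rightarrow> real) \<Rightarrow> real ^ 'm \<Rightarrow> real ^ 'm" where
  "riem_grad \<phi> x f c = (\<chi> i. \<Sum>j\<in>UNIV. inv_metric \<phi> x c $ i $ j * partial j (\<lambda>b. f (x b)) c)"

definition gradient_flow ::
    "'m::finite itself \<Rightarrow> (real ^ 'n::finite \<Rightarrow> real) \<Rightarrow> (real ^ 'n \<Rightarrow> real) \<Rightarrow> real ^ 'n
      \<Rightarrow> (real \<Rightarrow> real ^ 'n) \<Rightarrow> bool" where
  "gradient_flow _ \<phi> f q \<gamma> \<longleftrightarrow>
     \<gamma> 0 = q \<and> continuous_on {0..} \<gamma> \<and> \<gamma> ` {0..} \<subseteq> simplex_int \<and>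
     (\<forall>(\<Omega> :: (real ^ 'm) set) x \<xi>. coordinate_system \<Omega> x \<xi> \<longrightarrow>
        (\<forall>t\<ge>0. \<gamma> t \<in> x ` \<Omega> \<longrightarrow>
           ((\<xi> \<circ> \<gamma>) has_vector_derivative - riem_grad \<phi> x f (\<xi> (\<gamma> t))) (at t within {0..})))"

definition primal_flow ::
    "'m::finite itself \<Rightarrow> (real ^ 'n::finite \<Rightarrow> real) \<Rightarrow> real ^ 'n \<Rightarrow> real ^ 'n \<Rightarrow> (real \<Rightarrow> real ^ 'n) \<Rightarrow> bool" where
  "primal_flow M \<phi> r q \<gamma> \<longleftrightarrow> gradient_flow M \<phi> (\<lambda>p. L_div \<phi> r p) q \<gamma>"

definition dual_flow ::
    "'m::finite itself \<Rightarrow> (real ^ 'n::finite \<Rightarrow> real) \<Rightarrow> real ^ 'n \<Rightarrow> real ^ 'n \<Rightarrow> (real \<Rightarrow> real ^ 'n) \<Rightarrow> bool" where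
  "dual_flow M \<phi> p q \<gamma> \<longleftrightarrow> gradient_flow M \<phi> (\<lambda>r. L_div \<phi> r p) q \<gamma>"

definition time_change :: "(real \<Rightarrow> 'a) \<Rightarrow> (real \<Rightarrow> 'a) \<Rightarrow> bool" where
  "time_change \<gamma> \<sigma> \<longleftrightarrow>
     (\<exists>\<tau> :: real \<Rightarrow> real. continuous_on {0..} \<tau> \<and> strict_mono_on {0..} \<tau> \<and> \<tau> ` {0..} \<subseteq> {0..<1} \<and>
        \<tau> 0 = 0 \<and> (\<tau> \<longlongrightarrow> 1) at_top \<and> (\<forall>t\<ge>0. \<gamma> t = \<sigma> (\<tau> t)))"

end

theory Submission
  imports Defs
begin

text \<open>
  Write \<open>\<Phi> = e\<^sup>\<phi>\<close> and send a point \<open>p\<close> of the simplex to the two vectors \<open>X p = p / \<Phi> p\<close> and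
  \<open>Y p\<close>, the values at the vertices of the tangent plane of \<open>\<Phi>\<close> at \<open>p\<close>.  The value at \<open>q\<close> of this
  plane is the average of its values at the vertices, so \<open>X q \<bullet> Y p\<close> is its quotient by \<open>\<Phi> q\<close>, and
  this is \<open>exp T(q | p)\<close>.  By strict concavity \<open>X q \<bullet> Y p \<ge> 1\<close>, with equality only for \<open>p = q\<close>
  (\<open>pairing_ge_1\<close>, \<open>L_div_eq_ln_pairing\<close>).  Hence on the diagonal \<open>X \<bullet> Y = 1\<close> while \<open>\<partial>\<^sub>iX \<bullet> Y\<close> and
  \<open>X \<bullet> \<partial>\<^sub>jY\<close> vanish, and in every chart the derivatives of \<open>T = ln (X \<bullet> Y)\<close> collapse to
  \<open>g\<^sub>i\<^sub>j = - \<partial>\<^sub>iX \<bullet> \<partial>\<^sub>jY\<close>, \<open>\<Gamma>\<^sub>i\<^sub>j\<^sub>k = - \<partial>\<^sub>i\<partial>\<^sub>jX \<bullet> \<partial>\<^sub>kY\<close> and \<open>\<Gamma>\<^sup>*\<^sub>i\<^sub>j\<^sub>k = - \<partial>\<^sub>i\<partial>\<^sub>jY \<bullet> \<partial>\<^sub>kX\<close>.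
  Exchanging \<open>X\<close> and \<open>Y\<close> exchanges the primal and the dual geometry, so one argument serves both.

  As \<open>Y\<close> and its derivatives span the ambient space, two vectors are equal as soon as their pairings
  with these agree, and the pairings with the derivatives are the defining equations in
  coordinates.  In this way a curve \<open>\<sigma>\<close> is a primal geodesic iff \<open>(X \<circ> \<sigma>)''\<close> is
  everywhere a multiple of \<open>X \<circ> \<sigma>\<close> (\<open>geodesic_chart_iff\<close>), and the primal flow towards \<open>r\<close> is
  \<open>(X \<circ> \<gamma>)' = X r / (X r \<bullet> Y (\<gamma> t)) - X (\<gamma> t)\<close> (\<open>flow_chart_iff\<close>).  Both curves stay in the cone
  spanned by \<open>X q\<close> and \<open>X r\<close>: the flow satisfies \<open>e\<^sup>t X (\<gamma> t) = X q + K t X r\<close> with \<open>K\<close> increasing from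
  \<open>0\<close> to \<open>\<infinity>\<close> (\<open>flow_normal_form\<close>), and constancy of the Wronskian gives the geodesic the same form
  with a ratio of coefficients that also increases from \<open>0\<close> to \<open>\<infinity>\<close> (\<open>geodesic_normal_form\<close>).  Since
  \<open>X\<close> is injective up to scalars (\<open>proportional_imp_eq\<close>), matching the ratios gives the time change
  (\<open>flow_is_time_change\<close>).

  For existence, a continuous curve whose image under \<open>X\<close> runs along the segment from \<open>X q\<close> to
  \<open>X r\<close>, up to scalars, is smooth and can be reparametrised to a geodesic
  (\<open>geodesic_exists_if_segment_lifts\<close>), and a geodesic can be reparametrised to a flow
  (\<open>flow_exists_if_geodesic_exists\<close>).  In the primal case the curve is the straight segment from
  \<open>q\<close> to \<open>r\<close>.  In the dual case the segment from \<open>Y q\<close> to \<open>Y p\<close> may leave the image of \<open>Y\<close>, whence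
  the equivalence in place of existence; a dual flow sweeps out the segment up to its end point,
  which it reaches in the limit because it converges to \<open>p\<close> (\<open>flow_converges\<close>, \<open>pairing_proper\<close>).
\<close>

section \<open>Smooth maps on sets with boundary\<close>

text \<open>Derivatives are taken within the set, so that maps on open sets and curves on closed intervals
  share one calculus.  The derivative is existentially quantified because at a point that is not a
  limit point of the set it is not unique.\<close>

primrec Ck_within ::
    "nat \<Rightarrow> 'a::real_normed_vector set \<Rightarrow> ('a \<Rightarrow> 'b::real_normed_vector) \<Rightarrow> bool" where
  "Ck_within 0 S f \<longleftrightarrow> continuous_on S f"
| "Ck_within (Suc k) S f \<longleftrightarrow>
     (\<exists>f'. (\<forall>a\<in>S. (f has_derivative f' a) (at a within S)) \<and> (\<forall>v. Ck_within k S (\<lambda>a. f' a v)))"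

definition smooth_within :: "'a::real_normed_vector set \<Rightarrow> ('a \<Rightarrow> 'b::real_normed_vector) \<Rightarrow> bool" where
  "smooth_within S f \<longleftrightarrow> (\<forall>k. Ck_within k S f)"

lemma Ck_within_cong:
  assumes "Ck_within k S f" "\<And>a. a \<in> S \<Longrightarrow> f a = g a"
  shows "Ck_within k S g"
proof (cases k)
  case 0
  then show ?thesis using assms continuous_on_cong by (metis Ck_within.simps(1))
next
  case (Suc j)
  then obtain f' where f': "\<forall>a\<in>S. (f has_derivative f' a) (at a within S)"
      "\<forall>v. Ck_within j S (\<lambda>a. f' a v)"
    using assms(1) by auto
  have "(g has_derivative f' a) (at a within S)" if "a \<in> S" for a
    using has_derivative_transform[OF that, of g f] f'(1) assms(2) that by force
  then show ?thesis using f'(2) Suc by auto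
qed

lemma Ck_within_subset: "Ck_within k S f \<Longrightarrow> T \<subseteq> S \<Longrightarrow> Ck_within k T f"
proof (induction k arbitrary: f)
  case 0
  then show ?case using continuous_on_subset by auto
next
  case (Suc k)
  then obtain f' where "\<forall>a\<in>S. (f has_derivative f' a) (at a within S)"
      "\<forall>v. Ck_within k S (\<lambda>a. f' a v)"
    by auto
  then have "(\<forall>a\<in>T. (f has_derivative f' a) (at a within T)) \<and> (\<forall>v. Ck_within k T (\<lambda>a. f' a v))"
    using Suc has_derivative_subset by blast
  then show ?case by auto
qed

lemma Ck_within_continuous_on: "Ck_within k S f \<Longrightarrow> continuous_on S f"
  using has_derivative_continuous_on by (cases k) (simp, fastforce)

lemma Ck_within_Suc_imp: "Ck_within (Suc k) S f \<Longrightarrow> Ck_within k S f"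
proof (induction k arbitrary: f)
  case 0
  then show ?case using Ck_within_continuous_on by (metis Ck_within.simps(1))
next
  case (Suc k)
  then show ?case by (metis Ck_within.simps(2))
qed

lemma Ck_within_const: "Ck_within k S (\<lambda>a. c)"
proof (induction k arbitrary: c)
  case (Suc k)
  have "\<forall>a\<in>S. ((\<lambda>a. c) has_derivative (\<lambda>v. 0)) (at a within S)" by simp
  then show ?case using Suc unfolding Ck_within.simps by (intro exI[of _ "\<lambda>a v. 0"]) blast
qed auto

lemma Ck_within_bounded_linear:
  assumes "bounded_linear L" "Ck_within k S f"
  shows "Ck_within k S (\<lambda>a. L (f a))"
  using assms(2)
proof (induction k arbitrary: f)
  case 0
  then show ?case using assms(1) by (auto intro: bounded_linear.continuous_on)
next
  case (Suc k)
  then obtain f' where f': "\<forall>a\<in>S. (f has_derivative f' a) (at a within S)"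
      "\<forall>v. Ck_within k S (\<lambda>a. f' a v)"
    by auto
  have "\<forall>a\<in>S. ((\<lambda>a. L (f a)) has_derivative (\<lambda>v. L (f' a v))) (at a within S)"
    using bounded_linear.has_derivative[OF assms(1)] f'(1) by blast
  then show ?case using Suc.IH f'(2) unfolding Ck_within.simps
    by (intro exI[of _ "\<lambda>a v. L (f' a v)"]) blast
qed

lemma Ck_within_id: "Ck_within k S (\<lambda>a. a)"
proof (cases k)
  case (Suc j)
  have "\<forall>a\<in>S. ((\<lambda>a. a) has_derivative (\<lambda>v. v)) (at a within S)" by simp
  then show ?thesis unfolding Suc Ck_within.simps
    by (intro exI[of _ "\<lambda>a v. v"]) (use Ck_within_const in blast)
qed auto

lemma Ck_within_add:
  "Ck_within k S f \<Longrightarrow> Ck_within k S g \<Longrightarrow> Ck_within k S (\<lambda>a. f a + g a)"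
proof (induction k arbitrary: f g)
  case 0
  then show ?case by (auto intro: continuous_on_add)
next
  case (Suc k)
  then obtain f' g' where f': "\<forall>a\<in>S. (f has_derivative f' a) (at a within S)"
      "\<forall>v. Ck_within k S (\<lambda>a. f' a v)"
    and g': "\<forall>a\<in>S. (g has_derivative g' a) (at a within S)"
      "\<forall>v. Ck_within k S (\<lambda>a. g' a v)"
    by auto
  have "\<forall>a\<in>S. ((\<lambda>a. f a + g a) has_derivative (\<lambda>v. f' a v + g' a v)) (at a within S)"
    using f' g' by (auto intro: has_derivative_add)
  then show ?case using Suc.IH f'(2) g'(2) unfolding Ck_within.simps
    by (intro exI[of _ "\<lambda>a v. f' a v + g' a v"]) blast
qed

lemma Ck_within_bounded_bilinear:
  assumes "bounded_bilinear B"
  shows "Ck_within k S f \<Longrightarrow> Ck_within k S g \<Longrightarrow> Ck_within k S (\<lambda>a. B (f a) (g a))"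
proof (induction k arbitrary: f g)
  case 0
  then show ?case using assms by (auto intro: bounded_bilinear.continuous_on)
next
  case (Suc k)
  then obtain f' g' where f': "\<forall>a\<in>S. (f has_derivative f' a) (at a within S)"
      "\<forall>v. Ck_within k S (\<lambda>a. f' a v)"
    and g': "\<forall>a\<in>S. (g has_derivative g' a) (at a within S)"
      "\<forall>v. Ck_within k S (\<lambda>a. g' a v)"
    by auto
  have fg: "Ck_within k S f" "Ck_within k S g" using Suc.prems Ck_within_Suc_imp by blast+
  have "\<forall>a\<in>S. ((\<lambda>a. B (f a) (g a)) has_derivative (\<lambda>v. B (f a) (g' a v) + B (f' a v) (g a)))
      (at a within S)"
    using f' g' by (auto intro: bounded_bilinear.FDERIV[OF assms])
  moreover have "Ck_within k S (\<lambda>a. B (f a) (g' a v) + B (f' a v) (g a))" for v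
    using Suc.IH f'(2) g'(2) fg by (intro Ck_within_add) blast+
  ultimately show ?case unfolding Ck_within.simps
    by (intro exI[of _ "\<lambda>a v. B (f a) (g' a v) + B (f' a v) (g a)"]) blast
qed

lemmas Ck_within_scaleR = Ck_within_bounded_bilinear[OF bounded_bilinear_scaleR]
lemmas Ck_within_inner = Ck_within_bounded_bilinear[OF bounded_bilinear_inner]

lemma Ck_within_mult:
  fixes f g :: "'a::real_normed_vector \<Rightarrow> real"
  shows "Ck_within k S f \<Longrightarrow> Ck_within k S g \<Longrightarrow> Ck_within k S (\<lambda>a. f a * g a)"
  by (rule Ck_within_bounded_bilinear[OF bounded_bilinear_mult])

lemma Ck_within_minus: "Ck_within k S f \<Longrightarrow> Ck_within k S (\<lambda>a. - f a)"
  by (rule Ck_within_bounded_linear[OF bounded_linear_minus[OF bounded_linear_ident]])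

lemma Ck_within_diff:
  "Ck_within k S f \<Longrightarrow> Ck_within k S g \<Longrightarrow> Ck_within k S (\<lambda>a. f a - g a)"
  using Ck_within_add[OF _ Ck_within_minus, of k S f g] by simp

lemma Ck_within_sum:
  "finite A \<Longrightarrow> (\<And>i. i \<in> A \<Longrightarrow> Ck_within k S (f i)) \<Longrightarrow> Ck_within k S (\<lambda>a. \<Sum>i\<in>A. f i a)"
  by (induction A rule: finite_induct) (auto intro: Ck_within_add Ck_within_const)

lemma Ck_within_prod:
  fixes f :: "'i \<Rightarrow> 'a::real_normed_vector \<Rightarrow> real"
  shows "finite A \<Longrightarrow> (\<And>i. i \<in> A \<Longrightarrow> Ck_within k S (f i)) \<Longrightarrow> Ck_within k S (\<lambda>a. \<Prod>i\<in>A. f i a)"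
  by (induction A rule: finite_induct) (auto intro: Ck_within_mult Ck_within_const)

lemma Ck_within_inverse:
  fixes f :: "'a::real_normed_vector \<Rightarrow> real"
  assumes "\<And>a. a \<in> S \<Longrightarrow> f a \<noteq> 0"
  shows "Ck_within k S f \<Longrightarrow> Ck_within k S (\<lambda>a. inverse (f a))"
proof (induction k)
  case 0
  then show ?case using assms by (auto intro: continuous_on_inverse)
next
  case (Suc k)
  then obtain f' where f': "\<forall>a\<in>S. (f has_derivative f' a) (at a within S)"
      "\<forall>v. Ck_within k S (\<lambda>a. f' a v)"
    by auto
  have "Ck_within k S (\<lambda>a. inverse (f a))" using Suc Ck_within_Suc_imp by blast
  then have "Ck_within k S (\<lambda>a. - (inverse (f a) * f' a v * inverse (f a)))" for v
    using f'(2) by (intro Ck_within_minus Ck_within_mult) auto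
  moreover have "\<forall>a\<in>S. ((\<lambda>a. inverse (f a)) has_derivative
      (\<lambda>v. - (inverse (f a) * f' a v * inverse (f a)))) (at a within S)"
    using f' assms by auto
  ultimately show ?case unfolding Ck_within.simps
    by (intro exI[of _ "\<lambda>a v. - (inverse (f a) * f' a v * inverse (f a))"]) blast
qed

lemma Ck_within_exp:
  fixes f :: "'a::real_normed_vector \<Rightarrow> real"
  shows "Ck_within k S f \<Longrightarrow> Ck_within k S (\<lambda>a. exp (f a))"
proof (induction k)
  case 0
  then show ?case by (auto intro: continuous_on_exp)
next
  case (Suc k)
  then obtain f' where f': "\<forall>a\<in>S. (f has_derivative f' a) (at a within S)"
      "\<forall>v. Ck_within k S (\<lambda>a. f' a v)"
    by auto
  have "Ck_within k S (\<lambda>a. exp (f a))" using Suc Ck_within_Suc_imp by blast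
  then have "Ck_within k S (\<lambda>a. exp (f a) * f' a v)" for v
    using f'(2) by (intro Ck_within_mult) auto
  moreover have "\<forall>a\<in>S. ((\<lambda>a. exp (f a)) has_derivative (\<lambda>v. exp (f a) * f' a v)) (at a within S)"
    using f'(1) by (auto intro!: derivative_eq_intros)
  ultimately show ?case unfolding Ck_within.simps
    by (intro exI[of _ "\<lambda>a v. exp (f a) * f' a v"]) blast
qed

lemma Ck_within_compose:
  fixes f :: "'b::euclidean_space \<Rightarrow> 'c::real_normed_vector" and g :: "'a::real_normed_vector \<Rightarrow> 'b"
  assumes "g ` S \<subseteq> T"
  shows "Ck_within k T f \<Longrightarrow> Ck_within k S g \<Longrightarrow> Ck_within k S (\<lambda>a. f (g a))"
proof (induction k arbitrary: f)
  case 0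
  then show ?case using assms continuous_on_compose2 by (metis Ck_within.simps(1))
next
  case (Suc k)
  then obtain f' g' where f': "\<forall>a\<in>T. (f has_derivative f' a) (at a within T)"
      "\<forall>v. Ck_within k T (\<lambda>a. f' a v)"
    and g': "\<forall>a\<in>S. (g has_derivative g' a) (at a within S)"
      "\<forall>v. Ck_within k S (\<lambda>a. g' a v)"
    by auto
  have g: "Ck_within k S g" using Suc.prems Ck_within_Suc_imp by blast
  have der: "\<forall>a\<in>S. ((\<lambda>a. f (g a)) has_derivative (\<lambda>v. f' (g a) (g' a v))) (at a within S)"
    using f'(1) g'(1) has_derivative_in_compose2[of T f f' g S] assms by blast
  \<comment> \<open>The induction hypothesis speaks of derivatives of \<open>f\<close> in a fixed direction, and the direction
    \<open>g' a v\<close> varies with \<open>a\<close>.\<close>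
  have eq: "(\<Sum>b\<in>Basis. (g' a v \<bullet> b) *\<^sub>R f' (g a) b) = f' (g a) (g' a v)" if "a \<in> S" for a v
  proof -
    have "linear (f' (g a))"
      using f'(1) that assms has_derivative_linear by blast
    then have "f' (g a) (\<Sum>b\<in>Basis. (g' a v \<bullet> b) *\<^sub>R b) = (\<Sum>b\<in>Basis. (g' a v \<bullet> b) *\<^sub>R f' (g a) b)"
      by (simp add: linear_sum linear_scale)
    then show ?thesis by (simp add: euclidean_representation)
  qed
  have "Ck_within k S (\<lambda>a. \<Sum>b\<in>Basis. (g' a v \<bullet> b) *\<^sub>R f' (g a) b)" for v
    using Suc.IH[OF _ g] f'(2) g'(2)
    by (intro Ck_within_sum Ck_within_scaleR Ck_within_inner Ck_within_const) auto
  then have "Ck_within k S (\<lambda>a. f' (g a) (g' a v))" for v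
    by (rule Ck_within_cong) (rule eq)
  then show ?case using der unfolding Ck_within.simps
    by (intro exI[of _ "\<lambda>a v. f' (g a) (g' a v)"]) blast
qed

lemma Ck_within_vec:
  assumes "\<And>i. Ck_within k S (f i)"
  shows "Ck_within k S (\<lambda>a. (\<chi> i. f i a) :: real ^ 'm::finite)"
proof -
  have "(\<chi> i. f i a) = (\<Sum>i\<in>UNIV. f i a *\<^sub>R (axis i 1 :: real ^ 'm))" for a
    by (simp add: vec_eq_iff axis_def if_distrib cong: if_cong)
  then show ?thesis using assms
    by (auto intro!: Ck_within_sum Ck_within_scaleR Ck_within_const)
qed

lemma Ck_within_nth: "Ck_within k S f \<Longrightarrow> Ck_within k S (\<lambda>a. f a $ i)"
  by (rule Ck_within_bounded_linear[OF bounded_linear_vec_nth])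

lemma Ck_within_det:
  fixes A :: "'a::real_normed_vector \<Rightarrow> real ^ 'm ^ 'm::finite"
  assumes "\<And>i j. Ck_within k S (\<lambda>a. A a $ i $ j)"
  shows "Ck_within k S (\<lambda>a. det (A a))"
  unfolding det_def using assms
  by (intro Ck_within_sum Ck_within_mult Ck_within_const Ck_within_prod) auto

text \<open>By Cramer's rule the solution is a quotient of polynomials in the entries, so it inherits their
  order of differentiability.\<close>

lemma Ck_within_linear_solve:
  fixes A :: "'a::real_normed_vector \<Rightarrow> real ^ 'm ^ 'm::finite"
  assumes "\<And>i j. Ck_within k S (\<lambda>a. A a $ i $ j)" "\<And>i. Ck_within k S (\<lambda>a. b a $ i)"
    and "\<And>a. a \<in> S \<Longrightarrow> det (A a) \<noteq> 0" "\<And>a. a \<in> S \<Longrightarrow> A a *v y a = b a"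
  shows "Ck_within k S y"
proof -
  let ?c = "\<lambda>a. \<chi> l. det (\<chi> i j. if j = l then b a $ i else A a $ i $ j) * inverse (det (A a))"
  have "Ck_within k S (\<lambda>a. (\<chi> i j. if j = l then b a $ i else A a $ i $ j) $ i $ j)" for i j l :: 'm
    using assms(1,2) by (cases "j = l") auto
  then have "Ck_within k S ?c"
    using assms(1,3) by (intro Ck_within_vec Ck_within_mult Ck_within_inverse Ck_within_det) auto
  moreover have "?c a = y a" if "a \<in> S" for a
    using cramer[OF assms(3)[OF that], of "y a" "b a"] assms(4)[OF that]
    by (simp add: divide_inverse)
  ultimately show ?thesis by (rule Ck_within_cong)
qed

lemma smooth_on_imp_smooth_within:
  assumes "open S" "smooth_on S f"
  shows "smooth_within S f"
proof -
  have "Ck_on k S f \<Longrightarrow> Ck_within k S f" for k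
  proof (induction k arbitrary: f)
    case (Suc k)
    have "\<forall>a\<in>S. (f has_derivative frechet_derivative f (at a)) (at a within S)"
      using Suc.prems by (auto simp: frechet_derivative_works has_derivative_at_withinI)
    then show ?case using Suc by auto
  qed auto
  then show ?thesis using assms(2) by (auto simp: smooth_on_def smooth_within_def)
qed

lemma smooth_within_obtain_derivative:
  assumes "smooth_within S f"
  obtains f' where "\<forall>a\<in>S. (f has_derivative f' a) (at a within S)"
    "\<forall>v. Ck_within k S (\<lambda>a. f' a v)"
proof -
  have "Ck_within (Suc k) S f" using assms smooth_within_def by blast
  then show ?thesis using that by auto
qed

lemma smooth_within_differentiable:
  assumes "smooth_within S f" "a \<in> S"
  shows "\<exists>f'. (f has_derivative f') (at a within S)"
  by (rule smooth_within_obtain_derivative[OF assms(1), of 0]) (use assms(2) in blast)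

lemma smooth_within_frechet_derivative:
  assumes "open S" "smooth_within S f"
  shows "a \<in> S \<Longrightarrow> (f has_derivative frechet_derivative f (at a)) (at a)"
    and "smooth_within S (\<lambda>a. frechet_derivative f (at a) v)"
proof -
  show *: "(f has_derivative frechet_derivative f (at a)) (at a)" if "a \<in> S" for a
    using smooth_within_differentiable[OF assms(2) that]
    unfolding at_within_open[OF that assms(1)] differentiable_def[symmetric] frechet_derivative_works .
  have "Ck_within k S (\<lambda>a. frechet_derivative f (at a) v)" for k
  proof -
    obtain f' where f': "\<forall>a\<in>S. (f has_derivative f' a) (at a within S)"
        "\<forall>v. Ck_within k S (\<lambda>a. f' a v)"
      using smooth_within_obtain_derivative[OF assms(2)] by blast
    have eq: "f' a v = frechet_derivative f (at a) v" if "a \<in> S" for a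
    proof -
      have "(f has_derivative f' a) (at a within S)" using f'(1) that by blast
      then have "(f has_derivative f' a) (at a)" unfolding at_within_open[OF that assms(1)] .
      then show ?thesis using frechet_derivative_at by metis
    qed
    show ?thesis by (rule Ck_within_cong[OF f'(2)[rule_format] eq])
  qed
  then show "smooth_within S (\<lambda>a. frechet_derivative f (at a) v)" by (simp add: smooth_within_def)
qed

lemma smooth_within_vector_derivative:
  fixes c :: "real \<Rightarrow> 'b::real_normed_vector"
  assumes "\<And>t. t \<in> S \<Longrightarrow> at t within S \<noteq> bot" "smooth_within S c"
  shows "t \<in> S \<Longrightarrow> (c has_vector_derivative vector_derivative c (at t within S)) (at t within S)"
    and "smooth_within S (\<lambda>t. vector_derivative c (at t within S))"
proof -
  show "(c has_vector_derivative vector_derivative c (at t within S)) (at t within S)"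
    if "t \<in> S" for t
    using smooth_within_differentiable[OF assms(2) that]
    unfolding differentiable_def[symmetric] vector_derivative_works .
  have "Ck_within k S (\<lambda>t. vector_derivative c (at t within S))" for k
  proof -
    obtain f' where f': "\<forall>a\<in>S. (c has_derivative f' a) (at a within S)"
        "\<forall>v. Ck_within k S (\<lambda>a. f' a v)"
      using smooth_within_obtain_derivative[OF assms(2)] by blast
    have eq: "f' t 1 = vector_derivative c (at t within S)" if "t \<in> S" for t
    proof -
      have "bounded_linear (f' t)" using f'(1) that by (auto dest: has_derivative_bounded_linear)
      then have "f' t x = x *\<^sub>R f' t 1" for x
        using linear_scale[of "f' t" x 1] bounded_linear.linear by auto
      then have "f' t = (\<lambda>x. x *\<^sub>R f' t 1)" by blast
      then have "(c has_vector_derivative f' t 1) (at t within S)"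
        using f'(1) that unfolding has_vector_derivative_def by metis
      then show ?thesis using vector_derivative_within[OF assms(1)[OF that]] by metis
    qed
    show ?thesis by (rule Ck_within_cong[OF f'(2)[rule_format] eq])
  qed
  then show "smooth_within S (\<lambda>t. vector_derivative c (at t within S))"
    by (simp add: smooth_within_def)
qed

lemma smooth_curve_on_iff_smooth_within:
  assumes "\<And>t. t \<in> S \<Longrightarrow> at t within S \<noteq> bot"
  shows "smooth_curve_on S c \<longleftrightarrow> smooth_within S c"
proof
  assume "smooth_curve_on S c"
  then obtain d where d0: "\<forall>t\<in>S. d 0 t = c t"
    and d: "\<And>k t. t \<in> S \<Longrightarrow> (d k has_vector_derivative d (Suc k) t) (at t within S)"
    unfolding smooth_curve_on_def by auto
  have "Ck_within j S (d k)" for j k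
  proof (induction j arbitrary: k)
    case 0
    have "continuous_on S (d k)"
      by (rule has_derivative_continuous_on) (use d has_vector_derivative_def in blast)
    then show ?case by simp
  next
    case (Suc j)
    then show ?case using d unfolding Ck_within.simps has_vector_derivative_def
      by (intro exI[of _ "\<lambda>a v. v *\<^sub>R d (Suc k) a"]) (auto intro: Ck_within_scaleR Ck_within_const)
  qed
  then show "smooth_within S c" using d0 Ck_within_cong unfolding smooth_within_def by metis
next
  assume c: "smooth_within S c"
  define d where "d k = ((\<lambda>f t. vector_derivative f (at t within S)) ^^ k) c" for k
  have "smooth_within S (d k)" for k
    by (induction k) (use c assms smooth_within_vector_derivative(2) in \<open>auto simp: d_def\<close>)
  then have "(d k has_vector_derivative vector_derivative (d k) (at t within S)) (at t within S)"
    if "t \<in> S" for k t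
    using smooth_within_vector_derivative(1)[OF assms _ that] by blast
  then have "(d k has_vector_derivative d (Suc k) t) (at t within S)" if "t \<in> S" for k t
    using that by (simp add: d_def)
  then show "smooth_curve_on S c" unfolding smooth_curve_on_def
    by (intro exI[of _ d]) (simp add: d_def)
qed

lemma smooth_within_cong:
  "smooth_within S f \<Longrightarrow> (\<And>a. a \<in> S \<Longrightarrow> f a = g a) \<Longrightarrow> smooth_within S g"
  unfolding smooth_within_def using Ck_within_cong by blast

lemma smooth_within_subset: "smooth_within S f \<Longrightarrow> T \<subseteq> S \<Longrightarrow> smooth_within T f"
  unfolding smooth_within_def using Ck_within_subset by blast

lemma smooth_within_continuous_on: "smooth_within S f \<Longrightarrow> continuous_on S f"
  unfolding smooth_within_def using Ck_within_continuous_on by blast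

lemma smooth_within_const: "smooth_within S (\<lambda>a. c)"
  and smooth_within_id: "smooth_within S (\<lambda>a. a)"
  by (simp_all add: smooth_within_def Ck_within_const Ck_within_id)

lemma smooth_within_bounded_linear:
  "bounded_linear L \<Longrightarrow> smooth_within S f \<Longrightarrow> smooth_within S (\<lambda>a. L (f a))"
  unfolding smooth_within_def using Ck_within_bounded_linear by blast

lemma smooth_within_add:
  "smooth_within S f \<Longrightarrow> smooth_within S g \<Longrightarrow> smooth_within S (\<lambda>a. f a + g a)"
  and smooth_within_diff:
  "smooth_within S f \<Longrightarrow> smooth_within S g \<Longrightarrow> smooth_within S (\<lambda>a. f a - g a)"
  by (simp_all add: smooth_within_def Ck_within_add Ck_within_diff)

lemma smooth_within_scaleR:
  "smooth_within S r \<Longrightarrow> smooth_within S f \<Longrightarrow> smooth_within S (\<lambda>a. r a *\<^sub>R f a)"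
  and smooth_within_inner:
  "smooth_within S f \<Longrightarrow> smooth_within S g \<Longrightarrow> smooth_within S (\<lambda>a. f a \<bullet> g a)"
  by (simp_all add: smooth_within_def Ck_within_scaleR Ck_within_inner)

lemma smooth_within_real:
  fixes f g :: "'a::real_normed_vector \<Rightarrow> real"
  assumes "smooth_within S f"
  shows smooth_within_mult: "smooth_within S g \<Longrightarrow> smooth_within S (\<lambda>a. f a * g a)"
    and smooth_within_exp: "smooth_within S (\<lambda>a. exp (f a))"
    and smooth_within_inverse:
      "(\<And>a. a \<in> S \<Longrightarrow> f a \<noteq> 0) \<Longrightarrow> smooth_within S (\<lambda>a. inverse (f a))"
  using assms by (simp_all add: smooth_within_def Ck_within_mult Ck_within_exp Ck_within_inverse)

lemma smooth_within_sum:
  "finite A \<Longrightarrow> (\<And>i. i \<in> A \<Longrightarrow> smooth_within S (f i)) \<Longrightarrow> smooth_within S (\<lambda>a. \<Sum>i\<in>A. f i a)"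
  by (simp add: smooth_within_def Ck_within_sum)

lemma smooth_within_vec:
  "(\<And>i. smooth_within S (f i)) \<Longrightarrow> smooth_within S (\<lambda>a. (\<chi> i. f i a) :: real ^ 'm::finite)"
  by (simp add: smooth_within_def Ck_within_vec)

lemma smooth_within_nth: "smooth_within S f \<Longrightarrow> smooth_within S (\<lambda>a. f a $ i)"
  by (simp add: smooth_within_def Ck_within_nth)

lemma smooth_within_compose:
  fixes f :: "'b::euclidean_space \<Rightarrow> 'c::real_normed_vector"
  shows "smooth_within T f \<Longrightarrow> smooth_within S g \<Longrightarrow> g ` S \<subseteq> T \<Longrightarrow> smooth_within S (\<lambda>a. f (g a))"
  by (simp add: smooth_within_def Ck_within_compose)

text \<open>A left inverse of the derivative at \<open>g a\<close> controls \<open>g b - g a\<close> by \<open>N (g b) - N (g a)\<close>, so the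
  difference quotients of \<open>g\<close> converge with those of \<open>N \<circ> g\<close>.\<close>

lemma has_derivative_lift:
  fixes N :: "'b::real_normed_vector \<Rightarrow> 'c::real_normed_vector"
    and g :: "'a::real_normed_vector \<Rightarrow> 'b"
  assumes N: "(N has_derivative L) (at (g a) within T)"
    and P: "bounded_linear P" "\<And>v. P (L v) = v"
    and g: "g ` S \<subseteq> T" "continuous (at a within S) g" "a \<in> S"
    and h: "((\<lambda>b. N (g b)) has_derivative h) (at a within S)"
  shows "(g has_derivative (\<lambda>v. P (h v))) (at a within S)"
proof -
  interpret P: bounded_linear P by fact
  have Ph: "((\<lambda>b. P (N (g b))) has_derivative (\<lambda>v. P (h v))) (at a within S)"
    using P(1) h by (rule bounded_linear.has_derivative)
  have PN: "((\<lambda>y. P (N y)) has_derivative (\<lambda>v. v)) (at (g a) within T)"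
    using bounded_linear.has_derivative[OF P(1) N] P(2) by simp
  have bl: "bounded_linear (\<lambda>v. P (h v))" using Ph has_derivative_bounded_linear by blast
  then obtain M where M: "M > 0" "\<And>v. norm (P (h v)) \<le> norm v * M"
    using bounded_linear.pos_bounded by blast
  have near: "\<exists>d>0. \<forall>b\<in>S. norm (b - a) < d \<longrightarrow>
      norm (P (N (g b)) - P (N (g a)) - (g b - g a)) \<le> e * norm (g b - g a)" if "e > 0" for e
  proof -
    obtain d1 where d1: "d1 > 0" "\<forall>y\<in>T. norm (y - g a) < d1 \<longrightarrow>
        norm (P (N y) - P (N (g a)) - (y - g a)) \<le> e * norm (y - g a)"
      using PN \<open>e > 0\<close> unfolding has_derivative_within_alt by blast
    obtain d2 where "d2 > 0" "\<forall>b\<in>S. dist b a < d2 \<longrightarrow> dist (g b) (g a) < d1"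
      using g(2) d1(1) unfolding continuous_within_eps_delta by blast
    then show ?thesis using d1 g(1) by (auto simp: dist_norm image_subset_iff)
  qed
  have near2: "\<exists>d>0. \<forall>b\<in>S. norm (b - a) < d \<longrightarrow>
      norm (P (N (g b)) - P (N (g a)) - P (h (b - a))) \<le> e * norm (b - a)" if "e > 0" for e
    using Ph \<open>e > 0\<close> unfolding has_derivative_within_alt by blast
  have "\<exists>d>0. \<forall>b\<in>S. norm (b - a) < d \<longrightarrow> norm (g b - g a - P (h (b - a))) \<le> e * norm (b - a)"
    if e: "e > 0" for e
  proof -
    define e1 where "e1 = min (1/2) (e / (2 * (2 * M + 2)))"
    \<comment> \<open>The bound \<open>1/2\<close> makes \<open>norm (g b - g a)\<close> at most twice the norm of \<open>A\<close> below.\<close>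
    have e1: "e1 > 0" "e1 \<le> 1/2" using e M(1) unfolding e1_def by (auto simp del: le_divide_eq_numeral1)
    have K: "e / (2 * K) * K = e / 2" if "K > 0" for K :: real using that by simp
    have "e1 * (2 * M + 2) \<le> e / (2 * (2 * M + 2)) * (2 * M + 2)" using M(1)
      by (intro mult_right_mono) (auto simp: e1_def)
    then have e1_le: "e1 * (2 * M + 2) \<le> e / 2" using K[of "2 * M + 2"] M(1) by linarith
    obtain da where da: "da > 0" "\<forall>b\<in>S. norm (b - a) < da \<longrightarrow>
        norm (P (N (g b)) - P (N (g a)) - (g b - g a)) \<le> e1 * norm (g b - g a)"
      using near[OF e1(1)] by blast
    define e2 where "e2 = min 1 (e / 2)"
    have e2: "e2 > 0" "e2 \<le> 1" "e2 \<le> e / 2" using e by (auto simp: e2_def)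
    obtain db where db: "db > 0" "\<forall>b\<in>S. norm (b - a) < db \<longrightarrow>
        norm (P (N (g b)) - P (N (g a)) - P (h (b - a))) \<le> e2 * norm (b - a)"
      using near2[OF e2(1)] by blast
    have "norm (g b - g a - P (h (b - a))) \<le> e * norm (b - a)"
      if b: "b \<in> S" "norm (b - a) < min da db" for b
    proof -
      define A where "A = P (N (g b)) - P (N (g a))"
      define n where "n = norm (b - a)"
      have 1: "norm (A - (g b - g a)) \<le> e1 * norm (g b - g a)" using da b by (auto simp: A_def)
      have 2: "norm (A - P (h (b - a))) \<le> e2 * n" using db b by (auto simp: A_def n_def)
      have "norm A \<le> norm (P (h (b - a))) + e2 * n" 
        using 2 norm_triangle_sub[of A "P (h (b - a))"] by linarith
      also have "\<dots> \<le> n * M + 1 * n"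
        by (intro add_mono mult_right_mono e2) (auto simp: M(2) n_def)
      finally have An: "norm A \<le> (M + 1) * n" by (simp add: algebra_simps)
      have "norm (g b - g a) \<le> norm A + e1 * norm (g b - g a)"
        using 1 norm_triangle_sub[of "g b - g a" A] by (simp add: norm_minus_commute)
      also have "\<dots> \<le> norm A + (1/2) * norm (g b - g a)" using e1(2)
        by (intro add_left_mono mult_right_mono) auto
      finally have gb: "norm (g b - g a) \<le> (2 * M + 2) * n"
        using An by (simp add: algebra_simps)
      have "norm (g b - g a - P (h (b - a))) \<le> norm (A - (g b - g a)) + norm (A - P (h (b - a)))"
        using norm_triangle_ineq4[of "A - P (h (b - a))" "A - (g b - g a)"]
        by (simp only: diff_diff_eq2 diff_add_cancel add_diff_cancel_left' add.commute) (simp add: algebra_simps)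
      also have "\<dots> \<le> e1 * ((2 * M + 2) * n) + e2 * n"
        using 1 2 mult_left_mono[OF gb less_imp_le[OF e1(1)]] by linarith
      also have "\<dots> \<le> (e / 2) * n + (e / 2) * n"
        using e1_le e2(3) unfolding mult.assoc[symmetric]
        by (intro add_mono mult_right_mono) (auto simp: n_def)
      finally show ?thesis by (simp add: n_def)
    qed
    then show ?thesis using da(1) db(1) by (intro exI[of _ "min da db"]) auto
  qed
  then show ?thesis using bl unfolding has_derivative_within_alt by blast
qed

lemma matrix_inv_mult:
  fixes A :: "real ^ 'm ^ 'm::finite"
  assumes "det A \<noteq> 0"
  shows "A ** matrix_inv A = mat 1" "matrix_inv A ** A = mat 1"
proof -
  have "\<exists>B. A ** B = mat 1 \<and> B ** A = mat 1"
    using assms invertible_det_nz[of A] by (simp add: invertible_def)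
  then have "A ** matrix_inv A = mat 1 \<and> matrix_inv A ** A = mat 1"
    unfolding matrix_inv_def by (rule someI_ex)
  then show "A ** matrix_inv A = mat 1" "matrix_inv A ** A = mat 1" by auto
qed

lemma linear_axis_sum:
  fixes L :: "real ^ 'm::finite \<Rightarrow> 'c::real_vector"
  assumes "linear L"
  shows "L v = (\<Sum>j\<in>UNIV. v $ j *\<^sub>R L (axis j 1))"
proof -
  have "L (\<Sum>j\<in>UNIV. v $ j *\<^sub>R axis j 1) = (\<Sum>j\<in>UNIV. v $ j *\<^sub>R L (axis j 1))"
    using assms by (simp add: linear_sum linear_scale)
  then show ?thesis using basis_expansion[of v] by (simp add: scalar_mult_eq_scaleR)
qed

text \<open>With \<open>N'\<close> the derivative of \<open>N\<close>, the derivative of \<open>g\<close> solves a linear system whose matrix is the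
  Gram matrix of the columns of \<open>N'\<close> at \<open>g a\<close>.  The coefficients of the system are as smooth as \<open>g\<close>,
  so each order of differentiability of \<open>g\<close> yields the next.\<close>

lemma smooth_within_lift:
  fixes N :: "real ^ 'm::finite \<Rightarrow> 'c::euclidean_space" and g :: "'a::real_normed_vector \<Rightarrow> real ^ 'm"
  assumes N: "open T" "smooth_within T N" "\<And>y. y \<in> T \<Longrightarrow> inj (frechet_derivative N (at y))"
    and g: "g ` S \<subseteq> T" "continuous_on S g" "smooth_within S (\<lambda>a. N (g a))"
  shows "smooth_within S g"
proof -
  define D where "D y = frechet_derivative N (at y)" for y
  have D: "(N has_derivative D y) (at y)" "linear (D y)" if "y \<in> T" for y
    using smooth_within_frechet_derivative(1)[OF N(1,2) that] has_derivative_linear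
    by (auto simp: D_def)
  have Ds: "Ck_within k T (\<lambda>y. D y v)" for k v
    using smooth_within_frechet_derivative(2)[OF N(1,2)] by (simp add: D_def smooth_within_def)
  define G where "G y = (\<chi> i j. D y (axis i 1) \<bullet> D y (axis j 1))" for y
  have Dsum: "D y v = (\<Sum>j\<in>UNIV. v $ j *\<^sub>R D y (axis j 1))" if "y \<in> T" for y v
    by (rule linear_axis_sum[OF D(2)[OF that]])
  have Gv: "G y *v v = (\<chi> i. D y (axis i 1) \<bullet> D y v)" if "y \<in> T" for y v
    by (simp add: matrix_vector_mult_def G_def Dsum[OF that, of v] inner_sum_right mult.commute)
  have det: "det (G y) \<noteq> 0" if "y \<in> T" for y
  proof
    assume "det (G y) = 0"
    then obtain v where v: "v \<noteq> 0" "G y *v v = 0"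
      using invertible_det_nz[of "G y"] invertible_left_inverse[of "G y"]
        matrix_left_invertible_ker[of "G y"] by blast
    have "D y v \<bullet> D y v = (\<Sum>j\<in>UNIV. v $ j * (D y (axis j 1) \<bullet> D y v))"
      by (subst (1) Dsum[OF that]) (simp add: inner_sum_left)
    also have "\<dots> = 0" using v(2) Gv[OF that, of v] by (simp add: vec_eq_iff)
    finally have "D y v = D y 0" using D(2)[OF that] by (simp add: linear_0)
    then show False using N(3)[OF that] v(1) by (auto simp: D_def dest: injD)
  qed
  define P where "P y w = matrix_inv (G y) *v (\<chi> i. D y (axis i 1) \<bullet> w)" for y w
  have GP: "G y *v P y w = (\<chi> i. D y (axis i 1) \<bullet> w)" if "y \<in> T" for y w
    using matrix_inv_mult(1)[OF det[OF that]] by (simp add: P_def matrix_vector_mul_assoc)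
  have PD: "P y (D y v) = v" if "y \<in> T" for y v
    using matrix_inv_mult(2)[OF det[OF that]]
    by (simp add: P_def matrix_vector_mul_assoc flip: Gv[OF that])
  have Pbl: "bounded_linear (P y)" for y
  proof -
    have "linear (\<lambda>w. \<chi> i. D y (axis i 1) \<bullet> w)"
      by (auto simp: linear_iff vec_eq_iff inner_add_right)
    moreover have "P y = (*v) (matrix_inv (G y)) \<circ> (\<lambda>w. \<chi> i. D y (axis i 1) \<bullet> w)"
      by (auto simp: P_def)
    ultimately have "linear (P y)" using linear_compose matrix_vector_mul_linear by metis
    then show ?thesis by (simp add: linear_conv_bounded_linear)
  qed
  \<comment> \<open>\<open>P y\<close> is the left inverse of \<open>D y\<close> given by the normal equations of least squares.\<close>
  have "Ck_within k S g" for k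
  proof (induction k)
    case 0
    then show ?case using g(2) by simp
  next
    case (Suc k)
    obtain h where h: "\<forall>a\<in>S. ((\<lambda>a. N (g a)) has_derivative h a) (at a within S)"
        "\<forall>v. Ck_within k S (\<lambda>a. h a v)"
      using smooth_within_obtain_derivative[OF g(3)] by blast
    have "(g has_derivative (\<lambda>v. P (g a) (h a v))) (at a within S)" if "a \<in> S" for a
    proof (rule has_derivative_lift[where N = N and L = "D (g a)" and T = T])
      show "(N has_derivative D (g a)) (at (g a) within T)"
        using D(1) g(1) that has_derivative_at_withinI by blast
    qed (use that g h PD Pbl in \<open>auto simp: continuous_on_eq_continuous_within\<close>)
    moreover have "Ck_within k S (\<lambda>a. P (g a) (h a v))" for v
    proof (rule Ck_within_linear_solve[where A = "\<lambda>a. G (g a)" and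
          b = "\<lambda>a. \<chi> i. D (g a) (axis i 1) \<bullet> h a v"])
      have Dg: "Ck_within k S (\<lambda>a. D (g a) w)" for w
        using Ck_within_compose[OF g(1) Ds Suc] by simp
      then show "Ck_within k S (\<lambda>a. G (g a) $ i $ j)" for i j
        by (auto simp: G_def intro!: Ck_within_inner)
      show "Ck_within k S (\<lambda>a. (\<chi> i. D (g a) (axis i 1) \<bullet> h a v) $ i)" for i
        using Dg h(2) by (auto intro!: Ck_within_inner)
    qed (use det GP g(1) in auto)
    ultimately show ?case unfolding Ck_within.simps
      by (intro exI[of _ "\<lambda>a v. P (g a) (h a v)"]) blast
  qed
  then show ?thesis by (simp add: smooth_within_def)
qed

section \<open>Second derivatives\<close>

text \<open>The outer derivative is the one along \<open>u\<close>.\<close>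

definition deriv2 ::
    "('a::real_normed_vector \<Rightarrow> 'b::real_normed_vector) \<Rightarrow> 'a \<Rightarrow> 'a \<Rightarrow> 'a \<Rightarrow> 'b" where
  "deriv2 f a u v = frechet_derivative (\<lambda>b. frechet_derivative f (at b) v) (at a) u"

context
  fixes S :: "'a::real_normed_vector set" and f :: "'a \<Rightarrow> 'b::real_normed_vector"
  assumes S: "open S" and f: "smooth_within S f"
begin

lemma smooth_within_has_derivative:
  "a \<in> S \<Longrightarrow> (f has_derivative frechet_derivative f (at a)) (at a)"
  by (rule smooth_within_frechet_derivative(1)[OF S f])

lemma smooth_within_has_derivative2:
  "a \<in> S \<Longrightarrow> ((\<lambda>b. frechet_derivative f (at b) v) has_derivative (\<lambda>u. deriv2 f a u v)) (at a)"
  using smooth_within_frechet_derivative(1)[OF S smooth_within_frechet_derivative(2)[OF S f]]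
  unfolding deriv2_def .

lemma linear_frechet_derivative: "a \<in> S \<Longrightarrow> linear (frechet_derivative f (at a))"
  using smooth_within_has_derivative has_derivative_linear by blast

lemma linear_deriv2_left: "a \<in> S \<Longrightarrow> linear (\<lambda>u. deriv2 f a u v)"
  using smooth_within_has_derivative2 has_derivative_linear by blast

lemma linear_deriv2_right:
  assumes "a \<in> S"
  shows "linear (\<lambda>v. deriv2 f a u v)"
proof
  have eqI: "h1 = h2" if "(h has_derivative h1) (at a)" "(h has_derivative h2) (at a)"
    for h :: "'a \<Rightarrow> 'b" and h1 h2
    using that has_derivative_unique by blast
  fix v w :: 'a and r :: real
  have "((\<lambda>b. frechet_derivative f (at b) v + frechet_derivative f (at b) w) has_derivative
      (\<lambda>u. deriv2 f a u v + deriv2 f a u w)) (at a)"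
    by (intro has_derivative_add smooth_within_has_derivative2 assms)
  then have "((\<lambda>b. frechet_derivative f (at b) (v + w)) has_derivative
      (\<lambda>u. deriv2 f a u v + deriv2 f a u w)) (at a)"
    by (rule has_derivative_transform_within_open[OF _ S assms])
      (simp add: linear_add[OF linear_frechet_derivative])
  from eqI[OF this smooth_within_has_derivative2[OF assms]]
  show "deriv2 f a u (v + w) = deriv2 f a u v + deriv2 f a u w" by metis
  have "((\<lambda>b. r *\<^sub>R frechet_derivative f (at b) v) has_derivative (\<lambda>u. r *\<^sub>R deriv2 f a u v)) (at a)"
    by (intro has_derivative_scaleR_right smooth_within_has_derivative2 assms)
  then have "((\<lambda>b. frechet_derivative f (at b) (r *\<^sub>R v)) has_derivative
      (\<lambda>u. r *\<^sub>R deriv2 f a u v)) (at a)"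
    by (rule has_derivative_transform_within_open[OF _ S assms])
      (simp add: linear_scale[OF linear_frechet_derivative])
  from eqI[OF this smooth_within_has_derivative2[OF assms]]
  show "deriv2 f a u (r *\<^sub>R v) = r *\<^sub>R deriv2 f a u v" by metis
qed

end

lemma has_real_derivative_along_line:
  fixes f :: "'a::real_normed_vector \<Rightarrow> real"
  assumes "(f has_derivative f') (at (c + s *\<^sub>R w))"
  shows "((\<lambda>s. f (c + s *\<^sub>R w)) has_real_derivative f' w) (at s)"
proof -
  have "((\<lambda>s. c + s *\<^sub>R w) has_derivative (\<lambda>r. r *\<^sub>R w)) (at s)"
    by (auto intro!: derivative_eq_intros)
  then have *: "((\<lambda>s. f (c + s *\<^sub>R w)) has_derivative (\<lambda>r. f' (r *\<^sub>R w))) (at s)"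
    using has_derivative_compose assms by blast
  have "linear f'" using assms has_derivative_linear by blast
  then have "(\<lambda>r. f' (r *\<^sub>R w)) = (*) (f' w)" by (auto simp: linear_scale)
  with * show ?thesis unfolding has_field_derivative_def by metis
qed

text \<open>The mean value theorem is applied first in the direction \<open>u\<close> and then in the direction \<open>v\<close>.
  The left-hand side is symmetric in \<open>u\<close> and \<open>v\<close>, so the two orders of differentiation agree at
  points arbitrarily close to \<open>a\<close>, and by continuity at \<open>a\<close>.\<close>

lemma second_difference_mvt:
  fixes f :: "'a::real_normed_vector \<Rightarrow> real"
  assumes S: "open S" and f: "smooth_within S f" and h: "0 < h"
    and box: "\<And>s t. \<lbrakk>0 \<le> s; s \<le> h; 0 \<le> t; t \<le> h\<rbrakk> \<Longrightarrow> a + s *\<^sub>R u + t *\<^sub>R v \<in> S"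
  shows "\<exists>s t. 0 \<le> s \<and> s \<le> h \<and> 0 \<le> t \<and> t \<le> h \<and>
    f (a + h *\<^sub>R u + h *\<^sub>R v) - f (a + h *\<^sub>R u) - f (a + h *\<^sub>R v) + f a
      = h * (h * deriv2 f (a + s *\<^sub>R u + t *\<^sub>R v) v u)"
proof -
  let ?g = "\<lambda>s. f (a + s *\<^sub>R u + h *\<^sub>R v) - f (a + s *\<^sub>R u)"
  let ?g' = "\<lambda>s. frechet_derivative f (at (a + s *\<^sub>R u + h *\<^sub>R v)) u
      - frechet_derivative f (at (a + s *\<^sub>R u)) u"
  have "DERIV ?g s :> ?g' s" if "0 \<le> s" "s \<le> h" for s
  proof (rule DERIV_diff)
    have "a + h *\<^sub>R v + s *\<^sub>R u \<in> S" using box[of s h] that h by (simp add: algebra_simps)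
    then have "((\<lambda>s. f (a + h *\<^sub>R v + s *\<^sub>R u)) has_real_derivative
        frechet_derivative f (at (a + h *\<^sub>R v + s *\<^sub>R u)) u) (at s)"
      by (intro has_real_derivative_along_line smooth_within_has_derivative[OF S f])
    then show "((\<lambda>s. f (a + s *\<^sub>R u + h *\<^sub>R v)) has_real_derivative
        frechet_derivative f (at (a + s *\<^sub>R u + h *\<^sub>R v)) u) (at s)"
      by (simp add: algebra_simps)
    show "((\<lambda>s. f (a + s *\<^sub>R u)) has_real_derivative
        frechet_derivative f (at (a + s *\<^sub>R u)) u) (at s)"
      using box[of s 0] that h by (intro has_real_derivative_along_line smooth_within_has_derivative[OF S f]) simp
  qed
  from MVT2[OF h this] obtain s where s: "0 < s" "s < h" "?g h - ?g 0 = (h - 0) * ?g' s"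
    by blast
  have "DERIV (\<lambda>t. frechet_derivative f (at (a + s *\<^sub>R u + t *\<^sub>R v)) u) t
      :> deriv2 f (a + s *\<^sub>R u + t *\<^sub>R v) v u" if "0 \<le> t" "t \<le> h" for t
    using box[of s t] that s by (intro has_real_derivative_along_line smooth_within_has_derivative2[OF S f]) simp
  from MVT2[OF h this] obtain t where t: "0 < t" "t < h"
    "?g' s = (h - 0) * deriv2 f (a + s *\<^sub>R u + t *\<^sub>R v) v u" by auto
  show ?thesis using s t by (intro exI[of _ s] exI[of _ t]) (simp add: algebra_simps)
qed

lemma deriv2_commute_real:
  fixes f :: "'a::real_normed_vector \<Rightarrow> real"
  assumes S: "open S" and f: "smooth_within S f" and a: "a \<in> S"
  shows "deriv2 f a u v = deriv2 f a v u"
proof (rule ccontr)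
  assume ne: "deriv2 f a u v \<noteq> deriv2 f a v u"
  define e where "e = \<bar>deriv2 f a u v - deriv2 f a v u\<bar> / 2"
  have e: "e > 0" using ne by (simp add: e_def)
  have cont: "continuous_on S (\<lambda>b. deriv2 f b u' v')" for u' v'
    unfolding deriv2_def
    by (intro smooth_within_continuous_on smooth_within_frechet_derivative(2) S f)
  have "\<exists>d>0. \<forall>b. norm (b - a) < d \<longrightarrow> b \<in> S \<and> \<bar>deriv2 f b u' v' - deriv2 f a u' v'\<bar> < e"
    for u' v'
  proof -
    have "continuous (at a) (\<lambda>b. deriv2 f b u' v')"
      using cont[of u' v'] a S by (simp add: continuous_on_eq_continuous_at)
    then obtain d1 where d1: "d1 > 0" "\<And>b. dist b a < d1 \<Longrightarrow> dist (deriv2 f b u' v') (deriv2 f a u' v') < e"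
      using e unfolding continuous_at_eps_delta by blast
    obtain d2 where d2: "d2 > 0" "ball a d2 \<subseteq> S" using S a open_contains_ball by blast
    have "b \<in> S \<and> \<bar>deriv2 f b u' v' - deriv2 f a u' v'\<bar> < e" if "norm (b - a) < min d1 d2" for b
    proof -
      have "dist b a < d1" "b \<in> ball a d2" using that by (auto simp: dist_norm norm_minus_commute)
      then show ?thesis using d1(2) d2(2) by (auto simp: dist_real_def)
    qed
    then show ?thesis using d1(1) d2(1) by (intro exI[of _ "min d1 d2"]) auto
  qed
  then obtain d1 d2 where d: "d1 > 0" "d2 > 0"
    "\<And>b. norm (b - a) < d1 \<Longrightarrow> b \<in> S \<and> \<bar>deriv2 f b u v - deriv2 f a u v\<bar> < e"
    "\<And>b. norm (b - a) < d2 \<Longrightarrow> b \<in> S \<and> \<bar>deriv2 f b v u - deriv2 f a v u\<bar> < e"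
    by metis
  define h where "h = min d1 d2 / (norm u + norm v + 1)"
  have pos: "norm u + norm v + 1 > 0" by (simp add: add_nonneg_pos)
  have h: "h > 0" using d(1,2) pos by (simp add: h_def)
  have "h * (norm u + norm v + 1) = min d1 d2" using pos by (simp add: h_def)
  moreover have "h * (norm u + norm v + 1) = h + (h * norm u + h * norm v)"
    by (simp add: algebra_simps)
  ultimately have hlt: "h * norm u + h * norm v < min d1 d2" using h by linarith
  have small: "norm (s *\<^sub>R u + t *\<^sub>R v) < min d1 d2" if "0 \<le> s" "s \<le> h" "0 \<le> t" "t \<le> h" for s t
  proof -
    have "norm (s *\<^sub>R u + t *\<^sub>R v) \<le> norm (s *\<^sub>R u) + norm (t *\<^sub>R v)" by (rule norm_triangle_ineq)
    also have "\<dots> \<le> h * norm u + h * norm v" using that by (intro add_mono) (auto intro: mult_right_mono)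
    finally show ?thesis using hlt by simp
  qed
  have near: "norm (a + s *\<^sub>R u + t *\<^sub>R v - a) < min d1 d2"
    if "0 \<le> s" "s \<le> h" "0 \<le> t" "t \<le> h" for s t
    using small[OF that] by (simp add: add.assoc)
  have box: "a + s *\<^sub>R u + t *\<^sub>R v \<in> S" if "0 \<le> s" "s \<le> h" "0 \<le> t" "t \<le> h" for s t
    using near[OF that] d(3) by simp
  have box': "a + s *\<^sub>R v + t *\<^sub>R u \<in> S" if "0 \<le> s" "s \<le> h" "0 \<le> t" "t \<le> h" for s t
    using box[of t s] that by (simp add: algebra_simps)
  obtain s t where st: "0 \<le> s" "s \<le> h" "0 \<le> t" "t \<le> h" and
    1: "f (a + h *\<^sub>R u + h *\<^sub>R v) - f (a + h *\<^sub>R u) - f (a + h *\<^sub>R v) + f a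
      = h * (h * deriv2 f (a + s *\<^sub>R u + t *\<^sub>R v) v u)"
    using second_difference_mvt[OF S f h box] by blast
  obtain s' t' where st': "0 \<le> s'" "s' \<le> h" "0 \<le> t'" "t' \<le> h" and
    2: "f (a + h *\<^sub>R v + h *\<^sub>R u) - f (a + h *\<^sub>R v) - f (a + h *\<^sub>R u) + f a
      = h * (h * deriv2 f (a + s' *\<^sub>R v + t' *\<^sub>R u) u v)"
    using second_difference_mvt[OF S f h box'] by blast
  have "h * (h * deriv2 f (a + s *\<^sub>R u + t *\<^sub>R v) v u) = h * (h * deriv2 f (a + s' *\<^sub>R v + t' *\<^sub>R u) u v)"
    using 1 2 by (simp add: algebra_simps)
  then have eq: "deriv2 f (a + s *\<^sub>R u + t *\<^sub>R v) v u = deriv2 f (a + t' *\<^sub>R u + s' *\<^sub>R v) u v"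
    using h by (simp add: algebra_simps)
  have "\<bar>deriv2 f (a + s *\<^sub>R u + t *\<^sub>R v) v u - deriv2 f a v u\<bar> < e"
    using near[OF st] d(4) by simp
  moreover have "\<bar>deriv2 f (a + t' *\<^sub>R u + s' *\<^sub>R v) u v - deriv2 f a u v\<bar> < e"
    using near[OF st'(3,4,1,2)] d(3) by simp
  ultimately have "\<bar>deriv2 f a u v - deriv2 f a v u\<bar> < 2 * e" using eq by linarith
  then show False by (simp add: e_def)
qed

lemma deriv2_commute:
  fixes f :: "'a::real_normed_vector \<Rightarrow> 'b::real_inner"
  assumes S: "open S" and f: "smooth_within S f" and a: "a \<in> S"
  shows "deriv2 f a u v = deriv2 f a v u"
proof -
  have "deriv2 f a u v \<bullet> w = deriv2 f a v u \<bullet> w" for w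
  proof -
    define g where "g = (\<lambda>b. f b \<bullet> w)"
    have g: "smooth_within S g" unfolding g_def
      by (intro smooth_within_inner f smooth_within_const)
    have 1: "frechet_derivative f (at b) v \<bullet> w = frechet_derivative g (at b) v" if "b \<in> S" for b v
    proof -
      have "(g has_derivative (\<lambda>v. frechet_derivative f (at b) v \<bullet> w)) (at b)"
        unfolding g_def by (intro has_derivative_inner_left smooth_within_has_derivative[OF S f that])
      then have "(\<lambda>v. frechet_derivative f (at b) v \<bullet> w) = frechet_derivative g (at b)"
        by (rule frechet_derivative_at)
      then show ?thesis by metis
    qed
    have 2: "deriv2 g a u v = deriv2 f a u v \<bullet> w" for u v
    proof -
      have "((\<lambda>b. frechet_derivative f (at b) v \<bullet> w) has_derivative (\<lambda>u. deriv2 f a u v \<bullet> w)) (at a)"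
        by (intro has_derivative_inner_left smooth_within_has_derivative2[OF S f a])
      then have "((\<lambda>b. frechet_derivative g (at b) v) has_derivative (\<lambda>u. deriv2 f a u v \<bullet> w)) (at a)"
        by (rule has_derivative_transform_within_open[OF _ S a]) (rule 1)
      then have "(\<lambda>u. deriv2 f a u v \<bullet> w) = (\<lambda>u. deriv2 g a u v)"
        using smooth_within_has_derivative2[OF S g a] has_derivative_unique by blast
      then show ?thesis by metis
    qed
    show ?thesis using deriv2_commute_real[OF S g a, of u v] by (simp add: 2)
  qed
  then show ?thesis by (metis inner_commute vector_eq_ldot)
qed

section \<open>Conjugate pairs of immersions\<close>

text \<open>This is the local form of the two embeddings in a chart: \<open>ln (F a \<bullet> G b)\<close> plays the role of the
  divergence, and negativity on the diagonal says that the metric it induces is positive definite.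
  The roles of \<open>F\<close> and \<open>G\<close> are symmetric.\<close>

locale conjugate_immersions =
  fixes V :: "(real ^ 'm::finite) set" and F G :: "real ^ 'm \<Rightarrow> real ^ 'n::finite"
  assumes card: "CARD('n) = Suc CARD('m)"
    and open_V: "open V"
    and smooth_F: "smooth_within V F" and smooth_G: "smooth_within V G"
    and pairing_ge_1: "\<And>a b. a \<in> V \<Longrightarrow> b \<in> V \<Longrightarrow> 1 \<le> F a \<bullet> G b"
    and pairing_eq_1: "\<And>a. a \<in> V \<Longrightarrow> F a \<bullet> G a = 1"
    and negative: "\<And>a v. a \<in> V \<Longrightarrow> v \<noteq> 0 \<Longrightarrow>
      frechet_derivative F (at a) v \<bullet> frechet_derivative G (at a) v < 0"
begin

abbreviation "DF a \<equiv> frechet_derivative F (at a)"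
abbreviation "DG a \<equiv> frechet_derivative G (at a)"

lemmas DF = smooth_within_has_derivative[OF open_V smooth_F]
lemmas DG = smooth_within_has_derivative[OF open_V smooth_G]
lemmas DDF = smooth_within_has_derivative2[OF open_V smooth_F]
lemmas DDG = smooth_within_has_derivative2[OF open_V smooth_G]
lemmas linear_DF = linear_frechet_derivative[OF open_V smooth_F]
lemmas linear_DG = linear_frechet_derivative[OF open_V smooth_G]

lemma swap: "conjugate_immersions V G F"
  using card open_V smooth_F smooth_G pairing_ge_1 pairing_eq_1 negative
  by unfold_locales (simp_all add: inner_commute)

text \<open>For fixed \<open>a\<close> the function \<open>\<lambda>b. F b \<bullet> G a\<close> has its minimum at \<open>b = a\<close>.\<close>

lemma DF_orthogonal:
  assumes a: "a \<in> V"
  shows "DF a v \<bullet> G a = 0"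
proof -
  have "(\<lambda>v. DF a v \<bullet> G a) = (\<lambda>v. 0)"
  proof (rule differential_zero_maxmin[OF a open_V])
    show "((\<lambda>b. F b \<bullet> G a) has_derivative (\<lambda>v. DF a v \<bullet> G a)) (at a)"
      by (intro has_derivative_inner_left DF a)
    show "(\<forall>y\<in>V. F y \<bullet> G a \<le> F a \<bullet> G a) \<or> (\<forall>y\<in>V. F a \<bullet> G a \<le> F y \<bullet> G a)"
      using pairing_ge_1 pairing_eq_1 a by simp
  qed
  then show ?thesis by metis
qed

lemma DG_orthogonal: "a \<in> V \<Longrightarrow> F a \<bullet> DG a v = 0"
  using conjugate_immersions.DF_orthogonal[OF swap] by (simp add: inner_commute)

text \<open>Differentiate the orthogonality \<open>DF b v \<bullet> G b = 0\<close> in \<open>b\<close> along \<open>u\<close>.\<close>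

lemma DF_DG_eq_deriv2:
  assumes a: "a \<in> V"
  shows "DF a v \<bullet> DG a u = - (deriv2 F a u v \<bullet> G a)"
proof -
  have "((\<lambda>b. DF b v \<bullet> G b) has_derivative (\<lambda>u. DF a v \<bullet> DG a u + deriv2 F a u v \<bullet> G a)) (at a)"
    by (intro has_derivative_inner DDF DG a)
  then have "((\<lambda>b. 0) has_derivative (\<lambda>u. DF a v \<bullet> DG a u + deriv2 F a u v \<bullet> G a)) (at a)"
    by (rule has_derivative_transform_within_open[OF _ open_V a]) (simp add: DF_orthogonal)
  from has_derivative_unique[OF this has_derivative_const]
  have "DF a v \<bullet> DG a u + deriv2 F a u v \<bullet> G a = 0" by metis
  then show ?thesis by simp
qed

lemma DF_DG_commute: "a \<in> V \<Longrightarrow> DF a u \<bullet> DG a v = DF a v \<bullet> DG a u"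
  by (simp add: DF_DG_eq_deriv2 deriv2_commute[OF open_V smooth_F])

lemma inj_DF: "a \<in> V \<Longrightarrow> inj (DF a)"
  using negative[of a] linear_injective_0[OF linear_DF] by fastforce

text \<open>The vector \<open>G a\<close> is not in the range of \<open>DG a\<close>, as it pairs with \<open>F a\<close> to \<open>1\<close> and the range
  pairs with \<open>F a\<close> to \<open>0\<close>.  By the dimension count the two span the ambient space.\<close>

lemma eq_0_if_orthogonal:
  assumes a: "a \<in> V" and Z: "Z \<bullet> G a = 0" "\<And>v. Z \<bullet> DG a v = 0"
  shows "Z = 0"
proof -
  have inj: "inj (DG a)" by (rule conjugate_immersions.inj_DF[OF swap a])
  have notin: "G a \<notin> range (DG a)"
  proof
    assume "G a \<in> range (DG a)"
    then obtain v where "G a = DG a v" by blast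
    then show False using pairing_eq_1[OF a] DG_orthogonal[OF a, of v] by simp
  qed
  have sub: "subspace (range (DG a))"
    using linear_DG[OF a] linear_subspace_image subspace_UNIV by blast
  have "dim (range (DG a)) = CARD('m)"
    using dim_image_eq[OF linear_DG[OF a], of UNIV] inj by (simp add: dim_UNIV)
  then have "dim (insert (G a) (range (DG a))) = DIM(real ^ 'n)"
    using notin sub card by (simp add: dim_insert span_eq_iff[THEN iffD2])
  then have "span (insert (G a) (range (DG a))) = UNIV" using dim_eq_full by blast
  then have "Z \<in> span (insert (G a) (range (DG a)))" by simp
  moreover have "orthogonal Z y" if "y \<in> insert (G a) (range (DG a))" for y
    using that Z by (auto simp: orthogonal_def)
  ultimately have "orthogonal Z Z" using orthogonal_to_span by blast
  then show ?thesis by (simp add: orthogonal_def)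
qed

text \<open>The matrix of the metric induced by \<open>ln (F a \<bullet> G b)\<close>; see \<open>gram_eq_partials\<close>.\<close>

definition gram :: "real ^ 'm \<Rightarrow> real ^ 'm ^ 'm" where
  "gram a = (\<chi> i j. - (DF a (axis i 1) \<bullet> DG a (axis j 1)))"

lemma gram_mult: "a \<in> V \<Longrightarrow> gram a *v v = (\<chi> i. - (DF a (axis i 1) \<bullet> DG a v))"
  by (simp add: matrix_vector_mult_def gram_def linear_axis_sum[OF linear_DG, of a v]
      inner_sum_right vec_eq_iff mult.commute sum_negf)

lemma gram_symmetric: "a \<in> V \<Longrightarrow> gram a $ i $ j = gram a $ j $ i"
  by (simp add: gram_def DF_DG_commute)

lemma gram_det:
  assumes a: "a \<in> V"
  shows "det (gram a) \<noteq> 0"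
proof
  assume "det (gram a) = 0"
  then obtain v where v: "v \<noteq> 0" "gram a *v v = 0"
    using invertible_det_nz[of "gram a"] invertible_left_inverse[of "gram a"]
      matrix_left_invertible_ker[of "gram a"] by blast
  have "DF a v \<bullet> DG a v = (\<Sum>j\<in>UNIV. v $ j * (DF a (axis j 1) \<bullet> DG a v))"
    by (subst (1) linear_axis_sum[OF linear_DF[OF a]]) (simp add: inner_sum_left)
  also have "\<dots> = 0" using v(2) gram_mult[OF a, of v] by (simp add: vec_eq_iff)
  finally show False using negative[OF a v(1)] by simp
qed

lemma gram_cancel:
  assumes a: "a \<in> V"
  shows "gram a *v v = gram a *v w \<longleftrightarrow> v = w"
proof
  assume "gram a *v v = gram a *v w"
  then have "matrix_inv (gram a) *v (gram a *v v) = matrix_inv (gram a) *v (gram a *v w)" by simp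
  then show "v = w" by (simp add: matrix_vector_mul_assoc matrix_inv_mult(2)[OF gram_det[OF a]])
qed simp

lemma gram_matrix_inv: "a \<in> V \<Longrightarrow> gram a *v (matrix_inv (gram a) *v v) = v"
  by (simp add: matrix_vector_mul_assoc matrix_inv_mult(1)[OF gram_det])

lemma matrix_inv_gram_symmetric:
  assumes a: "a \<in> V"
  shows "matrix_inv (gram a) $ i $ j = matrix_inv (gram a) $ j $ i"
proof -
  have "transpose (gram a) = gram a"
    using gram_symmetric[OF a] by (simp add: transpose_def vec_eq_iff)
  then have 1: "transpose (matrix_inv (gram a)) ** gram a = mat 1"
    using matrix_inv_mult(1)[OF gram_det[OF a]] by (metis matrix_transpose_mul transpose_mat)
  have "transpose (matrix_inv (gram a)) = transpose (matrix_inv (gram a)) ** (gram a ** matrix_inv (gram a))"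
    by (simp add: matrix_inv_mult(1)[OF gram_det[OF a]])
  also have "\<dots> = matrix_inv (gram a)" by (simp add: matrix_mul_assoc 1)
  finally show ?thesis by (simp add: transpose_def vec_eq_iff)
qed

text \<open>The coordinate form of the gradient equation is the pairing of the embedded equation with the
  derivatives of \<open>G\<close>; its pairing with \<open>G\<close> itself holds because both sides give \<open>0\<close>.\<close>

lemma gradient_iff:
  assumes a: "a \<in> V" and w: "w \<bullet> G a \<noteq> 0"
  shows "u = - (\<chi> i. \<Sum>j\<in>UNIV. matrix_inv (gram a) $ i $ j * ((w \<bullet> DG a (axis j 1)) / (w \<bullet> G a)))
    \<longleftrightarrow> DF a u = (1 / (w \<bullet> G a)) *\<^sub>R w - F a"
    (is "u = - ?g \<longleftrightarrow> _")
proof -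
  define b where "b = (\<chi> j. (w \<bullet> DG a (axis j 1)) / (w \<bullet> G a))"
  have g: "?g = matrix_inv (gram a) *v b" by (simp add: matrix_vector_mult_def b_def)
  define Z where "Z = DF a u - ((1 / (w \<bullet> G a)) *\<^sub>R w - F a)"
  have "u = - ?g \<longleftrightarrow> gram a *v u = gram a *v (- ?g)"
    by (simp only: gram_cancel[OF a])
  also have "gram a *v (- ?g) = - b"
    unfolding g using gram_matrix_inv[OF a, of b]
    by (simp add: linear_neg[OF matrix_vector_mul_linear])
  also have "gram a *v u = - b \<longleftrightarrow> (\<forall>i. Z \<bullet> DG a (axis i 1) = 0)"
    by (simp add: gram_mult[OF a] b_def vec_eq_iff Z_def inner_diff_left DG_orthogonal[OF a]
        DF_DG_commute[OF a, of "axis _ 1"])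
  also have "\<dots> \<longleftrightarrow> Z = 0"
  proof
    assume "\<forall>i. Z \<bullet> DG a (axis i 1) = 0"
    then have "Z \<bullet> DG a v = 0" for v
      by (subst linear_axis_sum[OF linear_DG[OF a]]) (simp add: inner_sum_right)
    moreover have "Z \<bullet> G a = 0"
      using w by (simp add: Z_def inner_diff_left DF_orthogonal[OF a] pairing_eq_1[OF a])
    ultimately show "Z = 0" using eq_0_if_orthogonal[OF a] by blast
  qed simp
  finally show ?thesis by (simp add: Z_def)
qed

text \<open>The vector \<open>deriv2 F a u u + DF a w\<close> is the acceleration of \<open>F\<close> along a curve with velocity \<open>u\<close>
  and acceleration \<open>w\<close>.  Lowering the index of the geodesic equation pairs it with the derivatives
  of \<open>G\<close>, and the common orthogonal complement of these is the line through \<open>F a\<close>.\<close>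

lemma geodesic_iff:
  assumes a: "a \<in> V"
  shows "(\<forall>k. w $ k + (\<Sum>i\<in>UNIV. \<Sum>j\<in>UNIV.
        (\<Sum>m\<in>UNIV. - (deriv2 F a (axis i 1) (axis j 1) \<bullet> DG a (axis m 1)) * matrix_inv (gram a) $ m $ k)
          * u $ i * u $ j) = 0)
    \<longleftrightarrow> (\<exists>\<rho>. deriv2 F a u u + DF a w = \<rho> *\<^sub>R F a)"
proof -
  define E where "E = (\<chi> m. - (deriv2 F a u u \<bullet> DG a (axis m 1)))"
  have D2: "deriv2 F a u u = (\<Sum>i\<in>UNIV. \<Sum>j\<in>UNIV. (u $ i * u $ j) *\<^sub>R deriv2 F a (axis i 1) (axis j 1))"
  proof -
    have "deriv2 F a u u = (\<Sum>i\<in>UNIV. u $ i *\<^sub>R deriv2 F a (axis i 1) u)"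
      by (rule linear_axis_sum[OF linear_deriv2_left[OF open_V smooth_F a]])
    moreover have "deriv2 F a (axis i 1) u = (\<Sum>j\<in>UNIV. u $ j *\<^sub>R deriv2 F a (axis i 1) (axis j 1))"
      for i by (rule linear_axis_sum[OF linear_deriv2_right[OF open_V smooth_F a]])
    ultimately show ?thesis by (simp add: scaleR_sum_right)
  qed
  have "(\<Sum>i\<in>UNIV. \<Sum>j\<in>UNIV.
        (\<Sum>m\<in>UNIV. - (deriv2 F a (axis i 1) (axis j 1) \<bullet> DG a (axis m 1)) * matrix_inv (gram a) $ m $ k)
          * u $ i * u $ j) = (matrix_inv (gram a) *v E) $ k" for k
  proof -
    have "(matrix_inv (gram a) *v E) $ k = (\<Sum>m\<in>UNIV. \<Sum>i\<in>UNIV. \<Sum>j\<in>UNIV.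
        - (deriv2 F a (axis i 1) (axis j 1) \<bullet> DG a (axis m 1)) * matrix_inv (gram a) $ m $ k * u $ i * u $ j)"
      by (simp add: matrix_vector_mult_def E_def D2 inner_sum_left sum_distrib_left sum_negf[symmetric]
          matrix_inv_gram_symmetric[OF a, of k] mult_ac)
    also have "\<dots> = (\<Sum>i\<in>UNIV. \<Sum>j\<in>UNIV. \<Sum>m\<in>UNIV.
        - (deriv2 F a (axis i 1) (axis j 1) \<bullet> DG a (axis m 1)) * matrix_inv (gram a) $ m $ k * u $ i * u $ j)"
      by (subst sum.swap, rule sum.cong[OF refl], rule sum.swap)
    finally show ?thesis by (simp add: sum_distrib_right)
  qed
  then have "(\<forall>k. w $ k + (\<Sum>i\<in>UNIV. \<Sum>j\<in>UNIV.
        (\<Sum>m\<in>UNIV. - (deriv2 F a (axis i 1) (axis j 1) \<bullet> DG a (axis m 1)) * matrix_inv (gram a) $ m $ k)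
          * u $ i * u $ j) = 0) \<longleftrightarrow> w + matrix_inv (gram a) *v E = 0"
    by (simp add: vec_eq_iff)
  also have "\<dots> \<longleftrightarrow> gram a *v (w + matrix_inv (gram a) *v E) = gram a *v 0"
    by (simp only: gram_cancel[OF a])
  also have "\<dots> \<longleftrightarrow> gram a *v w + E = 0"
    by (simp add: matrix_vector_right_distrib gram_matrix_inv[OF a])
  also have "\<dots> \<longleftrightarrow> (\<forall>m. (deriv2 F a u u + DF a w) \<bullet> DG a (axis m 1) = 0)"
    by (simp add: gram_mult[OF a] E_def vec_eq_iff inner_add_left DF_DG_commute[OF a, of "axis _ 1"]
        algebra_simps neg_eq_iff_add_eq_0)
  also have "\<dots> \<longleftrightarrow> (\<exists>\<rho>. deriv2 F a u u + DF a w = \<rho> *\<^sub>R F a)"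
  proof
    define X where "X = deriv2 F a u u + DF a w"
    assume "\<forall>m. (deriv2 F a u u + DF a w) \<bullet> DG a (axis m 1) = 0"
    then have "X \<bullet> DG a v = 0" for v
      by (subst linear_axis_sum[OF linear_DG[OF a]]) (simp add: inner_sum_right X_def)
    then have "(X - (X \<bullet> G a) *\<^sub>R F a) \<bullet> DG a v = 0" for v
      by (simp add: inner_diff_left DG_orthogonal[OF a])
    moreover have "(X - (X \<bullet> G a) *\<^sub>R F a) \<bullet> G a = 0"
      by (simp add: inner_diff_left pairing_eq_1[OF a])
    ultimately have "X - (X \<bullet> G a) *\<^sub>R F a = 0" using eq_0_if_orthogonal[OF a] by blast
    then show "\<exists>\<rho>. deriv2 F a u u + DF a w = \<rho> *\<^sub>R F a" unfolding X_def by auto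
  qed (auto simp: DG_orthogonal[OF a])
  finally show ?thesis .
qed

end

lemma partial_eq:
  assumes "(g has_derivative g') (at c)" "open V" "c \<in> V" "\<And>a. a \<in> V \<Longrightarrow> f a = g a"
  shows "partial i f c = g' (axis i 1)"
proof -
  have f: "(f has_derivative g') (at c)"
    using has_derivative_transform_within_open[OF assms(1-3)] assms(4) by simp
  have "((\<lambda>h. f (c + h *\<^sub>R axis i 1)) has_real_derivative g' (axis i 1)) (at 0)"
    by (rule has_real_derivative_along_line) (simp add: f)
  then show ?thesis unfolding partial_def dirderiv_def by (rule DERIV_imp_deriv)
qed

context conjugate_immersions
begin

lemma pairing_pos: "a \<in> V \<Longrightarrow> b \<in> V \<Longrightarrow> 0 < F a \<bullet> G b"
  using pairing_ge_1[of a b] by linarith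

lemma partial_ln_pairing:
  assumes f: "\<And>b. b \<in> V \<Longrightarrow> f b = ln (w \<bullet> G b)" and w: "\<And>b. b \<in> V \<Longrightarrow> w \<bullet> G b > 0" and c: "c \<in> V"
  shows "partial j f c = (w \<bullet> DG c (axis j 1)) / (w \<bullet> G c)"
proof (rule partial_eq[OF _ open_V c f])
  show "((\<lambda>b. ln (w \<bullet> G b)) has_derivative (\<lambda>v. (w \<bullet> DG c v) / (w \<bullet> G c))) (at c)"
    using w[OF c] by (auto intro!: derivative_eq_intros DG c simp: divide_inverse)
qed

context
  fixes T :: "real ^ 'm \<Rightarrow> real ^ 'm \<Rightarrow> real"
  assumes T: "\<And>a b. a \<in> V \<Longrightarrow> b \<in> V \<Longrightarrow> T a b = ln (F a \<bullet> G b)"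
begin

lemma partial_second: "a \<in> V \<Longrightarrow> c \<in> V \<Longrightarrow>
    partial j (\<lambda>b. T a b) c = (F a \<bullet> DG c (axis j 1)) / (F a \<bullet> G c)"
  by (rule partial_ln_pairing) (auto simp: T pairing_pos)

lemma has_derivative_quotient_first:
  assumes a: "a \<in> V" and c: "c \<in> V"
  shows "((\<lambda>a. (F a \<bullet> w) / (F a \<bullet> G c)) has_derivative
    (\<lambda>v. (DF a v \<bullet> w) / (F a \<bullet> G c) - (F a \<bullet> w) * (DF a v \<bullet> G c) / (F a \<bullet> G c)\<^sup>2)) (at a)"
  using pairing_pos[OF a c]
  by (auto intro!: derivative_eq_intros DF a simp: divide_simps power2_eq_square)

lemma partial_first_second: "a \<in> V \<Longrightarrow> c \<in> V \<Longrightarrow>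
    partial i (\<lambda>a. partial j (\<lambda>b. T a b) c) a =
    (DF a (axis i 1) \<bullet> DG c (axis j 1)) / (F a \<bullet> G c)
      - (F a \<bullet> DG c (axis j 1)) * (DF a (axis i 1) \<bullet> G c) / (F a \<bullet> G c)\<^sup>2"
  by (rule partial_eq[OF has_derivative_quotient_first open_V]) (auto simp: partial_second)

text \<open>On the diagonal the terms with \<open>F \<bullet> DG\<close> or \<open>DF \<bullet> G\<close> vanish and all denominators are \<open>1\<close>.\<close>

lemma gram_eq_partials:
  "c \<in> V \<Longrightarrow> (\<chi> i j. - partial i (\<lambda>a. partial j (\<lambda>b. T a b) c) c) = gram c"
  by (simp add: partial_first_second gram_def vec_eq_iff pairing_eq_1 DG_orthogonal)

lemma partial_first_first_second:
  assumes c: "c \<in> V"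
  shows "partial i (\<lambda>a. partial j (\<lambda>a'. partial k (\<lambda>b. T a' b) c) a) c
    = deriv2 F c (axis i 1) (axis j 1) \<bullet> DG c (axis k 1)"
proof -
  define f where "f a = (DF a (axis j 1) \<bullet> DG c (axis k 1)) / (F a \<bullet> G c)
      - (F a \<bullet> DG c (axis k 1)) * (DF a (axis j 1) \<bullet> G c) / (F a \<bullet> G c)\<^sup>2" for a
  have "(f has_derivative (\<lambda>v. deriv2 F c v (axis j 1) \<bullet> DG c (axis k 1))) (at c)"
    unfolding f_def
    by (auto intro!: derivative_eq_intros DF DDF c simp: pairing_eq_1[OF c] DF_orthogonal[OF c] DG_orthogonal[OF c])
  then show ?thesis
    by (rule partial_eq[OF _ open_V c]) (simp add: f_def partial_first_second c)
qed

lemma partial_first_second_second: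
  assumes c: "c \<in> V"
  shows "partial k (\<lambda>a. partial i (\<lambda>b. partial j (\<lambda>b'. T a b') b) c) c
    = DF c (axis k 1) \<bullet> deriv2 G c (axis i 1) (axis j 1)"
proof -
  define g where "g a = (F a \<bullet> deriv2 G c (axis i 1) (axis j 1)) / (F a \<bullet> G c)
      - (F a \<bullet> DG c (axis j 1)) * (F a \<bullet> DG c (axis i 1)) / (F a \<bullet> G c)\<^sup>2" for a
  have 1: "partial i (\<lambda>b. partial j (\<lambda>b'. T a b') b) c = g a" if a: "a \<in> V" for a
  proof -
    have "((\<lambda>b. (F a \<bullet> DG b (axis j 1)) / (F a \<bullet> G b)) has_derivative
      (\<lambda>v. (F a \<bullet> deriv2 G c v (axis j 1)) / (F a \<bullet> G c)
        - (F a \<bullet> DG c (axis j 1)) * (F a \<bullet> DG c v) / (F a \<bullet> G c)\<^sup>2)) (at c)"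
      using pairing_pos[OF a c]
      by (auto intro!: derivative_eq_intros DG DDG c simp: divide_simps power2_eq_square)
    from partial_eq[OF this open_V c, of "\<lambda>b. partial j (\<lambda>b'. T a b') b" i]
    show ?thesis by (simp add: partial_second a g_def)
  qed
  have "(g has_derivative (\<lambda>v. DF c v \<bullet> deriv2 G c (axis i 1) (axis j 1))) (at c)"
    unfolding g_def
    by (auto intro!: derivative_eq_intros DF c simp: pairing_eq_1[OF c] DF_orthogonal[OF c] DG_orthogonal[OF c])
  then show ?thesis by (rule partial_eq[OF _ open_V c]) (rule 1)
qed

end

end

section \<open>An affine chart of the simplex\<close>

lemma smooth_on_affine:
  assumes "bounded_linear L"
  shows "smooth_on S (\<lambda>a. c + L a)"
proof -
  have const: "Ck_on k S (\<lambda>a. w)" for k and w :: 'b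
  proof (induction k arbitrary: w)
    case (Suc k)
    have "frechet_derivative (\<lambda>a. w) (at a) = (\<lambda>v. 0)" for a :: 'a
      using frechet_derivative_const .
    then show ?case using Suc by simp
  qed simp
  have der: "((\<lambda>a. c + L a) has_derivative L) (at a)" for a
    using bounded_linear_imp_has_derivative[OF assms]
    by (auto intro!: derivative_eq_intros simp: fun_eq_iff)
  have diff: "(\<lambda>a. c + L a) differentiable (at a)" for a
    using der unfolding differentiable_def by blast
  have "frechet_derivative (\<lambda>a. c + L a) (at a) = L" for a
    using frechet_derivative_at[OF der, of a] by simp
  then have "Ck_on k S (\<lambda>a. c + L a)" for k
  proof (cases k)
    case 0
    have "continuous_on S (\<lambda>a. c + L a)"
      using der has_derivative_continuous by (intro continuous_at_imp_continuous_on) blast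
    then show ?thesis using 0 by simp
  qed (use const diff in auto)
  then show ?thesis by (simp add: smooth_on_def)
qed

lemma convex_simplex_int: "convex simplex_int"
  unfolding convex_def
proof (intro ballI allI impI)
  fix p q :: "real ^ 'n" and u v :: real
  assume pq: "p \<in> simplex_int" "q \<in> simplex_int" and uv: "0 \<le> u" "0 \<le> v" "u + v = 1"
  have "0 < (u *\<^sub>R p + v *\<^sub>R q) $ i" for i
  proof (cases "u = 0")
    case False
    then have "0 < u * p $ i" "0 \<le> v * q $ i"
      using pq uv by (auto simp: simplex_int_def intro!: mult_pos_pos mult_nonneg_nonneg)
        (simp add: less_imp_le)
    then show ?thesis by simp
  qed (use pq uv in \<open>simp add: simplex_int_def\<close>)
  moreover have "(\<Sum>i\<in>UNIV. (u *\<^sub>R p + v *\<^sub>R q) $ i) = u * (\<Sum>i\<in>UNIV. p $ i) + v * (\<Sum>i\<in>UNIV. q $ i)"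
    by (simp add: sum.distrib sum_distrib_left)
  ultimately show "u *\<^sub>R p + v *\<^sub>R q \<in> simplex_int"
    using pq uv by (simp add: simplex_int_def)
qed

text \<open>The chart omits one barycentric coordinate \<open>i0\<close>.  Both \<open>P\<close> and the linear part \<open>L\<close> are kept on the
  whole space, as \<open>L\<close> identifies coordinate directions with tangent vectors of the simplex.\<close>

lemma affine_chart_exists:
  assumes "CARD('n::finite) \<ge> 2" and "CARD('m::finite) = CARD('n) - 1"
  obtains L :: "real ^ 'm \<Rightarrow> real ^ 'n" and P :: "real ^ 'n \<Rightarrow> real ^ 'm" and c :: "real ^ 'n" and \<Omega>
  where "linear L" "linear P" "\<And>a. P (c + L a) = a" "\<And>p. (\<Sum>i\<in>UNIV. p $ i) = 1 \<Longrightarrow> c + L (P p) = p"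
    "\<And>a. L a \<in> tangent_space" "\<And>v. v \<in> tangent_space \<Longrightarrow> L (P v) = v"
    "open \<Omega>" "convex \<Omega>" "(\<lambda>a. c + L a) ` \<Omega> = simplex_int" "coordinate_system \<Omega> (\<lambda>a. c + L a) P"
proof -
  define i0 :: 'n where "i0 = undefined"
  have "card (UNIV - {i0}) = CARD('m)" using assms(2) by simp
  then obtain e :: "'m \<Rightarrow> 'n" where e: "bij_betw e UNIV (UNIV - {i0})"
    by (metis finite finite_same_card_bij)
  have inj: "inj e" and range: "range e = UNIV - {i0}" using e by (auto simp: bij_betw_def)
  define c :: "real ^ 'n" where "c = axis i0 1"
  define L :: "real ^ 'm \<Rightarrow> real ^ 'n"
    where "L a = (\<chi> i. if i = i0 then - (\<Sum>j\<in>UNIV. a $ j) else a $ (inv e i))" for a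
  define P :: "real ^ 'n \<Rightarrow> real ^ 'm" where "P p = (\<chi> j. p $ e j)" for p
  have e_i0: "e j \<noteq> i0" for j using range by auto
  have inv_e: "inv e (e j) = j" for j using inj by simp
  have e_inv: "e (inv e i) = i" if "i \<noteq> i0" for i using that range by (intro f_inv_into_f) auto
  have sum_e: "(\<Sum>i\<in>UNIV. p $ i) = p $ i0 + (\<Sum>j\<in>UNIV. p $ e j)" for p :: "real ^ 'n"
    using sum.remove[of UNIV i0 "\<lambda>i. p $ i"] sum.reindex_bij_betw[OF e, of "\<lambda>i. p $ i"] by simp
  have L: "linear L" by (auto simp: linear_iff L_def vec_eq_iff sum.distrib sum_distrib_left)
  have P: "linear P" by (auto simp: linear_iff P_def vec_eq_iff)
  have PL: "P (c + L a) = a" for a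
    by (simp add: P_def c_def L_def vec_eq_iff e_i0 inv_e axis_def)
  have LP: "c + L (P p) = p" if "(\<Sum>i\<in>UNIV. p $ i) = 1" for p
    using that sum_e[of p] e_inv by (auto simp: c_def L_def P_def vec_eq_iff axis_def)
  have Lt: "L a \<in> tangent_space" for a
    by (simp add: tangent_space_def sum_e L_def e_i0 inv_e)
  have LPt: "L (P v) = v" if "v \<in> tangent_space" for v
    using that sum_e[of v] e_inv by (auto simp: tangent_space_def L_def P_def vec_eq_iff)
  define \<Omega> :: "(real ^ 'm) set" where "\<Omega> = {a. c + L a \<in> simplex_int}"
  have \<Omega>: "\<Omega> = (\<Inter>i. {a. 0 < (c + L a) $ i})"
  proof -
    have "(\<Sum>i\<in>UNIV. (c + L a) $ i) = 1" for a
      using Lt[of a] by (simp add: tangent_space_def sum.distrib c_def axis_def)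
    then show ?thesis by (auto simp: \<Omega>_def simplex_int_def)
  qed
  have cont: "continuous_on UNIV L" using L linear_continuous_on linear_conv_bounded_linear by blast
  have "open {a. 0 < (c + L a) $ i}" for i
    by (intro open_Collect_less continuous_intros cont)
  then have "open \<Omega>" unfolding \<Omega> by (intro open_INT) auto
  moreover have "convex \<Omega>"
  proof -
    have "convex (simplex_int :: (real ^ 'n) set)"
      by (rule convex_simplex_int)
    then show ?thesis
      unfolding convex_def \<Omega>_def
    proof (intro ballI allI impI; clarify)
      fix a b and u v :: real
      assume *: "\<forall>x\<in>simplex_int. \<forall>y\<in>simplex_int. \<forall>u\<ge>0. \<forall>v\<ge>0. u + v = 1 \<longrightarrow>
          u *\<^sub>R x + v *\<^sub>R y \<in> (simplex_int :: (real ^ 'n) set)"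
        and ab: "c + L a \<in> simplex_int" "c + L b \<in> simplex_int" and uv: "0 \<le> u" "0 \<le> v" "u + v = 1"
      have "u *\<^sub>R (c + L a) + v *\<^sub>R (c + L b) = (u + v) *\<^sub>R c + L (u *\<^sub>R a + v *\<^sub>R b)"
        by (simp add: linear_add[OF L] linear_scale[OF L] algebra_simps)
      then show "c + L (u *\<^sub>R a + v *\<^sub>R b) \<in> simplex_int" using * ab uv by fastforce
    qed
  qed
  moreover have img: "(\<lambda>a. c + L a) ` \<Omega> = simplex_int"
  proof (intro equalityI subsetI)
    fix p :: "real ^ 'n" assume p: "p \<in> simplex_int"
    then have "c + L (P p) = p" by (intro LP) (simp add: simplex_int_def)
    then show "p \<in> (\<lambda>a. c + L a) ` \<Omega>" using p by (intro image_eqI[of _ _ "P p"]) (auto simp: \<Omega>_def)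
  qed (auto simp: \<Omega>_def)
  moreover have "coordinate_system \<Omega> (\<lambda>a. c + L a) P"
    unfolding coordinate_system_def img
  proof (intro conjI ballI)
    show "homeomorphism \<Omega> simplex_int (\<lambda>a. c + L a) P"
    proof (rule homeomorphismI)
      show "continuous_on \<Omega> (\<lambda>a. c + L a)"
        using cont by (intro continuous_intros) (auto intro: continuous_on_subset)
      show "continuous_on simplex_int P" using P linear_continuous_on linear_conv_bounded_linear by blast
      show "(\<lambda>a. c + L a) ` \<Omega> \<subseteq> simplex_int" using img by simp
      show "P ` simplex_int \<subseteq> \<Omega>" using img PL by (force simp flip: img)
      show "c + L (P y) = y" if "y \<in> simplex_int" for y using LP that by (simp add: simplex_int_def)
    qed (use PL in auto)
    show "smooth_on \<Omega> (\<lambda>a. c + L a)"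
      using L by (intro smooth_on_affine) (simp add: linear_conv_bounded_linear)
    fix a
    have "((\<lambda>a. c + L a) has_derivative L) (at a)"
      using bounded_linear_imp_has_derivative[of L] L
      by (auto intro!: derivative_eq_intros simp: fun_eq_iff linear_conv_bounded_linear)
    then have "frechet_derivative (\<lambda>a. c + L a) (at a) = L"
      by (rule frechet_derivative_at[symmetric])
    moreover have "inj L" using PL by (metis injI)
    ultimately show "inj (frechet_derivative (\<lambda>a. c + L a) (at a))" by simp
  qed (use \<open>open \<Omega>\<close> in auto)
  ultimately show ?thesis using that[of L P c \<Omega>] L P PL LP Lt LPt by blast
qed

section \<open>Flows and geodesics in an embedding\<close>

text \<open>The gradient flow of \<open>T(r | -)\<close> and the geodesics from \<open>q\<close> to \<open>r\<close>, as seen through \<open>X\<close>.  With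
  \<open>X\<close> and \<open>Y\<close> exchanged they describe the flow of \<open>T(- | r)\<close> and the dual geodesics.\<close>

definition embedded_flow ::
    "(real ^ 'n::finite \<Rightarrow> real ^ 'n) \<Rightarrow> (real ^ 'n \<Rightarrow> real ^ 'n) \<Rightarrow> real ^ 'n \<Rightarrow> real ^ 'n
      \<Rightarrow> (real \<Rightarrow> real ^ 'n) \<Rightarrow> bool" where
  "embedded_flow X Y r q \<gamma> \<longleftrightarrow>
     \<gamma> 0 = q \<and> continuous_on {0..} \<gamma> \<and> \<gamma> ` {0..} \<subseteq> simplex_int \<and>
     (\<forall>t\<ge>0. ((X \<circ> \<gamma>) has_vector_derivative (1 / (X r \<bullet> Y (\<gamma> t))) *\<^sub>R X r - X (\<gamma> t))
        (at t within {0..}))"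

definition embedded_geodesic ::
    "(real ^ 'n::finite \<Rightarrow> real ^ 'n) \<Rightarrow> real ^ 'n \<Rightarrow> real ^ 'n \<Rightarrow> (real \<Rightarrow> real ^ 'n) \<Rightarrow> bool" where
  "embedded_geodesic X q r \<sigma> \<longleftrightarrow>
     smooth_within {0..1} \<sigma> \<and> \<sigma> ` {0..1} \<subseteq> simplex_int \<and> \<sigma> 0 = q \<and> \<sigma> 1 = r \<and>
     (\<forall>t\<in>{0..1}. \<exists>\<rho>. velocity {0..1} (velocity {0..1} (X \<circ> \<sigma>)) t = \<rho> *\<^sub>R X (\<sigma> t))"

lemma at_within_openin:
  assumes "openin (top_of_set I) J" "t \<in> J"
  shows "at t within J = at t within (I :: 'a::topological_space set)"
proof -
  obtain U where U: "open U" "J = I \<inter> U" using assms(1) unfolding openin_open by blast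
  then show ?thesis using assms(2) by (intro at_within_nhd[of t U]) auto
qed

lemma at_within_unit_interval_neq_bot: "t \<in> {0..1} \<Longrightarrow> at t within {0..1} \<noteq> (bot :: real filter)"
  by (simp add: trivial_limit_within islimpt_Icc)

lemma velocity_eq:
  assumes "(c has_vector_derivative d) (at t within I)" "at t within I \<noteq> bot"
  shows "velocity I c t = d"
  unfolding velocity_def using vector_derivative_within[OF assms(2,1)] .

text \<open>The hypothesis on charts is required of all coordinate systems because flows and geodesics are
  defined by equations in all of them.\<close>

locale divergence_pair =
  fixes X Y :: "real ^ 'n::finite \<Rightarrow> real ^ 'n"
  assumes card_n: "CARD('n) \<ge> 2" and card_m: "CARD('m::finite) = CARD('n) - 1"
    and pairing_ge: "\<And>y z. y \<in> simplex_int \<Longrightarrow> z \<in> simplex_int \<Longrightarrow> 1 \<le> X y \<bullet> Y z"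
    and pairing_eq: "\<And>y z. y \<in> simplex_int \<Longrightarrow> z \<in> simplex_int \<Longrightarrow> X y \<bullet> Y z = 1 \<longleftrightarrow> y = z"
    and chart: "\<And>(\<Omega> :: (real ^ 'm) set) x \<xi>. coordinate_system \<Omega> x \<xi> \<Longrightarrow>
      conjugate_immersions \<Omega> (\<lambda>a. X (x a)) (\<lambda>a. Y (x a))"
begin

lemma swap_pair: "divergence_pair TYPE('m) Y X"
proof (rule divergence_pair.intro)
  show "1 \<le> Y y \<bullet> X z" if "y \<in> simplex_int" "z \<in> simplex_int" for y z
    using pairing_ge[OF that(2,1)] by (simp add: inner_commute)
  show "Y y \<bullet> X z = 1 \<longleftrightarrow> y = z" if "y \<in> simplex_int" "z \<in> simplex_int" for y z
    using pairing_eq[OF that(2,1)] by (auto simp: inner_commute)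
  show "conjugate_immersions \<Omega> (\<lambda>a. Y (x a)) (\<lambda>a. X (x a))"
    if "coordinate_system \<Omega> x \<xi>" for \<Omega> :: "(real ^ 'm) set" and x \<xi>
    using conjugate_immersions.swap[OF chart[OF that]] .
qed (fact card_n card_m)+

lemma pairing_positive: "y \<in> simplex_int \<Longrightarrow> z \<in> simplex_int \<Longrightarrow> 0 < X y \<bullet> Y z"
  using pairing_ge[of y z] by linarith

context
  fixes \<Omega> :: "(real ^ 'm) set" and x :: "real ^ 'm \<Rightarrow> real ^ 'n" and \<xi> :: "real ^ 'n \<Rightarrow> real ^ 'm"
  assumes cs: "coordinate_system \<Omega> x \<xi>"
begin

interpretation C: conjugate_immersions \<Omega> "\<lambda>a. X (x a)" "\<lambda>a. Y (x a)"
  by (rule chart[OF cs])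

text \<open>A curve is only known to lie in the chart on a relatively open set of times \<open>J\<close>, where derivatives
  within \<open>J\<close> and within \<open>I\<close> agree.\<close>

lemma chart_lift:
  assumes c: "continuous_on I c" "c ` I \<subseteq> simplex_int"
  defines "J \<equiv> {s \<in> I. c s \<in> x ` \<Omega>}"
  shows "t \<in> J \<Longrightarrow> at t within J = at t within I"
    and "continuous_on J (\<xi> \<circ> c)" "(\<xi> \<circ> c) ` J \<subseteq> \<Omega>" "s \<in> J \<Longrightarrow> x (\<xi> (c s)) = c s"
proof -
  have hom: "homeomorphism \<Omega> (x ` \<Omega>) x \<xi>" and op: "openin (top_of_set simplex_int) (x ` \<Omega>)"
    using cs by (auto simp: coordinate_system_def)
  have "openin (top_of_set I) (I \<inter> c -` (x ` \<Omega>))"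
    using c op by (intro continuous_openin_preimage[of I c simplex_int]) auto
  moreover have "I \<inter> c -` (x ` \<Omega>) = J" by (auto simp: J_def)
  ultimately have "openin (top_of_set I) J" by simp
  then show "t \<in> J \<Longrightarrow> at t within J = at t within I" by (rule at_within_openin)
  have "continuous_on (x ` \<Omega>) \<xi>" using hom by (auto simp: homeomorphism_def)
  moreover have "continuous_on J c" using c(1) by (rule continuous_on_subset) (auto simp: J_def)
  moreover have "c ` J \<subseteq> x ` \<Omega>" by (auto simp: J_def)
  ultimately show "continuous_on J (\<xi> \<circ> c)"
    by (metis continuous_on_compose continuous_on_subset)
  show "(\<xi> \<circ> c) ` J \<subseteq> \<Omega>" using hom by (fastforce simp: homeomorphism_def J_def)
  show "x (\<xi> (c s)) = c s" if "s \<in> J" using hom that by (auto simp: homeomorphism_def J_def)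
qed

text \<open>From right to left, the coordinate curve is differentiable because it lifts \<open>X \<circ> \<gamma>\<close> through the
  immersion \<open>X \<circ> x\<close>.\<close>

lemma flow_chart_iff:
  assumes \<gamma>: "continuous_on {0..} \<gamma>" "\<gamma> ` {0..} \<subseteq> simplex_int" and t: "t \<ge> 0" "\<gamma> t \<in> x ` \<Omega>"
    and w: "w \<bullet> Y (\<gamma> t) \<noteq> 0"
  defines "a \<equiv> \<xi> (\<gamma> t)"
  shows "((\<xi> \<circ> \<gamma>) has_vector_derivative - (\<chi> i. \<Sum>j\<in>UNIV. matrix_inv (C.gram a) $ i $ j *
           ((w \<bullet> C.DG a (axis j 1)) / (w \<bullet> Y (x a))))) (at t within {0..})
    \<longleftrightarrow> ((X \<circ> \<gamma>) has_vector_derivative (1 / (w \<bullet> Y (\<gamma> t))) *\<^sub>R w - X (\<gamma> t)) (at t within {0..})"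
proof -
  define J where "J = {s \<in> {0..}. \<gamma> s \<in> x ` \<Omega>}"
  note lift = chart_lift[OF \<gamma>, folded J_def]
  have tJ: "t \<in> J" using t by (simp add: J_def)
  have xa: "x a = \<gamma> t" using lift(4)[OF tJ] by (simp add: a_def)
  have a: "a \<in> \<Omega>" using lift(3) tJ by (auto simp: a_def)
  define u0 where "u0 = - (\<chi> i. \<Sum>j\<in>UNIV. matrix_inv (C.gram a) $ i $ j *
           ((w \<bullet> C.DG a (axis j 1)) / (w \<bullet> Y (x a))))"
  define d where "d = (1 / (w \<bullet> Y (\<gamma> t))) *\<^sub>R w - X (\<gamma> t)"
  have u0: "C.DF a u0 = d"
    using C.gradient_iff[OF a, of w u0] w by (simp add: u0_def d_def xa)
  have XF: "X (\<gamma> s) = X (x ((\<xi> \<circ> \<gamma>) s))" if "s \<in> J" for s using lift(4)[OF that] by simp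
  have DFa: "((\<lambda>a. X (x a)) has_derivative C.DF a) (at ((\<xi> \<circ> \<gamma>) t))"
    using C.DF[OF a] by (simp add: a_def)
  have "((\<xi> \<circ> \<gamma>) has_vector_derivative u0) (at t within J)
    \<longleftrightarrow> ((X \<circ> \<gamma>) has_vector_derivative d) (at t within J)"
  proof
    assume "((\<xi> \<circ> \<gamma>) has_vector_derivative u0) (at t within J)"
    then have "((\<lambda>s. X (x ((\<xi> \<circ> \<gamma>) s))) has_derivative (\<lambda>h. C.DF a (h *\<^sub>R u0))) (at t within J)"
      unfolding has_vector_derivative_def by (rule has_derivative_compose) (rule DFa)
    then have "((\<lambda>s. X (x ((\<xi> \<circ> \<gamma>) s))) has_vector_derivative d) (at t within J)"
      by (simp add: has_vector_derivative_def linear_scale[OF C.linear_DF[OF a]] u0)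
    then show "((X \<circ> \<gamma>) has_vector_derivative d) (at t within J)"
      by (rule has_vector_derivative_transform[OF tJ, rotated]) (simp add: XF)
  next
    assume "((X \<circ> \<gamma>) has_vector_derivative d) (at t within J)"
    then have "((\<lambda>s. X (x ((\<xi> \<circ> \<gamma>) s))) has_vector_derivative d) (at t within J)"
      by (rule has_vector_derivative_transform[OF tJ, rotated]) (simp add: XF)
    then have h: "((\<lambda>s. X (x ((\<xi> \<circ> \<gamma>) s))) has_derivative (\<lambda>h. h *\<^sub>R d)) (at t within J)"
      by (simp add: has_vector_derivative_def)
    obtain P where P: "linear P" "P \<circ> C.DF a = id"
      using linear_injective_left_inverse[OF C.linear_DF[OF a] C.inj_DF[OF a]] by blast
    have "((\<xi> \<circ> \<gamma>) has_derivative (\<lambda>v. P (v *\<^sub>R d))) (at t within J)"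
    proof (rule has_derivative_lift[where N = "\<lambda>a. X (x a)" and L = "C.DF a" and T = \<Omega>])
      show "((\<lambda>a. X (x a)) has_derivative C.DF a) (at ((\<xi> \<circ> \<gamma>) t) within \<Omega>)"
        using DFa by (rule has_derivative_at_withinI)
      show "bounded_linear P" using P(1) by (simp add: linear_conv_bounded_linear)
      show "P (C.DF a v) = v" for v using P(2) by (metis comp_apply id_apply)
      show "continuous (at t within J) (\<xi> \<circ> \<gamma>)"
        using lift(2) tJ unfolding continuous_on_eq_continuous_within by blast
    qed (use lift(3) tJ h in auto)
    moreover have "P d = u0" using P(2) u0 by (metis comp_apply id_apply)
    ultimately show "((\<xi> \<circ> \<gamma>) has_vector_derivative u0) (at t within J)"
      by (simp add: has_vector_derivative_def linear_scale[OF P(1)])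
  qed
  then show ?thesis unfolding lift(1)[OF tJ] by (simp add: u0_def d_def)
qed

text \<open>The coordinate curve is smooth as the lift of \<open>c\<close> through the immersion \<open>x\<close>, so both accelerations
  exist and the one of \<open>X \<circ> c\<close> is \<open>deriv2 (X \<circ> x) a u\<^sub>1 u\<^sub>1 + D(X \<circ> x) u\<^sub>2\<close>.\<close>

lemma geodesic_chart_iff:
  assumes c: "smooth_within {0..1} c" "c ` {0..1} \<subseteq> simplex_int"
    and t: "t \<in> {0..1}" "c t \<in> x ` \<Omega>"
  defines "a \<equiv> \<xi> (c t)"
  shows "(\<forall>k. velocity {0..1} (velocity {0..1} (\<xi> \<circ> c)) t $ k + (\<Sum>i\<in>UNIV. \<Sum>j\<in>UNIV.
        (\<Sum>m\<in>UNIV. - (deriv2 (\<lambda>a. X (x a)) a (axis i 1) (axis j 1) \<bullet> C.DG a (axis m 1))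
            * matrix_inv (C.gram a) $ m $ k)
          * velocity {0..1} (\<xi> \<circ> c) t $ i * velocity {0..1} (\<xi> \<circ> c) t $ j) = 0)
    \<longleftrightarrow> (\<exists>\<rho>. velocity {0..1} (velocity {0..1} (X \<circ> c)) t = \<rho> *\<^sub>R X (c t))"
proof -
  define I where "I = {0..1::real}"
  define J where "J = {s \<in> I. c s \<in> x ` \<Omega>}"
  define u where "u = \<xi> \<circ> c"
  have c': "continuous_on I c" "c ` I \<subseteq> simplex_int"
    using c smooth_within_continuous_on by (auto simp: I_def)
  note lift = chart_lift[OF c', folded J_def, folded u_def]
  have JI: "J \<subseteq> I" by (auto simp: J_def)
  have tJ: "t \<in> J" using t by (simp add: J_def I_def)
  have nb: "at s within J \<noteq> bot" if "s \<in> J" for s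
    using lift(1)[OF that] at_within_unit_interval_neq_bot JI that by (auto simp: I_def)
  have "smooth_within J (\<lambda>s. x (u s))"
    by (rule smooth_within_cong[OF smooth_within_subset[OF c(1)]])
      (use JI lift(4) in \<open>auto simp: I_def u_def\<close>)
  moreover have x: "smooth_within \<Omega> x" "\<And>y. y \<in> \<Omega> \<Longrightarrow> inj (frechet_derivative x (at y))"
    using cs smooth_on_imp_smooth_within by (auto simp: coordinate_system_def)
  ultimately have u: "smooth_within J u"
    using lift(2,3) C.open_V by (intro smooth_within_lift[of \<Omega> x]) auto
  define u1 where "u1 s = vector_derivative u (at s within J)" for s
  define u2 where "u2 s = vector_derivative u1 (at s within J)" for s
  have u1: "(u has_vector_derivative u1 s) (at s within J)" if "s \<in> J" for s
    using smooth_within_vector_derivative(1)[OF nb u that] by (simp add: u1_def)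
  have "smooth_within J u1"
    using smooth_within_vector_derivative(2)[OF nb u] by (simp add: u1_def[abs_def])
  then have u2: "(u1 has_vector_derivative u2 s) (at s within J)" if "s \<in> J" for s
    using smooth_within_vector_derivative(1)[OF nb _ that] by (simp add: u2_def)
  have vel1: "velocity I f s = f1" if "(f has_vector_derivative f1) (at s within J)" "s \<in> J"
    for f s and f1 :: "'z::real_normed_vector"
    using velocity_eq[of f f1 s I] that nb[OF that(2)] lift(1)[OF that(2)] by metis
  have vel2: "velocity I (velocity I f) t = f2"
    if "\<And>s. s \<in> J \<Longrightarrow> (f has_vector_derivative f1 s) (at s within J)"
      "(f1 has_vector_derivative f2) (at t within J)" for f f1 and f2 :: "'z::real_normed_vector"
  proof -
    have "(velocity I f has_vector_derivative f2) (at t within J)"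
      by (rule has_vector_derivative_transform[OF tJ _ that(2)]) (rule vel1[OF that(1)])
    then show ?thesis by (rule vel1) (rule tJ)
  qed
  have F1: "((X \<circ> c) has_vector_derivative C.DF (u s) (u1 s)) (at s within J)" if s: "s \<in> J" for s
  proof -
    have us: "u s \<in> \<Omega>" using lift(3) s by auto
    have "((\<lambda>s. X (x (u s))) has_derivative (\<lambda>h. C.DF (u s) (h *\<^sub>R u1 s))) (at s within J)"
      using u1[OF s] unfolding has_vector_derivative_def
      by (rule has_derivative_compose) (rule C.DF[OF us])
    then have "((\<lambda>s. X (x (u s))) has_vector_derivative C.DF (u s) (u1 s)) (at s within J)"
      by (simp add: has_vector_derivative_def linear_scale[OF C.linear_DF[OF us]])
    then show ?thesis
      by (rule has_vector_derivative_transform[OF s, rotated]) (use lift(4) in \<open>simp add: u_def\<close>)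
  qed
  have a: "a \<in> \<Omega>" "u t = a" "x a = c t" using lift(3) lift(4)[OF tJ] tJ by (auto simp: a_def u_def)
  have F2: "((\<lambda>s. C.DF (u s) (u1 s)) has_vector_derivative
      deriv2 (\<lambda>a. X (x a)) a (u1 t) (u1 t) + C.DF a (u2 t)) (at t within J)"
  proof -
    have D: "((\<lambda>s. C.DF (u s) v) has_vector_derivative deriv2 (\<lambda>a. X (x a)) a (u1 t) v) (at t within J)"
      for v
    proof -
      have "((\<lambda>s. C.DF (u s) v) has_derivative (\<lambda>h. deriv2 (\<lambda>a. X (x a)) a (h *\<^sub>R u1 t) v))
          (at t within J)"
        using u1[OF tJ] unfolding has_vector_derivative_def
        by (rule has_derivative_compose) (use C.DDF[OF a(1)] a(2) in simp)
      then show ?thesis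
        by (simp add: has_vector_derivative_def
            linear_scale[OF linear_deriv2_left[OF C.open_V C.smooth_F a(1)]])
    qed
    have N: "((\<lambda>s. u1 s $ j) has_real_derivative u2 t $ j) (at t within J)" for j
      using bounded_linear.has_vector_derivative[OF bounded_linear_vec_nth u2[OF tJ], of j]
      by (simp add: has_real_derivative_iff_has_vector_derivative)
    have "((\<lambda>s. \<Sum>j\<in>UNIV. u1 s $ j *\<^sub>R C.DF (u s) (axis j 1)) has_vector_derivative
        (\<Sum>j\<in>UNIV. u1 t $ j *\<^sub>R deriv2 (\<lambda>a. X (x a)) a (u1 t) (axis j 1)
          + u2 t $ j *\<^sub>R C.DF (u t) (axis j 1))) (at t within J)"
      by (intro has_vector_derivative_sum has_vector_derivative_scaleR N D)
    then have "((\<lambda>s. C.DF (u s) (u1 s)) has_vector_derivative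
        (\<Sum>j\<in>UNIV. u1 t $ j *\<^sub>R deriv2 (\<lambda>a. X (x a)) a (u1 t) (axis j 1)
          + u2 t $ j *\<^sub>R C.DF (u t) (axis j 1))) (at t within J)"
    proof (rule has_vector_derivative_transform[OF tJ, rotated])
      fix s assume "s \<in> J"
      then have "u s \<in> \<Omega>" using lift(3) by auto
      then show "C.DF (u s) (u1 s) = (\<Sum>j\<in>UNIV. u1 s $ j *\<^sub>R C.DF (u s) (axis j 1))"
        by (rule linear_axis_sum[OF C.linear_DF])
    qed
    then show ?thesis
      by (simp add: sum.distrib a linear_axis_sum[OF C.linear_DF[OF a(1)], of "u2 t"]
          linear_axis_sum[OF linear_deriv2_right[OF C.open_V C.smooth_F a(1)], of _ "u1 t"])
  qed
  have "velocity I (velocity I u) t = u2 t" using vel2[OF u1 u2[OF tJ]] .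
  moreover have "velocity I u t = u1 t" using vel1[OF u1[OF tJ] tJ] .
  moreover have "velocity I (velocity I (X \<circ> c)) t
      = deriv2 (\<lambda>a. X (x a)) a (u1 t) (u1 t) + C.DF a (u2 t)" using vel2[OF F1 F2] .
  ultimately show ?thesis
    using C.geodesic_iff[OF a(1), of "u2 t" "u1 t"] by (simp add: a I_def u_def)
qed

lemma gram_swap: "c \<in> \<Omega> \<Longrightarrow> conjugate_immersions.gram (\<lambda>a. Y (x a)) (\<lambda>a. X (x a)) c = C.gram c"
  unfolding conjugate_immersions.gram_def[OF C.swap] C.gram_def
  using C.DF_DG_commute by (simp add: vec_eq_iff inner_commute)

text \<open>The coefficients of the definitions are the partial derivatives of the logarithm of the
  pairing.\<close>

context
  fixes \<phi> :: "real ^ 'n \<Rightarrow> real"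
  assumes T: "\<forall>y\<in>simplex_int. \<forall>z\<in>simplex_int. L_div \<phi> y z = ln (X y \<bullet> Y z)"
begin

lemma chart_in_simplex: "a \<in> \<Omega> \<Longrightarrow> x a \<in> simplex_int"
  using cs openin_imp_subset by (fastforce simp: coordinate_system_def)

lemma L_div_chart: "a \<in> \<Omega> \<Longrightarrow> b \<in> \<Omega> \<Longrightarrow> L_div \<phi> (x a) (x b) = ln (X (x a) \<bullet> Y (x b))"
  by (simp add: T chart_in_simplex)

lemma inv_metric_eq: "c \<in> \<Omega> \<Longrightarrow> inv_metric \<phi> x c = matrix_inv (C.gram c)"
  unfolding inv_metric_def metric_def
  by (subst C.gram_eq_partials[where T = "\<lambda>a b. L_div \<phi> (x a) (x b)"]) (auto simp: L_div_chart)

lemma primal_Gamma_low_eq: "c \<in> \<Omega> \<Longrightarrow>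
    primal_Gamma_low \<phi> x c i j k = - (deriv2 (\<lambda>a. X (x a)) c (axis i 1) (axis j 1) \<bullet> C.DG c (axis k 1))"
  unfolding primal_Gamma_low_def
  by (subst C.partial_first_first_second[where T = "\<lambda>a b. L_div \<phi> (x a) (x b)"])
    (auto simp: L_div_chart)

lemma dual_Gamma_low_eq: "c \<in> \<Omega> \<Longrightarrow>
    dual_Gamma_low \<phi> x c i j k = - (deriv2 (\<lambda>a. Y (x a)) c (axis i 1) (axis j 1) \<bullet> C.DF c (axis k 1))"
  unfolding dual_Gamma_low_def
  by (subst C.partial_first_second_second[where T = "\<lambda>a b. L_div \<phi> (x a) (x b)"])
    (auto simp: L_div_chart inner_commute)

lemma riem_grad_second: "c \<in> \<Omega> \<Longrightarrow> r \<in> simplex_int \<Longrightarrow>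
    riem_grad \<phi> x (\<lambda>p. L_div \<phi> r p) c = (\<chi> i. \<Sum>j\<in>UNIV. matrix_inv (C.gram c) $ i $ j *
       ((X r \<bullet> C.DG c (axis j 1)) / (X r \<bullet> Y (x c))))"
  unfolding riem_grad_def
  by (subst C.partial_ln_pairing[where w = "X r"])
    (auto simp: T chart_in_simplex pairing_positive inv_metric_eq)

lemma riem_grad_first:
  assumes c: "c \<in> \<Omega>" and p: "p \<in> simplex_int"
  shows "riem_grad \<phi> x (\<lambda>r. L_div \<phi> r p) c = (\<chi> i. \<Sum>j\<in>UNIV. matrix_inv (C.gram c) $ i $ j *
       ((Y p \<bullet> C.DF c (axis j 1)) / (Y p \<bullet> X (x c))))"
proof -
  have "partial j (\<lambda>b. L_div \<phi> (x b) p) c = (Y p \<bullet> C.DF c (axis j 1)) / (Y p \<bullet> X (x c))" for j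
  proof (rule conjugate_immersions.partial_ln_pairing[OF C.swap _ _ c])
    show "L_div \<phi> (x b) p = ln (Y p \<bullet> X (x b))" if "b \<in> \<Omega>" for b
      using T[rule_format, OF chart_in_simplex[OF that] p] by (simp add: inner_commute)
    show "0 < Y p \<bullet> X (x b)" if "b \<in> \<Omega>" for b
      using pairing_positive[OF chart_in_simplex[OF that] p] by (simp add: inner_commute)
  qed
  then show ?thesis by (simp add: riem_grad_def inv_metric_eq[OF c])
qed

end

end

end

context divergence_pair
begin

lemma global_chart:
  obtains \<Omega> :: "(real ^ 'm) set" and x :: "real ^ 'm \<Rightarrow> real ^ 'n" and \<xi>
  where "coordinate_system \<Omega> x \<xi>" "x ` \<Omega> = simplex_int" "linear \<xi>"
  using affine_chart_exists[OF card_n card_m] by metis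

text \<open>A smooth curve in the simplex is smooth in the affine chart because that chart is linear on the
  ambient space.\<close>

lemma global_chart_curve:
  assumes \<sigma>: "smooth_within I \<sigma>" "\<sigma> ` I \<subseteq> simplex_int"
  obtains \<Omega> :: "(real ^ 'm) set" and x :: "real ^ 'm \<Rightarrow> real ^ 'n" and u
  where "conjugate_immersions \<Omega> (\<lambda>a. X (x a)) (\<lambda>a. Y (x a))" "smooth_within I u" "u ` I \<subseteq> \<Omega>"
    "\<And>s. s \<in> I \<Longrightarrow> x (u s) = \<sigma> s"
proof -
  obtain \<Omega> :: "(real ^ 'm) set" and x :: "real ^ 'm \<Rightarrow> real ^ 'n" and \<xi>
    where cs: "coordinate_system \<Omega> x \<xi>" and img: "x ` \<Omega> = simplex_int" and \<xi>: "linear \<xi>"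
    by (rule global_chart)
  have hom: "homeomorphism \<Omega> simplex_int x \<xi>" using cs img by (auto simp: coordinate_system_def)
  have "smooth_within I (\<lambda>s. \<xi> (\<sigma> s))"
    using \<xi> \<sigma>(1) smooth_within_bounded_linear[of \<xi> I \<sigma>]
    by (simp add: linear_conv_bounded_linear)
  moreover have "(\<lambda>s. \<xi> (\<sigma> s)) ` I \<subseteq> \<Omega>" using \<sigma>(2) hom by (auto simp: homeomorphism_def)
  moreover have "x (\<xi> (\<sigma> s)) = \<sigma> s" if "s \<in> I" for s
    using \<sigma>(2) hom that by (auto simp: homeomorphism_def)
  ultimately show ?thesis using that[OF chart[OF cs]] by blast
qed

lemma smooth_embedded_curve:
  assumes \<sigma>: "smooth_within I \<sigma>" "\<sigma> ` I \<subseteq> simplex_int"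
  shows "smooth_within I (X \<circ> \<sigma>)"
proof -
  obtain \<Omega> :: "(real ^ 'm) set" and x :: "real ^ 'm \<Rightarrow> real ^ 'n" and u
    where C: "conjugate_immersions \<Omega> (\<lambda>a. X (x a)) (\<lambda>a. Y (x a))"
      and u: "smooth_within I u" "u ` I \<subseteq> \<Omega>" "\<And>s. s \<in> I \<Longrightarrow> x (u s) = \<sigma> s"
    using global_chart_curve[OF \<sigma>] by blast
  interpret C: conjugate_immersions \<Omega> "\<lambda>a. X (x a)" "\<lambda>a. Y (x a)" by (rule C)
  have "smooth_within I (\<lambda>s. X (x (u s)))" by (rule smooth_within_compose[OF C.smooth_F u(1,2)])
  then show ?thesis by (rule smooth_within_cong) (simp add: u(3))
qed

lemma embedded_velocity_orthogonal:
  assumes \<sigma>: "smooth_within I \<sigma>" "\<sigma> ` I \<subseteq> simplex_int"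
    and t: "t \<in> I" "at t within I \<noteq> bot" and d: "((X \<circ> \<sigma>) has_vector_derivative d) (at t within I)"
  shows "d \<bullet> Y (\<sigma> t) = 0"
proof -
  obtain \<Omega> :: "(real ^ 'm) set" and x :: "real ^ 'm \<Rightarrow> real ^ 'n" and u
    where C: "conjugate_immersions \<Omega> (\<lambda>a. X (x a)) (\<lambda>a. Y (x a))"
      and u: "smooth_within I u" "u ` I \<subseteq> \<Omega>" "\<And>s. s \<in> I \<Longrightarrow> x (u s) = \<sigma> s"
    using global_chart_curve[OF \<sigma>] by blast
  interpret C: conjugate_immersions \<Omega> "\<lambda>a. X (x a)" "\<lambda>a. Y (x a)" by (rule C)
  have ut: "u t \<in> \<Omega>" using u(2) t(1) by auto
  obtain u' where u': "(u has_derivative u') (at t within I)"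
    using smooth_within_differentiable[OF u(1) t(1)] by blast
  have lu: "linear u'" using u' has_derivative_linear by blast
  have der: "((\<lambda>s. X (x (u s))) has_derivative (\<lambda>h. C.DF (u t) (u' h))) (at t within I)"
    using u' by (rule has_derivative_compose) (rule C.DF[OF ut])
  have "C.DF (u t) (u' h) = h *\<^sub>R C.DF (u t) (u' 1)" for h
    using linear_scale[OF lu, of h 1] by (simp add: linear_scale[OF C.linear_DF[OF ut]])
  then have "(\<lambda>h. C.DF (u t) (u' h)) = (\<lambda>h. h *\<^sub>R C.DF (u t) (u' 1))" by blast
  with der have "((\<lambda>s. X (x (u s))) has_vector_derivative C.DF (u t) (u' 1)) (at t within I)"
    unfolding has_vector_derivative_def by metis
  then have "((X \<circ> \<sigma>) has_vector_derivative C.DF (u t) (u' 1)) (at t within I)"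
    by (rule has_vector_derivative_transform[OF t(1), rotated]) (simp add: u(3))
  from vector_derivative_unique_within[OF t(2) this d]
  have "d = C.DF (u t) (u' 1)" by simp
  then show ?thesis using C.DF_orthogonal[OF ut, of "u' 1"] u(3)[OF t(1)] by simp
qed

lemma chart_coordinate:
  assumes "coordinate_system \<Omega> x \<xi>" "y \<in> x ` \<Omega>"
  shows "\<xi> y \<in> \<Omega>" "x (\<xi> y) = y"
  using assms by (auto simp: coordinate_system_def homeomorphism_def)

text \<open>The affine chart covers the simplex and so suffices to derive the embedded equation, which in turn
  implies the equation in every chart.\<close>

lemma gradient_flow_iff_embedded:
  fixes X' Y' :: "real ^ 'n \<Rightarrow> real ^ 'n"
  assumes S: "divergence_pair TYPE('m) X' Y'" and r: "r \<in> simplex_int"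
    and grad: "\<And>(\<Omega> :: (real ^ 'm) set) x \<xi> a. \<lbrakk>coordinate_system \<Omega> x \<xi>; a \<in> \<Omega>\<rbrakk> \<Longrightarrow>
      riem_grad \<phi> x f a = (\<chi> i. \<Sum>j\<in>UNIV.
        matrix_inv (conjugate_immersions.gram (\<lambda>a. X' (x a)) (\<lambda>a. Y' (x a)) a) $ i $ j *
        ((X' r \<bullet> frechet_derivative (\<lambda>a. Y' (x a)) (at a) (axis j 1)) / (X' r \<bullet> Y' (x a))))"
  shows "gradient_flow TYPE('m) \<phi> f q \<gamma> \<longleftrightarrow> embedded_flow X' Y' r q \<gamma>"
proof -
  interpret S: divergence_pair X' Y' by (rule S)
  let ?base = "\<gamma> 0 = q \<and> continuous_on {0..} \<gamma> \<and> \<gamma> ` {0..} \<subseteq> simplex_int"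
  let ?D = "\<lambda>t. ((X' \<circ> \<gamma>) has_vector_derivative (1 / (X' r \<bullet> Y' (\<gamma> t))) *\<^sub>R X' r - X' (\<gamma> t)) (at t within {0..})"
  have main: "((\<xi> \<circ> \<gamma>) has_vector_derivative - riem_grad \<phi> x f (\<xi> (\<gamma> t))) (at t within {0..}) \<longleftrightarrow> ?D t"
    if base: ?base and cs: "coordinate_system \<Omega> x \<xi>" and t: "t \<ge> 0" "\<gamma> t \<in> x ` \<Omega>"
    for \<Omega> :: "(real ^ 'm) set" and x :: "real ^ 'm \<Rightarrow> real ^ 'n" and \<xi> t
  proof -
    have b: "continuous_on {0..} \<gamma>" "\<gamma> ` {0..} \<subseteq> simplex_int" using base by auto
    have "X' r \<bullet> Y' (\<gamma> t) \<noteq> 0" using S.pairing_positive[OF r, of "\<gamma> t"] b(2) t(1) by force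
    from S.flow_chart_iff[OF cs b t this, folded grad[OF cs chart_coordinate(1)[OF cs t(2)]]]
    show ?thesis .
  qed
  obtain \<Omega> :: "(real ^ 'm) set" and x :: "real ^ 'm \<Rightarrow> real ^ 'n" and \<xi>
    where cs: "coordinate_system \<Omega> x \<xi>" and img: "x ` \<Omega> = simplex_int"
      and "linear \<xi>"
    by (rule global_chart)
  show ?thesis
  proof
    assume *: "gradient_flow TYPE('m) \<phi> f q \<gamma>"
    then have base: ?base by (auto simp: gradient_flow_def)
    have "?D t" if "t \<ge> 0" for t
    proof -
      have "\<gamma> t \<in> x ` \<Omega>" using base img that by auto
      then show ?thesis using * main[OF base cs that] cs that unfolding gradient_flow_def by blast
    qed
    then show "embedded_flow X' Y' r q \<gamma>" using base by (simp add: embedded_flow_def)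
  next
    assume *: "embedded_flow X' Y' r q \<gamma>"
    then have base: ?base by (auto simp: embedded_flow_def)
    then show "gradient_flow TYPE('m) \<phi> f q \<gamma>"
      using * main[OF base] by (simp add: embedded_flow_def gradient_flow_def)
  qed
qed

lemma geodesic_iff_embedded:
  fixes \<Gamma> :: "(real ^ 'm \<Rightarrow> real ^ 'n) \<Rightarrow> real ^ 'm \<Rightarrow> 'm \<Rightarrow> 'm \<Rightarrow> 'm \<Rightarrow> real"
    and X' Y' :: "real ^ 'n \<Rightarrow> real ^ 'n"
  assumes S: "divergence_pair TYPE('m) X' Y'"
    and \<Gamma>: "\<And>\<Omega> x \<xi> a i j k. \<lbrakk>coordinate_system \<Omega> x \<xi>; a \<in> \<Omega>\<rbrakk> \<Longrightarrow> \<Gamma> x a i j k =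
      (\<Sum>m\<in>UNIV. - (deriv2 (\<lambda>a. X' (x a)) a (axis i 1) (axis j 1)
          \<bullet> frechet_derivative (\<lambda>a. Y' (x a)) (at a) (axis m 1))
        * matrix_inv (conjugate_immersions.gram (\<lambda>a. X' (x a)) (\<lambda>a. Y' (x a)) a) $ m $ k)"
  shows "geodesic \<Gamma> {0..1} \<sigma> \<and> \<sigma> 0 = q \<and> \<sigma> 1 = r \<longleftrightarrow> embedded_geodesic X' q r \<sigma>"
proof -
  interpret S: divergence_pair X' Y' by (rule S)
  let ?D = "\<lambda>t. \<exists>\<rho>. velocity {0..1} (velocity {0..1} (X' \<circ> \<sigma>)) t = \<rho> *\<^sub>R X' (\<sigma> t)"
  have smooth: "smooth_curve_on {0..1} \<sigma> \<longleftrightarrow> smooth_within {0..1} \<sigma>"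
    by (rule smooth_curve_on_iff_smooth_within) (rule at_within_unit_interval_neq_bot)
  have main: "(\<forall>k. velocity {0..1} (velocity {0..1} (\<xi> \<circ> \<sigma>)) t $ k
      + (\<Sum>i\<in>UNIV. \<Sum>j\<in>UNIV. \<Gamma> x (\<xi> (\<sigma> t)) i j k
         * velocity {0..1} (\<xi> \<circ> \<sigma>) t $ i * velocity {0..1} (\<xi> \<circ> \<sigma>) t $ j) = 0) \<longleftrightarrow> ?D t"
    if \<sigma>: "smooth_within {0..1} \<sigma>" "\<sigma> ` {0..1} \<subseteq> simplex_int"
      and cs: "coordinate_system \<Omega> x \<xi>" and t: "t \<in> {0..1}" "\<sigma> t \<in> x ` \<Omega>"
    for \<Omega> x \<xi> t
    using S.geodesic_chart_iff[OF cs \<sigma> t] \<Gamma>[OF cs chart_coordinate(1)[OF cs t(2)]] by simp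
  obtain \<Omega> :: "(real ^ 'm) set" and x :: "real ^ 'm \<Rightarrow> real ^ 'n" and \<xi>
    where cs: "coordinate_system \<Omega> x \<xi>" and img: "x ` \<Omega> = simplex_int"
      and "linear \<xi>"
    by (rule global_chart)
  show ?thesis
  proof
    assume *: "geodesic \<Gamma> {0..1} \<sigma> \<and> \<sigma> 0 = q \<and> \<sigma> 1 = r"
    then have \<sigma>: "smooth_within {0..1} \<sigma>" "\<sigma> ` {0..1} \<subseteq> simplex_int"
      by (auto simp: geodesic_def smooth)
    have "?D t" if t: "t \<in> {0..1}" for t
    proof -
      have "\<sigma> t \<in> x ` \<Omega>" using \<sigma>(2) img t by auto
      then show ?thesis
        by (intro iffD1[OF main[OF \<sigma> cs t]] allI
            *[unfolded geodesic_def, THEN conjunct1, THEN conjunct2, THEN conjunct2, rule_format, OF cs t])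
    qed
    then show "embedded_geodesic X' q r \<sigma>" using * \<sigma> by (simp add: embedded_geodesic_def)
  next
    assume *: "embedded_geodesic X' q r \<sigma>"
    then have \<sigma>: "smooth_within {0..1} \<sigma>" "\<sigma> ` {0..1} \<subseteq> simplex_int"
      by (auto simp: embedded_geodesic_def)
    have D: "?D t" if "t \<in> {0..1}" for t using * that unfolding embedded_geodesic_def by blast
    have "geodesic \<Gamma> {0..1} \<sigma>"
      unfolding geodesic_def smooth
      by (intro conjI \<sigma> allI impI ballI) (rule iffD2[OF main[OF \<sigma>] D, rule_format])
    then show "geodesic \<Gamma> {0..1} \<sigma> \<and> \<sigma> 0 = q \<and> \<sigma> 1 = r"
      using * by (simp add: embedded_geodesic_def)
  qed
qed

context
  fixes \<phi> :: "real ^ 'n \<Rightarrow> real"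
  assumes T: "\<forall>y\<in>simplex_int. \<forall>z\<in>simplex_int. L_div \<phi> y z = ln (X y \<bullet> Y z)"
begin

lemma primal_flow_iff:
  assumes r: "r \<in> simplex_int"
  shows "primal_flow TYPE('m) \<phi> r q \<gamma> \<longleftrightarrow> embedded_flow X Y r q \<gamma>"
  unfolding primal_flow_def
proof (rule gradient_flow_iff_embedded[OF _ r])
  show "divergence_pair TYPE('m) X Y" by unfold_locales
qed (rule riem_grad_second[OF _ T _ r])

lemma dual_flow_iff:
  assumes p: "p \<in> simplex_int"
  shows "dual_flow TYPE('m) \<phi> p q \<gamma> \<longleftrightarrow> embedded_flow Y X p q \<gamma>"
  unfolding dual_flow_def
  by (rule gradient_flow_iff_embedded[OF swap_pair p])
    (simp add: gram_swap riem_grad_first[OF _ T _ p])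

lemma primal_geodesic_iff:
  "primal_geodesic_from_to TYPE('m) \<phi> q r \<sigma> \<longleftrightarrow> embedded_geodesic X q r \<sigma>"
  unfolding primal_geodesic_from_to_def
proof (rule geodesic_iff_embedded)
  show "divergence_pair TYPE('m) X Y" by unfold_locales
qed (simp add: primal_Gamma_def primal_Gamma_low_eq[OF _ T] inv_metric_eq[OF _ T])

lemma dual_geodesic_iff:
  "dual_geodesic_from_to TYPE('m) \<phi> q p \<sigma> \<longleftrightarrow> embedded_geodesic Y q p \<sigma>"
  unfolding dual_geodesic_from_to_def
  by (rule geodesic_iff_embedded[OF swap_pair])
    (simp add: dual_Gamma_def dual_Gamma_low_eq[OF _ T] inv_metric_eq[OF _ T] gram_swap)

end

end

section \<open>Reparametrisations of the unit interval\<close>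

lemma strict_mono_on_if_derivative_pos:
  fixes f :: "real \<Rightarrow> real"
  assumes I: "is_interval I" and f: "\<And>t. t \<in> I \<Longrightarrow> (f has_real_derivative f' t) (at t within I)"
    and pos: "\<And>t. t \<in> I \<Longrightarrow> f' t > 0"
  shows "strict_mono_on I f"
proof (rule strict_mono_onI)
  fix a b assume ab: "a \<in> I" "b \<in> I" "a < b"
  have sub: "{a..b} \<subseteq> I"
    using I ab(1,2) unfolding is_interval_1 by (meson atLeastAtMost_iff subsetI)
  have der: "(f has_real_derivative f' t) (at t within {a..b})" if "t \<in> {a..b}" for t
    using DERIV_subset[OF f sub] sub that by blast
  show "f a < f b"
  proof (rule DERIV_pos_imp_increasing_open[OF ab(3)])
    fix t assume t: "a < t" "t < b"
    then have "(f has_real_derivative f' t) (at t)"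
      using der[of t] at_within_Icc_at[OF t] by simp
    then show "\<exists>y. (f has_real_derivative y) (at t) \<and> 0 < y"
      using pos subsetD[OF sub, of t] t by auto
  next
    show "continuous_on {a..b} f" using der by (intro DERIV_continuous_on)
  qed
qed

lemma zero_derivative_constant:
  fixes f :: "real \<Rightarrow> 'a::real_normed_vector"
  assumes I: "convex I" and f: "\<And>t. t \<in> I \<Longrightarrow> (f has_vector_derivative 0) (at t within I)"
    and st: "s \<in> I" "t \<in> I"
  shows "f s = f t"
proof -
  obtain c where "\<And>x. x \<in> I \<Longrightarrow> f x = c"
    using has_vector_derivative_zero_constant[OF I f] by blast
  then show ?thesis using st by simp
qed

lemma unit_interval_inverse:
  fixes s :: "real \<Rightarrow> real"
  assumes mono: "strict_mono_on {0..1} s" and cont: "continuous_on {0..1} s" and s: "s 0 = 0" "s 1 = 1"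
  obtains g where "continuous_on {0..1} g" "strict_mono_on {0..1} g" "g ` {0..1} \<subseteq> {0..1}"
    "\<And>t. t \<in> {0..1} \<Longrightarrow> g (s t) = t" "\<And>y. y \<in> {0..1} \<Longrightarrow> s (g y) = y" "g 0 = 0" "g 1 = 1"
proof -
  have inj: "inj_on s {0..1}" using mono by (rule strict_mono_on_imp_inj_on)
  have img: "s ` {0..1} = {0..1}"
  proof (intro equalityI subsetI)
    fix y assume "y \<in> s ` {0..1}"
    then obtain t where t: "t \<in> {0..1}" "y = s t" by blast
    have "s 0 \<le> s t" "s t \<le> s 1"
      using t strict_mono_on_leD[OF mono] by auto
    then show "y \<in> {0..1}" using s t by simp
  next
    fix y :: real assume "y \<in> {0..1}"
    then show "y \<in> s ` {0..1}" using IVT'[of s 0 y 1] s cont by auto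
  qed
  define g where "g = the_inv_into {0..1} s"
  have gs: "g (s t) = t" if "t \<in> {0..1}" for t using the_inv_into_f_f[OF inj that] by (simp add: g_def)
  have sg: "s (g y) = y" "g y \<in> {0..1}" if "y \<in> {0..1}" for y
  proof -
    have "y \<in> s ` {0..1}" unfolding img by (rule that)
    then obtain t where "t \<in> {0..1}" "y = s t" by (rule imageE)
    then show "s (g y) = y" "g y \<in> {0..1}" using gs by auto
  qed
  have "continuous_on (s ` {0..1}) g" using cont gs by (intro continuous_on_inv) auto
  then have gc: "continuous_on {0..1} g" by (simp add: img)
  have "strict_mono_on {0..1} g"
  proof (rule strict_mono_onI)
    fix y z :: real assume yz: "y \<in> {0..1}" "z \<in> {0..1}" "y < z"
    show "g y < g z"
    proof (rule ccontr)
      assume "\<not> g y < g z"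
      then have "s (g z) \<le> s (g y)" using strict_mono_on_leD[OF mono] sg(2) yz by auto
      then show False using sg(1) yz by simp
    qed
  qed
  moreover have "g 0 = 0" "g 1 = 1" using gs[of 0] gs[of 1] s by auto
  ultimately show ?thesis using that[OF gc] gs sg by blast
qed

lemma ratio_strict_mono:
  fixes x y l :: real
  assumes "0 \<le> x" "x < y" "0 < l"
  shows "x / (x + l) < y / (y + l)"
proof -
  have "x * (y + l) < y * (x + l)" using assms by (simp add: algebra_simps)
  then show ?thesis using assms by (simp add: divide_simps)
qed

lemma tendsto_ratio_1:
  fixes K :: "'a \<Rightarrow> real"
  assumes K: "filterlim K at_top F"
  shows "((\<lambda>t. K t / (K t + l)) \<longlongrightarrow> 1) F"
proof -
  have Kl: "filterlim (\<lambda>t. K t + l) at_top F"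
    using filterlim_tendsto_add_at_top[OF tendsto_const K, of l] by (simp add: add.commute)
  have lim: "((\<lambda>t. 1 - l / (K t + l)) \<longlongrightarrow> 1 - 0) F"
    by (intro tendsto_diff tendsto_const tendsto_divide_0[OF tendsto_const]
        filterlim_at_top_imp_at_infinity[OF Kl])
  have "\<forall>\<^sub>F t in F. 1 - l / (K t + l) = K t / (K t + l)"
    using filterlim_at_top_dense[THEN iffD1, OF Kl, rule_format, of 0]
    by (rule eventually_mono) (simp add: field_simps)
  from Lim_transform_eventually[OF lim this] show ?thesis by simp
qed

text \<open>The substitution \<open>t = u / (1 - u)\<close> compactifies the half line.\<close>

lemma continuous_on_compactified_half_line:
  fixes f :: "real \<Rightarrow> 'a::topological_space"
  assumes f: "continuous_on {0..} f" and lim: "(f \<longlongrightarrow> l) at_top"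
  shows "continuous_on {0..1} (\<lambda>u. if u < 1 then f (u / (1 - u)) else l)" (is "continuous_on _ ?F")
  unfolding continuous_on_def
proof
  fix u :: real assume u: "u \<in> {0..1}"
  show "(?F \<longlongrightarrow> ?F u) (at u within {0..1})"
  proof (cases "u < 1")
    case True
    have "continuous_on {0..<1} (\<lambda>u. f (u / (1 - u)))"
      by (intro continuous_on_compose2[OF f] continuous_intros) auto
    then have "((\<lambda>u. f (u / (1 - u))) \<longlongrightarrow> f (u / (1 - u))) (at u within {0..<1})"
      using True u by (auto simp: continuous_on_def)
    moreover have "at u within {0..<1} = at u within {0..1}"
      using True by (intro at_within_nhd[of u "{..<1}"]) auto
    ultimately have "((\<lambda>u. f (u / (1 - u))) \<longlongrightarrow> f (u / (1 - u))) (at u within {0..1})" by simp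
    moreover have "\<forall>\<^sub>F v in at u within {0..1}. f (v / (1 - v)) = ?F v"
    proof -
      have "\<forall>\<^sub>F v in nhds u. v < 1" using True by (rule order_tendstoD[OF filterlim_ident])
      then have "\<forall>\<^sub>F v in at u within {0..1}. v < 1"
        unfolding eventually_at_filter by (rule eventually_mono) simp
      then show ?thesis by (rule eventually_mono) simp
    qed
    ultimately show ?thesis using True by (simp add: tendsto_cong)
  next
    case False
    then have u1: "u = 1" using u by simp
    have top: "filterlim (\<lambda>u::real. u / (1 - u)) at_top (at 1 within {0..<1})"
      unfolding filterlim_at_top
    proof
      fix Z :: real
      define M where "M = max Z 1"
      have M: "M \<ge> 1" "M \<ge> Z" by (auto simp: M_def)
      have "M / (M + 1) < 1" using M by simp
      then have "\<forall>\<^sub>F u in nhds 1. M / (M + 1) < u" by (rule order_tendstoD[OF filterlim_ident])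
      then show "\<forall>\<^sub>F u in at 1 within {0..<1}. Z \<le> u / (1 - u)"
        unfolding eventually_at_filter
      proof (rule eventually_mono, intro impI)
        fix u :: real assume u: "M / (M + 1) < u" "u \<in> {0..<1}"
        then have "M < u * (M + 1)" using M by (simp add: field_simps)
        then have "M * (1 - u) \<le> u" by (simp add: algebra_simps)
        then have "M \<le> u / (1 - u)" using u by (simp add: field_simps)
        then show "Z \<le> u / (1 - u)" using M by simp
      qed
    qed
    have 1: "((\<lambda>u. f (u / (1 - u))) \<longlongrightarrow> l) (at 1 within {0..<1})"
      by (rule filterlim_compose[OF lim top])
    have "at 1 within {0..<1} = at (1::real) within {0..1}"
      by (intro at_within_nhd[of 1 UNIV]) auto
    then have "((\<lambda>u. f (u / (1 - u))) \<longlongrightarrow> l) (at 1 within {0..1})" using 1 by simp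
    moreover have "\<forall>\<^sub>F v in at 1 within {0..1}. f (v / (1 - v)) = ?F v"
      unfolding eventually_at_filter by (rule always_eventually) auto
    ultimately show ?thesis by (simp add: u1 tendsto_cong)
  qed
qed

section \<open>Curves in a divergence pair\<close>

context divergence_pair
begin

lemma pairing_self: "y \<in> simplex_int \<Longrightarrow> X y \<bullet> Y y = 1"
  using pairing_eq by blast

text \<open>Pairing \<open>X y = c X z\<close> with \<open>Y z\<close> gives \<open>c \<ge> 1\<close>, and pairing it with \<open>Y y\<close> gives \<open>c \<le> 1\<close>; for
  \<open>c = 1\<close> the first pairing is the equality case of \<open>pairing_ge\<close>.\<close>

lemma proportional_imp_eq:
  assumes y: "y \<in> simplex_int" and z: "z \<in> simplex_int" and eq: "X y = c *\<^sub>R X z"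
  shows "y = z"
proof -
  have 1: "c * (X z \<bullet> Y y) = 1" using pairing_self[OF y] by (simp add: eq)
  have c: "c = X y \<bullet> Y z" using pairing_self[OF z] by (simp add: eq)
  have "c \<ge> 1" using pairing_ge[OF y z] c by simp
  moreover have "c * 1 \<le> c * (X z \<bullet> Y y)" using \<open>c \<ge> 1\<close> pairing_ge[OF z y] by (intro mult_left_mono) auto
  ultimately have "c = 1" using 1 by linarith
  then have "X y \<bullet> Y z = 1" using c by simp
  then show ?thesis using pairing_eq[OF y z] by simp
qed

lemma segment_pairing_pos:
  assumes q: "q \<in> simplex_int" and r: "r \<in> simplex_int" and l: "l \<in> {0..1}"
  shows "((1 - l) *\<^sub>R X q + l *\<^sub>R X r) \<bullet> Y q > 0"
proof -
  have "l * 1 \<le> l * (X r \<bullet> Y q)" using l pairing_ge[OF r q] by (intro mult_left_mono) auto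
  then have "(1 - l) + l * (X r \<bullet> Y q) > 0" by linarith
  then show ?thesis by (simp add: inner_add_left pairing_self[OF q])
qed

text \<open>The factor \<open>e\<^sup>t\<close> cancels the term \<open>- X (\<gamma> t)\<close> of the flow equation and leaves a velocity that is a
  positive multiple of \<open>X r\<close>.  The lower bound for \<open>K\<close> is \<open>X (\<gamma> t) \<bullet> Y r \<ge> 1\<close>.\<close>

lemma flow_normal_form:
  assumes fl: "embedded_flow X Y r q \<gamma>" and r: "r \<in> simplex_int"
  obtains K where "continuous_on {0..} K" "strict_mono_on {0..} K" "K 0 = 0"
    "\<And>t. t \<ge> 0 \<Longrightarrow> exp t *\<^sub>R X (\<gamma> t) = X q + K t *\<^sub>R X r"
    "\<And>t. t \<ge> 0 \<Longrightarrow> exp t - X q \<bullet> Y r \<le> K t" "filterlim K at_top at_top"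
proof -
  have \<gamma>: "\<gamma> 0 = q" "\<gamma> ` {0..} \<subseteq> simplex_int"
    and der: "\<And>t. t \<ge> 0 \<Longrightarrow> ((\<lambda>t. X (\<gamma> t)) has_vector_derivative
        (1 / (X r \<bullet> Y (\<gamma> t))) *\<^sub>R X r - X (\<gamma> t)) (at t within {0..})"
    using fl by (auto simp: embedded_flow_def o_def)
  have in_S: "\<gamma> t \<in> simplex_int" if "t \<ge> 0" for t using \<gamma>(2) that by auto
  define v where "v t = exp t *\<^sub>R X (\<gamma> t)" for t
  define k where "k t = exp t / (X r \<bullet> Y (\<gamma> t))" for t
  \<comment> \<open>The pairing with \<open>Y r\<close> reads off the coefficient of \<open>X r\<close>, as \<open>X r \<bullet> Y r = 1\<close>.\<close>
  define K where "K t = (v t - X q) \<bullet> Y r" for t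
  have k: "k t > 0" if "t \<ge> 0" for t using pairing_positive[OF r in_S[OF that]] by (simp add: k_def)
  have v: "(v has_vector_derivative k t *\<^sub>R X r) (at t within {0..})" if "t \<ge> 0" for t
    unfolding v_def[abs_def]
    by (rule derivative_eq_intros der that refl)+
      (simp add: k_def algebra_simps flip: scaleR_add_left scaleR_diff_left)
  have K: "(K has_real_derivative k t) (at t within {0..})" if "t \<ge> 0" for t
  proof -
    have "((\<lambda>t. (v t - X q) \<bullet> Y r) has_derivative (\<lambda>h. (h *\<^sub>R k t *\<^sub>R X r - 0) \<bullet> Y r)) (at t within {0..})"
      using v[OF that] unfolding has_vector_derivative_def
      by (intro has_derivative_inner_left has_derivative_diff) auto
    then show ?thesis
      by (simp add: K_def[abs_def] has_field_derivative_def pairing_self[OF r] mult_commute_abs)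
  qed
  have "((\<lambda>t. v t - K t *\<^sub>R X r) has_vector_derivative 0) (at t within {0..})" if "t \<in> {0..}" for t
    by (rule derivative_eq_intros v K refl | use that in simp)+
  from zero_derivative_constant[OF _ this, of _ 0]
  have const: "v t - K t *\<^sub>R X r = v 0 - K 0 *\<^sub>R X r" if "t \<ge> 0" for t
    using that by (metis atLeast_iff convex_real_interval(1) order_refl)
  have v0: "v 0 = X q" by (simp add: v_def \<gamma>(1))
  show ?thesis
  proof (rule that)
    show "continuous_on {0..} K" using K by (intro DERIV_continuous_on) auto
    show "strict_mono_on {0..} K" using K k by (intro strict_mono_on_if_derivative_pos) (auto simp: is_interval_ci)
    show "K 0 = 0" by (simp add: K_def v0)
    show "exp t *\<^sub>R X (\<gamma> t) = X q + K t *\<^sub>R X r" if "t \<ge> 0" for t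
      using const[OF that] v0 by (simp add: K_def v_def algebra_simps)
    show K_ge: "exp t - X q \<bullet> Y r \<le> K t" if "t \<ge> 0" for t
      using mult_left_mono[OF pairing_ge[OF in_S[OF that] r], of "exp t"]
      by (simp add: K_def v_def inner_diff_left)
    show "filterlim K at_top at_top"
    proof (rule filterlim_at_top_mono)
      show "filterlim (\<lambda>t. exp t - X q \<bullet> Y r) at_top at_top"
        using filterlim_tendsto_add_at_top[OF tendsto_const exp_at_top, of "- (X q \<bullet> Y r)"] by simp
      show "\<forall>\<^sub>F t in at_top. exp t - X q \<bullet> Y r \<le> K t"
        using eventually_ge_at_top[of 0] by (rule eventually_mono) (rule K_ge)
    qed
  qed
qed

text \<open>Let \<open>v = X \<circ> \<sigma>\<close>, so that \<open>v'' = \<rho> v\<close>.  The positive function \<open>h = v \<bullet> Y q\<close> solves the same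
  linear equation, hence the Wronskian \<open>h v' - h' v\<close> is constant.  It equals \<open>h\<^sup>2 (v / h)'\<close>, so \<open>v / h\<close>
  moves on a straight line with speed proportional to \<open>1 / h\<^sup>2\<close>; \<open>s\<close> is the fraction of the line
  covered so far.\<close>

lemma geodesic_normal_form:
  assumes geo: "embedded_geodesic X q r \<sigma>"
  obtains h h' s s' where
    "\<And>t. t \<in> {0..1} \<Longrightarrow> (h has_real_derivative h' t) (at t within {0..1})"
    "\<And>t. t \<in> {0..1} \<Longrightarrow> (s has_real_derivative s' t) (at t within {0..1})"
    "\<And>t. t \<in> {0..1} \<Longrightarrow> s' t > 0" "\<And>t. t \<in> {0..1} \<Longrightarrow> h t > 0" "s 0 = 0" "s 1 = 1" "h 0 = 1"
    "\<And>t. t \<in> {0..1} \<Longrightarrow> X (\<sigma> t) = (h t * (1 - s t)) *\<^sub>R X q + (h t * s t / h 1) *\<^sub>R X r"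
proof -
  have \<sigma>: "smooth_within {0..1} \<sigma>" "\<sigma> ` {0..1} \<subseteq> simplex_int" "\<sigma> 0 = q" "\<sigma> 1 = r"
    and par: "\<And>t. t \<in> {0..1} \<Longrightarrow> \<exists>\<rho>. velocity {0..1} (velocity {0..1} (X \<circ> \<sigma>)) t = \<rho> *\<^sub>R X (\<sigma> t)"
    using geo by (auto simp: embedded_geodesic_def)
  have in_S: "\<sigma> t \<in> simplex_int" if "t \<in> {0..1}" for t using \<sigma>(2) that by auto
  have q: "q \<in> simplex_int" using in_S[of 0] \<sigma>(3) by simp
  note nb = at_within_unit_interval_neq_bot
  define v where "v = X \<circ> \<sigma>"
  define v1 where "v1 = velocity {0..1} v"
  define v2 where "v2 = velocity {0..1} v1"
  have sv: "smooth_within {0..1} v" unfolding v_def by (rule smooth_embedded_curve[OF \<sigma>(1,2)])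
  have sv1: "smooth_within {0..1} v1" unfolding v1_def velocity_def[abs_def]
    by (rule smooth_within_vector_derivative(2)[OF nb sv])
  have v: "(v has_vector_derivative v1 t) (at t within {0..1})" if "t \<in> {0..1}" for t
    using smooth_within_vector_derivative(1)[OF nb sv that] by (simp add: v1_def velocity_def)
  have v1: "(v1 has_vector_derivative v2 t) (at t within {0..1})" if "t \<in> {0..1}" for t
    using smooth_within_vector_derivative(1)[OF nb sv1 that] by (simp add: v2_def velocity_def)
  define h where "h t = v t \<bullet> Y q" for t
  define h1 where "h1 t = v1 t \<bullet> Y q" for t
  have inner: "((\<lambda>t. f t \<bullet> Y q) has_real_derivative f' \<bullet> Y q) (at t within {0..1})"
    if "(f has_vector_derivative f') (at t within {0..1})" for f f' t
    using has_derivative_inner_left[OF that[unfolded has_vector_derivative_def], of "Y q"]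
    by (simp add: has_field_derivative_def mult_commute_abs)
  have h: "(h has_real_derivative h1 t) (at t within {0..1})" if "t \<in> {0..1}" for t
    using inner[OF v[OF that]] by (simp add: h_def[abs_def] h1_def)
  have h1: "(h1 has_real_derivative v2 t \<bullet> Y q) (at t within {0..1})" if "t \<in> {0..1}" for t
    using inner[OF v1[OF that]] by (simp add: h1_def[abs_def])
  have h_pos: "h t > 0" if "t \<in> {0..1}" for t
    using pairing_positive[OF in_S[OF that] q] by (simp add: h_def v_def)
  define W where "W t = h t *\<^sub>R v1 t - h1 t *\<^sub>R v t" for t
  have "(W has_vector_derivative 0) (at t within {0..1})" if t: "t \<in> {0..1}" for t
  proof -
    obtain \<rho> where "v2 t = \<rho> *\<^sub>R v t" using par[OF t] by (auto simp: v2_def v1_def v_def)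
    then have "h t *\<^sub>R v2 t + h1 t *\<^sub>R v1 t - (h1 t *\<^sub>R v1 t + (v2 t \<bullet> Y q) *\<^sub>R v t) = 0"
      by (simp add: h_def)
    moreover have "(W has_vector_derivative
        h t *\<^sub>R v2 t + h1 t *\<^sub>R v1 t - (h1 t *\<^sub>R v1 t + (v2 t \<bullet> Y q) *\<^sub>R v t)) (at t within {0..1})"
      unfolding W_def[abs_def]
      by (intro has_vector_derivative_diff has_vector_derivative_scaleR h h1 v v1 t)
    ultimately show ?thesis by simp
  qed
  then have W: "W t = W 0" if "t \<in> {0..1}" for t
    using zero_derivative_constant[of "{0..1}" W t 0] that by simp
  have cont: "continuous_on {0..1} (\<lambda>t. 1 / (h t)\<^sup>2)"
    using h h_pos by (intro continuous_intros DERIV_continuous_on) force+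
  define \<theta> where "\<theta> t = integral {0..t} (\<lambda>t. 1 / (h t)\<^sup>2)" for t
  have \<theta>: "(\<theta> has_real_derivative 1 / (h t)\<^sup>2) (at t within {0..1})" if "t \<in> {0..1}" for t
    using integral_has_vector_derivative[OF cont that]
    by (simp add: \<theta>_def[abs_def] has_real_derivative_iff_has_vector_derivative)
  have \<theta>0: "\<theta> 0 = 0" by (simp add: \<theta>_def)
  have mono: "strict_mono_on {0..1} \<theta>"
    using \<theta> h_pos by (intro strict_mono_on_if_derivative_pos) (force simp: is_interval_cc)+
  then have \<theta>1: "\<theta> 1 > 0" using \<theta>0 by (auto dest: strict_mono_onD[of _ _ 0 1])
  have "((\<lambda>t. (1 / h t) *\<^sub>R v t - \<theta> t *\<^sub>R W 0) has_vector_derivative 0) (at t within {0..1})"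
    if t: "t \<in> {0..1}" for t
  proof -
    have inv: "((\<lambda>t. 1 / h t) has_real_derivative - h1 t / (h t)\<^sup>2) (at t within {0..1})"
      using h_pos[OF t] by (auto intro!: derivative_eq_intros h t simp: power2_eq_square)
    have "((\<lambda>t. (1 / h t) *\<^sub>R v t - \<theta> t *\<^sub>R W 0) has_vector_derivative
        (1 / h t) *\<^sub>R v1 t + (- h1 t / (h t)\<^sup>2) *\<^sub>R v t - (\<theta> t *\<^sub>R 0 + (1 / (h t)\<^sup>2) *\<^sub>R W 0)) (at t within {0..1})"
      by (intro has_vector_derivative_diff has_vector_derivative_scaleR inv v \<theta> t has_vector_derivative_const)
    moreover have "(1 / (h t)\<^sup>2) *\<^sub>R W 0 = (1 / h t) *\<^sub>R v1 t + (- h1 t / (h t)\<^sup>2) *\<^sub>R v t"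
      unfolding W[OF t, symmetric] W_def[of t] using h_pos[OF t]
      by (simp add: scaleR_diff_right power2_eq_square)
    ultimately show ?thesis by simp
  qed
  then have "(1 / h t) *\<^sub>R v t - \<theta> t *\<^sub>R W 0 = (1 / h 0) *\<^sub>R v 0 - \<theta> 0 *\<^sub>R W 0"
    if "t \<in> {0..1}" for t
    using zero_derivative_constant[of "{0..1}" "\<lambda>t. (1 / h t) *\<^sub>R v t - \<theta> t *\<^sub>R W 0" t 0] that by simp
  moreover have h0: "h 0 = 1" "v 0 = X q" "v 1 = X r"
    using pairing_self[OF q] \<sigma>(3,4) by (auto simp: h_def v_def)
  ultimately have line: "(1 / h t) *\<^sub>R v t = X q + \<theta> t *\<^sub>R W 0" if "t \<in> {0..1}" for t
    using that \<theta>0 by (simp add: algebra_simps)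
  have W0: "W 0 = (1 / \<theta> 1) *\<^sub>R ((1 / h 1) *\<^sub>R X r - X q)"
    using line[of 1] \<theta>1 h0(3) by simp
  show ?thesis
  proof (rule that[of h h1 "\<lambda>t. \<theta> t / \<theta> 1" "\<lambda>t. 1 / (h t)\<^sup>2 / \<theta> 1"])
    fix t :: real assume t: "t \<in> {0..1}"
    show "((\<lambda>t. \<theta> t / \<theta> 1) has_real_derivative 1 / (h t)\<^sup>2 / \<theta> 1) (at t within {0..1})"
      by (intro DERIV_cdivide \<theta> t)
    show "0 < 1 / (h t)\<^sup>2 / \<theta> 1" using h_pos[OF t] \<theta>1 by simp
    have "X (\<sigma> t) = h t *\<^sub>R ((1 / h t) *\<^sub>R v t)" using h_pos[OF t] by (simp add: v_def)
    also have "\<dots> = h t *\<^sub>R (X q + (\<theta> t / \<theta> 1) *\<^sub>R ((1 / h 1) *\<^sub>R X r - X q))"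
      by (simp add: line[OF t] W0)
    also have "\<dots> = (h t * (1 - \<theta> t / \<theta> 1)) *\<^sub>R X q + (h t * (\<theta> t / \<theta> 1) / h 1) *\<^sub>R X r"
      by (simp add: algebra_simps)
    finally show "X (\<sigma> t) = (h t * (1 - \<theta> t / \<theta> 1)) *\<^sub>R X q + (h t * (\<theta> t / \<theta> 1) / h 1) *\<^sub>R X r" .
  qed (use h h_pos \<theta>0 \<theta>1 h0 in auto)
qed

lemma geodesic_ends_in_simplex:
  "embedded_geodesic X q r \<sigma> \<Longrightarrow> q \<in> simplex_int" "embedded_geodesic X q r \<sigma> \<Longrightarrow> r \<in> simplex_int"
  by (force simp: embedded_geodesic_def)+

text \<open>Before the end of the geodesic both curves have the form \<open>c (X q + k X r)\<close> under \<open>X\<close>, with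
  \<open>c > 0\<close>, and \<open>k\<close> increases from \<open>0\<close> to \<open>\<infinity>\<close> along each.  The time change matches the values of \<open>k\<close>.\<close>

lemma flow_is_time_change:
  assumes fl: "embedded_flow X Y r q \<gamma>" and geo: "embedded_geodesic X q r \<sigma>"
  shows "time_change \<gamma> \<sigma>"
proof -
  have r: "r \<in> simplex_int" by (rule geodesic_ends_in_simplex(2)[OF geo])
  obtain K where K: "continuous_on {0..} K" "strict_mono_on {0..} K" "K 0 = 0"
    and flow: "\<And>t. t \<ge> 0 \<Longrightarrow> exp t *\<^sub>R X (\<gamma> t) = X q + K t *\<^sub>R X r"
    and "\<And>t. t \<ge> 0 \<Longrightarrow> exp t - X q \<bullet> Y r \<le> K t" and K_lim: "filterlim K at_top at_top"
    using flow_normal_form[OF fl r] by blast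
  obtain h h' s s' where
    h: "\<And>t. t \<in> {0..1} \<Longrightarrow> (h has_real_derivative h' t) (at t within {0..1})"
    and s: "\<And>t. t \<in> {0..1} \<Longrightarrow> (s has_real_derivative s' t) (at t within {0..1})"
    and pos: "\<And>t. t \<in> {0..1} \<Longrightarrow> s' t > 0" "\<And>t. t \<in> {0..1} \<Longrightarrow> h t > 0"
    and ends: "s 0 = 0" "s 1 = 1" "h 0 = 1"
    and line: "\<And>t. t \<in> {0..1} \<Longrightarrow> X (\<sigma> t) = (h t * (1 - s t)) *\<^sub>R X q + (h t * s t / h 1) *\<^sub>R X r"
    using geodesic_normal_form[OF geo] by blast
  have s_mono: "strict_mono_on {0..1} s"
    using s pos(1) by (intro strict_mono_on_if_derivative_pos) (auto simp: is_interval_cc)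
  have s_cont: "continuous_on {0..1} s" using s by (intro DERIV_continuous_on) auto
  obtain g where g: "continuous_on {0..1} g" "strict_mono_on {0..1} g" "g ` {0..1} \<subseteq> {0..1}"
    "\<And>t. t \<in> {0..1} \<Longrightarrow> g (s t) = t" "\<And>y. y \<in> {0..1} \<Longrightarrow> s (g y) = y" "g 0 = 0" "g 1 = 1"
    using unit_interval_inverse[OF s_mono s_cont ends(1,2)] by blast
  define l where "l = 1 / h 1"
  have l: "l > 0" using pos(2)[of 1] by (simp add: l_def)
  have K_nonneg: "K t \<ge> 0" if "t \<ge> 0" for t
    using strict_mono_on_leD[OF K(2), of 0 t] that K(3) by simp
  \<comment> \<open>Along the geodesic \<open>k = l s / (1 - s)\<close>, which equals \<open>K t\<close> iff \<open>s = K t / (K t + l)\<close>.\<close>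
  define \<psi> where "\<psi> t = K t / (K t + l)" for t
  have \<psi>: "\<psi> t \<ge> 0" "\<psi> t < 1" if "t \<ge> 0" for t
    using K_nonneg[OF that] l by (auto simp: \<psi>_def)
  have in01: "\<psi> t \<in> {0..1}" if "t \<ge> 0" for t using \<psi>[OF that] by simp
  have g01: "g (\<psi> t) \<in> {0..1}" if "t \<ge> 0" for t using g(3) in01[OF that] by blast
  have \<psi>_cont: "continuous_on {0..} \<psi>"
  proof -
    have "K t + l \<noteq> 0" if "t \<in> {0..}" for t using K_nonneg[of t] that l by simp
    then show ?thesis unfolding \<psi>_def[abs_def] by (intro continuous_intros K(1)) auto
  qed
  have \<psi>_mono: "\<psi> a < \<psi> b" if "0 \<le> a" "a < b" for a b
  proof -
    have "K a < K b" using strict_mono_onD[OF K(2)] that by simp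
    then show ?thesis unfolding \<psi>_def by (rule ratio_strict_mono[OF K_nonneg[OF that(1)] _ l])
  qed
  have \<psi>_lim: "(\<psi> \<longlongrightarrow> 1) at_top" unfolding \<psi>_def[abs_def] by (rule tendsto_ratio_1[OF K_lim])
  have "((\<lambda>t. g (\<psi> t)) \<longlongrightarrow> g 1) at_top"
    by (rule continuous_on_tendsto_compose[OF g(1) \<psi>_lim])
      (use in01 in \<open>auto intro: eventually_mono[OF eventually_ge_at_top[of 0]]\<close>)
  then have lim: "((\<lambda>t. g (\<psi> t)) \<longlongrightarrow> 1) at_top" by (simp add: g(7))
  have mono: "g (\<psi> a) < g (\<psi> b)" if "0 \<le> a" "a < b" for a b
    using strict_mono_onD[OF g(2) in01 in01 \<psi>_mono] that by simp
  have lt1: "g (\<psi> t) < 1" if "t \<ge> 0" for t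
    using strict_mono_onD[OF g(2) in01[OF that], of 1] \<psi>(2)[OF that] g(7) by simp
  have eq: "\<gamma> t = \<sigma> (g (\<psi> t))" if t: "t \<ge> 0" for t
  proof -
    let ?u = "g (\<psi> t)"
    have su: "s ?u = \<psi> t" using g(5) in01[OF t] by blast
    have Kl: "K t + l > 0" using K_nonneg[OF t] l by simp
    have 1: "1 - \<psi> t = l / (K t + l)" using Kl by (simp add: \<psi>_def field_simps)
    have "X (\<sigma> ?u) = (h ?u * (l / (K t + l))) *\<^sub>R X q + (h ?u * \<psi> t * l) *\<^sub>R X r"
      using line[OF g01[OF t]] by (simp add: su 1 l_def)
    also have "\<dots> = (h ?u * (l / (K t + l))) *\<^sub>R (X q + K t *\<^sub>R X r)"
      by (simp add: \<psi>_def scaleR_add_right mult_ac)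
    also have "\<dots> = (h ?u * (l / (K t + l)) * exp t) *\<^sub>R X (\<gamma> t)"
      by (simp add: flow[OF t, symmetric])
    finally have "X (\<sigma> ?u) = (h ?u * (l / (K t + l)) * exp t) *\<^sub>R X (\<gamma> t)" .
    moreover have "\<sigma> ?u \<in> simplex_int" "\<gamma> t \<in> simplex_int"
      using geo fl g01[OF t] t by (auto simp: embedded_geodesic_def embedded_flow_def)
    ultimately show ?thesis using proportional_imp_eq by metis
  qed
  show ?thesis
    unfolding time_change_def
  proof (intro exI[of _ "\<lambda>t. g (\<psi> t)"] conjI)
    show "continuous_on {0..} (\<lambda>t. g (\<psi> t))"
      by (rule continuous_on_compose2[OF g(1) \<psi>_cont]) (use in01 in \<open>simp add: image_subset_iff\<close>)
    show "strict_mono_on {0..} (\<lambda>t. g (\<psi> t))"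
    proof (rule strict_mono_onI)
      fix a b :: real assume "a \<in> {0..}" "b \<in> {0..}" "a < b"
      then show "g (\<psi> a) < g (\<psi> b)" by (intro mono) auto
    qed
    show "(\<lambda>t. g (\<psi> t)) ` {0..} \<subseteq> {0..<1}"
      unfolding image_subset_iff using g01 lt1 by simp
    show "g (\<psi> 0) = 0" by (simp add: \<psi>_def K(3) g(6))
    show "((\<lambda>t. g (\<psi> t)) \<longlongrightarrow> 1) at_top" by (rule lim)
    show "\<forall>t\<ge>0. \<gamma> t = \<sigma> (g (\<psi> t))" using eq by blast
  qed
qed

text \<open>Along the flow the coefficient of \<open>X q\<close> is \<open>e\<^sup>-\<^sup>t\<close>, so the flow is the geodesic run at the time where
  its coefficient \<open>\<alpha>\<close> of \<open>X q\<close> has this value; the flow equation then holds because the velocity is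
  orthogonal to \<open>Y\<close>.  The point is that \<open>\<alpha>\<close> has no critical point.  At a critical point of \<open>\<alpha>\<close> the
  velocity would be a multiple of \<open>X r\<close> and orthogonal to \<open>Y\<close>, hence zero; then both coefficients
  would be stationary, against \<open>s' > 0\<close>.\<close>

lemma flow_exists_if_geodesic_exists:
  assumes geo: "embedded_geodesic X q r \<sigma>"
  shows "\<exists>\<gamma>. embedded_flow X Y r q \<gamma>"
proof -
  have r: "r \<in> simplex_int" by (rule geodesic_ends_in_simplex(2)[OF geo])
  have \<sigma>: "smooth_within {0..1} \<sigma>" "\<sigma> ` {0..1} \<subseteq> simplex_int" "\<sigma> 0 = q"
    using geo by (auto simp: embedded_geodesic_def)
  have in_S: "\<sigma> t \<in> simplex_int" if "t \<in> {0..1}" for t using \<sigma>(2) that by auto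
  obtain h h' s s' where
    h: "\<And>t. t \<in> {0..1} \<Longrightarrow> (h has_real_derivative h' t) (at t within {0..1})"
    and s: "\<And>t. t \<in> {0..1} \<Longrightarrow> (s has_real_derivative s' t) (at t within {0..1})"
    and pos: "\<And>t. t \<in> {0..1} \<Longrightarrow> s' t > 0" "\<And>t. t \<in> {0..1} \<Longrightarrow> h t > 0"
    and ends: "s 0 = 0" "s 1 = 1" "h 0 = 1"
    and line: "\<And>t. t \<in> {0..1} \<Longrightarrow> X (\<sigma> t) = (h t * (1 - s t)) *\<^sub>R X q + (h t * s t / h 1) *\<^sub>R X r"
    using geodesic_normal_form[OF geo] by blast
  define \<alpha> where "\<alpha> t = h t * (1 - s t)" for t
  define \<beta> where "\<beta> t = h t * s t / h 1" for t
  define \<alpha>' where "\<alpha>' t = h' t * (1 - s t) - h t * s' t" for t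
  define \<beta>' where "\<beta>' t = (h' t * s t + h t * s' t) / h 1" for t
  have \<alpha>: "(\<alpha> has_real_derivative \<alpha>' t) (at t within {0..1})" if "t \<in> {0..1}" for t
    unfolding \<alpha>_def[abs_def] \<alpha>'_def
    by (rule derivative_eq_intros h s that refl)+ (simp add: algebra_simps)
  have \<beta>: "(\<beta> has_real_derivative \<beta>' t) (at t within {0..1})" if "t \<in> {0..1}" for t
  proof -
    have "((\<lambda>t. h t * s t) has_real_derivative h' t * s t + h t * s' t) (at t within {0..1})"
      by (rule derivative_eq_intros h s that refl)+ simp
    then show ?thesis unfolding \<beta>_def[abs_def] \<beta>'_def by (rule DERIV_cdivide)
  qed
  have X\<sigma>: "X (\<sigma> t) = \<alpha> t *\<^sub>R X q + \<beta> t *\<^sub>R X r" if "t \<in> {0..1}" for t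
    using line[OF that] by (simp add: \<alpha>_def \<beta>_def)
  have v: "((X \<circ> \<sigma>) has_vector_derivative \<alpha>' t *\<^sub>R X q + \<beta>' t *\<^sub>R X r) (at t within {0..1})"
    if t: "t \<in> {0..1}" for t
  proof -
    have "((\<lambda>t. \<alpha> t *\<^sub>R X q + \<beta> t *\<^sub>R X r) has_vector_derivative
        (\<alpha> t *\<^sub>R 0 + \<alpha>' t *\<^sub>R X q) + (\<beta> t *\<^sub>R 0 + \<beta>' t *\<^sub>R X r)) (at t within {0..1})"
      by (intro has_vector_derivative_add has_vector_derivative_scaleR \<alpha> \<beta> t has_vector_derivative_const)
    then have "((\<lambda>t. \<alpha> t *\<^sub>R X q + \<beta> t *\<^sub>R X r) has_vector_derivative
        \<alpha>' t *\<^sub>R X q + \<beta>' t *\<^sub>R X r) (at t within {0..1})" by simp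
    then show ?thesis by (rule has_vector_derivative_transform[OF t, rotated]) (simp add: X\<sigma>)
  qed
  have orth: "(\<alpha>' t *\<^sub>R X q + \<beta>' t *\<^sub>R X r) \<bullet> Y (\<sigma> t) = 0" if "t \<in> {0..1}" for t
    by (rule embedded_velocity_orthogonal[OF \<sigma>(1,2) that at_within_unit_interval_neq_bot[OF that] v[OF that]])
  have \<alpha>'_nz: "\<alpha>' t \<noteq> 0" if t: "t \<in> {0..1}" for t
  proof
    assume 0: "\<alpha>' t = 0"
    then have "\<beta>' t = 0" using orth[OF t] pairing_positive[OF r in_S[OF t]] by simp
    then have 1: "h' t * s t + h t * s' t = 0" using pos(2)[of 1] by (simp add: \<beta>'_def)
    have "h' t = 0" using 0 1 by (simp add: \<alpha>'_def algebra_simps)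
    then show False using 1 pos[OF t] by simp
  qed
  have \<alpha>_ends: "\<alpha> 0 = 1" "\<alpha> 1 = 0" "\<beta> 0 = 0" using ends by (auto simp: \<alpha>_def \<beta>_def)
  define A where "A t = 1 - \<alpha> t" for t
  have A: "(A has_real_derivative - \<alpha>' t) (at t within {0..1})" if "t \<in> {0..1}" for t
    unfolding A_def[abs_def] using \<alpha>[OF that] by (auto intro!: derivative_eq_intros)
  have A_cont: "continuous_on {0..1} A" using A by (intro DERIV_continuous_on) auto
  have A_ends: "A 0 = 0" "A 1 = 1" using \<alpha>_ends by (auto simp: A_def)
  have A_ne: "A a \<noteq> A b" if ab: "0 \<le> a" "a < b" "b \<le> 1" for a b
  proof
    assume eq: "A a = A b"
    have der: "(A has_derivative (*) (- \<alpha>' t)) (at t)" if "a < t" "t < b" for t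
    proof -
      have "at t within {0..1} = at t" using that ab by (intro at_within_Icc_at) auto
      then show ?thesis using A[of t] that ab
        by (simp add: has_field_derivative_def)
    qed
    have "continuous_on {a..b} A" using A_cont by (rule continuous_on_subset) (use ab in auto)
    from Rolle_deriv[OF ab(2) eq this, of "\<lambda>t. (*) (- \<alpha>' t)"] der
    obtain t where t: "a < t" "t < b" "(*) (- \<alpha>' t) = (\<lambda>v. 0)" by blast
    from fun_cong[OF t(3), of 1] have "\<alpha>' t = 0" by simp
    moreover have "t \<in> {0..1}" using t(1,2) ab by simp
    ultimately show False using \<alpha>'_nz by blast
  qed
  have A_inj: "inj_on A {0..1}"
  proof (rule inj_onI)
    fix a b :: real assume "a \<in> {0..1}" "b \<in> {0..1}" "A a = A b"
    then show "a = b" using A_ne[of a b] A_ne[of b a] by (cases a b rule: linorder_cases) auto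
  qed
  have A_mono: "strict_mono_on {0..1} A"
  proof (rule strict_mono_onI)
    have pos: "A 0 < A b \<and> (b < 1 \<longrightarrow> A b < A 1)" if b: "0 < b" "b \<le> 1" for b
    proof (cases "b = 1")
      case False
      then have "(A 0 < A b \<and> A b < A 1) \<or> (A 1 < A b \<and> A b < A 0)"
        using b by (intro continuous_inj_imp_mono[of 0 b 1 A, OF _ _ A_cont A_inj]) auto
      then show ?thesis using A_ends by auto
    qed (use A_ends in auto)
    fix a b :: real assume ab: "a \<in> {0..1}" "b \<in> {0..1}" "a < b"
    show "A a < A b"
    proof (cases "a = 0")
      case True
      then show ?thesis using pos[of b] ab by simp
    next
      case False
      have "(A 0 < A a \<and> A a < A b) \<or> (A b < A a \<and> A a < A 0)"
      proof (rule continuous_inj_imp_mono[of 0 a b A])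
        show "continuous_on {0..b} A" using A_cont by (rule continuous_on_subset) (use ab in auto)
        show "inj_on A {0..b}" using A_inj by (rule inj_on_subset) (use ab in auto)
      qed (use False ab in auto)
      then show ?thesis using pos[of a] False ab by auto
    qed
  qed
  obtain g where g: "continuous_on {0..1} g" "strict_mono_on {0..1} g" "g ` {0..1} \<subseteq> {0..1}"
    "\<And>t. t \<in> {0..1} \<Longrightarrow> g (A t) = t" "\<And>y. y \<in> {0..1} \<Longrightarrow> A (g y) = y" "g 0 = 0" "g 1 = 1"
    using unit_interval_inverse[OF A_mono A_cont A_ends] by blast
  define \<tau> where "\<tau> t = g (1 - exp (- t))" for t :: real
  have in01: "1 - exp (- t) \<in> {0..1}" if "t \<ge> 0" for t :: real using that by auto
  have \<tau>01: "\<tau> t \<in> {0..1}" if "t \<ge> 0" for t using g(3) in01[OF that] unfolding \<tau>_def by blast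
  have \<tau>_img: "\<tau> ` {0..} \<subseteq> {0..1}" by (rule image_subsetI) (rule \<tau>01, simp)
  have A\<tau>: "A (\<tau> t) = 1 - exp (- t)" if "t \<ge> 0" for t using g(5) in01[OF that] unfolding \<tau>_def by blast
  have \<tau>_cont: "continuous_on {0..} \<tau>"
    unfolding \<tau>_def[abs_def]
    by (rule continuous_on_compose2[OF g(1)]) (auto intro!: continuous_intros)
  have \<tau>: "(\<tau> has_real_derivative exp (- t) / - \<alpha>' (\<tau> t)) (at t within {0..})" if t: "t \<ge> 0" for t
  proof -
    have "(\<tau> has_derivative (\<lambda>v. inverse (- \<alpha>' (\<tau> t)) * (exp (- t) * v))) (at t within {0..})"
    proof (rule has_derivative_lift[where N = A and L = "\<lambda>v. - \<alpha>' (\<tau> t) * v" and T = "{0..1}"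
          and P = "(*) (inverse (- \<alpha>' (\<tau> t)))" and h = "\<lambda>v. exp (- t) * v"])
      show "(A has_derivative (\<lambda>v. - \<alpha>' (\<tau> t) * v)) (at (\<tau> t) within {0..1})"
        using A[OF \<tau>01[OF t]] unfolding has_field_derivative_def .
      show "bounded_linear ((*) (inverse (- \<alpha>' (\<tau> t))))" by (rule bounded_linear_mult_right)
      show "inverse (- \<alpha>' (\<tau> t)) * (- \<alpha>' (\<tau> t) * v) = v" for v using \<alpha>'_nz[OF \<tau>01[OF t]] by simp
      show "\<tau> ` {0..} \<subseteq> {0..1}" by (rule \<tau>_img)
      show "continuous (at t within {0..}) \<tau>"
        using \<tau>_cont t by (simp add: continuous_on_eq_continuous_within)
      have "((\<lambda>b. 1 - exp (- b)) has_derivative (\<lambda>v. exp (- t) * v)) (at t within {0..})"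
        by (auto intro!: derivative_eq_intros)
      then show "((\<lambda>b. A (\<tau> b)) has_derivative (\<lambda>v. exp (- t) * v)) (at t within {0..})"
        by (rule has_derivative_transform[rotated 2]) (use t in \<open>simp_all add: A\<tau>\<close>)
    qed (use t in auto)
    moreover have "(\<lambda>v. inverse (- \<alpha>' (\<tau> t)) * (exp (- t) * v)) = (*) (exp (- t) / - \<alpha>' (\<tau> t))"
      by (simp add: fun_eq_iff divide_inverse mult_ac)
    ultimately show ?thesis unfolding has_field_derivative_def by metis
  qed
  have "((X \<circ> (\<sigma> \<circ> \<tau>)) has_vector_derivative (1 / (X r \<bullet> Y (\<sigma> (\<tau> t)))) *\<^sub>R X r - X (\<sigma> (\<tau> t)))
      (at t within {0..})" if t: "t \<ge> 0" for t
  proof -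
    let ?u = "\<tau> t" and ?\<tau>' = "exp (- t) / - \<alpha>' (\<tau> t)"
    let ?b = "?\<tau>' * \<beta>' ?u"
    have "((\<lambda>t. (X \<circ> \<sigma>) (\<tau> t)) has_derivative (\<lambda>x. (?\<tau>' * x) *\<^sub>R (\<alpha>' ?u *\<^sub>R X q + \<beta>' ?u *\<^sub>R X r)))
        (at t within {0..})"
    proof (rule has_derivative_in_compose2[where t = "{0..1}" and f = \<tau> and f' = "\<lambda>x. ?\<tau>' * x"
          and g = "X \<circ> \<sigma>"
          and g' = "\<lambda>u x. x *\<^sub>R (\<alpha>' u *\<^sub>R X q + \<beta>' u *\<^sub>R X r)"])
      show "\<tau> ` {0..} \<subseteq> {0..1}" by (rule \<tau>_img)
      show "(\<tau> has_derivative (\<lambda>x. ?\<tau>' * x)) (at t within {0..})"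
        using \<tau>[OF t] unfolding has_field_derivative_def .
    qed (use v t in \<open>auto simp: has_vector_derivative_def\<close>)
    moreover have "(?\<tau>' * x) *\<^sub>R (\<alpha>' ?u *\<^sub>R X q + \<beta>' ?u *\<^sub>R X r)
        = x *\<^sub>R (?b *\<^sub>R X r - exp (- t) *\<^sub>R X q)" for x
      using \<alpha>'_nz[OF \<tau>01[OF t]] by (simp add: algebra_simps)
    ultimately have der: "((X \<circ> (\<sigma> \<circ> \<tau>)) has_vector_derivative ?b *\<^sub>R X r - exp (- t) *\<^sub>R X q) (at t within {0..})"
      by (simp add: has_vector_derivative_def o_def)
    have e: "exp (- t) = \<alpha> ?u" using A\<tau>[OF t] by (simp add: A_def)
    have eq: "?b *\<^sub>R X r - exp (- t) *\<^sub>R X q = (?b + \<beta> ?u) *\<^sub>R X r - X (\<sigma> ?u)"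
      using X\<sigma>[OF \<tau>01[OF t]] by (simp add: e algebra_simps)
    have "(?b *\<^sub>R X r - exp (- t) *\<^sub>R X q) \<bullet> Y (\<sigma> ?u) = ?\<tau>' * ((\<alpha>' ?u *\<^sub>R X q + \<beta>' ?u *\<^sub>R X r) \<bullet> Y (\<sigma> ?u))"
      using \<alpha>'_nz[OF \<tau>01[OF t]] by (simp add: inner_add_left inner_diff_left algebra_simps)
    then have "((?b + \<beta> ?u) *\<^sub>R X r - X (\<sigma> ?u)) \<bullet> Y (\<sigma> ?u) = 0"
      unfolding eq using orth[OF \<tau>01[OF t]] by simp
    then have "(?b + \<beta> ?u) * (X r \<bullet> Y (\<sigma> ?u)) = 1"
      using pairing_self[OF in_S[OF \<tau>01[OF t]]] by (simp add: inner_diff_left)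
    then have "?b + \<beta> ?u = 1 / (X r \<bullet> Y (\<sigma> ?u))"
      using pairing_positive[OF r in_S[OF \<tau>01[OF t]]] by (simp add: eq_divide_eq)
    then show ?thesis using der eq by simp
  qed
  moreover have "continuous_on {0..} (\<sigma> \<circ> \<tau>)" unfolding o_def
    by (rule continuous_on_compose2[OF smooth_within_continuous_on[OF \<sigma>(1)] \<tau>_cont \<tau>_img])
  moreover have "(\<sigma> \<circ> \<tau>) ` {0..} \<subseteq> simplex_int" using \<sigma>(2) \<tau>_img by auto
  moreover have "(\<sigma> \<circ> \<tau>) 0 = q" by (simp add: \<tau>_def g(6) \<sigma>(3))
  ultimately have "embedded_flow X Y r q (\<sigma> \<circ> \<tau>)" by (simp add: embedded_flow_def)
  then show ?thesis by blast
qed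

text \<open>The curve is the lift of a segment through the normalisation \<open>X / (X \<bullet> Y q)\<close>, which is an
  immersion because \<open>X\<close> is transversal to the image of its derivative.\<close>

lemma smooth_segment_lift:
  assumes q: "q \<in> simplex_int" and r: "r \<in> simplex_int"
    and z: "continuous_on {0..1} z" "z ` {0..1} \<subseteq> simplex_int"
    and seg: "\<And>l. l \<in> {0..1} \<Longrightarrow> \<exists>c. X (z l) = c *\<^sub>R ((1 - l) *\<^sub>R X q + l *\<^sub>R X r)"
  shows "smooth_within {0..1} z"
proof -
  define w where "w = Y q"
  define b where "b l = (1 - l) *\<^sub>R X q + l *\<^sub>R X r" for l
  have bw: "b l \<bullet> w > 0" if "l \<in> {0..1}" for l
    unfolding b_def w_def by (rule segment_pairing_pos[OF q r that])
  obtain \<Omega> :: "(real ^ 'm) set" and x :: "real ^ 'm \<Rightarrow> real ^ 'n" and \<xi>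
    where cs: "coordinate_system \<Omega> x \<xi>" and img: "x ` \<Omega> = simplex_int" and "linear \<xi>"
    by (rule global_chart)
  interpret C: conjugate_immersions \<Omega> "\<lambda>a. X (x a)" "\<lambda>a. Y (x a)" by (rule chart[OF cs])
  have hom: "homeomorphism \<Omega> simplex_int x \<xi>" using cs img by (auto simp: coordinate_system_def)
  have x\<Omega>: "x a \<in> simplex_int" if "a \<in> \<Omega>" for a using img that by blast
  have pos: "X (x a) \<bullet> w > 0" if "a \<in> \<Omega>" for a
    using pairing_positive[OF x\<Omega>[OF that] q] by (simp add: w_def)
  define u where "u = \<xi> \<circ> z"
  have in_S: "z l \<in> simplex_int" if "l \<in> {0..1}" for l using z(2) that by auto
  have "u l \<in> \<Omega> \<and> x (u l) = z l" if "l \<in> {0..1}" for l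
    using hom in_S[OF that] by (auto simp: u_def homeomorphism_def)
  then have u: "u ` {0..1} \<subseteq> \<Omega>" "\<And>l. l \<in> {0..1} \<Longrightarrow> x (u l) = z l" by blast+
  have u_cont: "continuous_on {0..1} u"
    unfolding u_def o_def
    by (rule continuous_on_compose2[OF _ z]) (use hom in \<open>simp add: homeomorphism_def\<close>)
  define N where "N a = inverse (X (x a) \<bullet> w) *\<^sub>R X (x a)" for a
  have N: "smooth_within \<Omega> N" unfolding N_def[abs_def]
    using pos by (intro smooth_within_scaleR smooth_within_inverse smooth_within_inner
        smooth_within_const C.smooth_F) force
  have "inj (frechet_derivative N (at a))" if a: "a \<in> \<Omega>" for a
  proof -
    let ?p = "X (x a) \<bullet> w"
    let ?d = "\<lambda>v. inverse ?p *\<^sub>R C.DF a v + (- (inverse ?p * (C.DF a v \<bullet> w) * inverse ?p)) *\<^sub>R X (x a)"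
    have "(N has_derivative ?d) (at a)"
      unfolding N_def[abs_def] using pos[OF a]
      by (intro has_derivative_scaleR Deriv.has_derivative_inverse has_derivative_inner_left C.DF a) auto
    then have eq: "frechet_derivative N (at a) = ?d" by (rule frechet_derivative_at[symmetric])
    have lin: "linear (frechet_derivative N (at a))"
      by (rule linear_frechet_derivative[OF C.open_V N a])
    have "v = 0" if "frechet_derivative N (at a) v = 0" for v
    proof -
      have 0: "?d v = 0" using that unfolding eq .
      then have "?d v \<bullet> Y (x a) = 0" by simp
      then have "C.DF a v \<bullet> w = 0"
        using pos[OF a] by (simp add: inner_add_left inner_diff_left C.DF_orthogonal[OF a] C.pairing_eq_1[OF a])
      then have "C.DF a v = 0" using 0 pos[OF a] by simp
      then show "v = 0" using C.negative[OF a, of v] by force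
    qed
    then show ?thesis using linear_injective_0[OF lin] by blast
  qed
  moreover have "smooth_within {0..1} (\<lambda>l. N (u l))"
  proof (rule smooth_within_cong)
    show "smooth_within {0..1} (\<lambda>l. inverse (b l \<bullet> w) *\<^sub>R b l)"
      unfolding b_def using bw[unfolded b_def]
      by (intro smooth_within_scaleR smooth_within_inverse smooth_within_inner smooth_within_add
          smooth_within_diff smooth_within_const smooth_within_id) force
    fix l :: real assume l: "l \<in> {0..1}"
    obtain c where c: "X (z l) = c *\<^sub>R b l" using seg[OF l] by (auto simp: b_def)
    have "z l \<in> simplex_int" using z(2) l by auto
    then have "c \<noteq> 0" using pairing_positive[OF _ q, of "z l"] c by auto
    then show "inverse (b l \<bullet> w) *\<^sub>R b l = N (u l)" by (simp add: N_def u(2)[OF l] c)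
  qed
  ultimately have us: "smooth_within {0..1} u"
    by (intro smooth_within_lift[OF C.open_V N _ u(1) u_cont])
  have "smooth_within \<Omega> x"
    using cs by (intro smooth_on_imp_smooth_within C.open_V) (simp add: coordinate_system_def)
  from smooth_within_compose[OF this us u(1)] have "smooth_within {0..1} (\<lambda>l. x (u l))" .
  then show ?thesis by (rule smooth_within_cong) (simp add: u(2))
qed

text \<open>Write \<open>X \<circ> z = f b\<close> with \<open>b\<close> the affine segment of direction \<open>d\<close>.  Reparametrised by \<open>g\<close>, with
  \<open>F = f \<circ> g\<close>, the acceleration of \<open>F (b \<circ> g)\<close> is \<open>F'' (b \<circ> g) + (2 F' g' + F g'') d\<close>.  The second
  term is \<open>(F\<^sup>2 g')' d / F\<close> and vanishes for \<open>g' = \<theta>\<^sub>1 / F\<^sup>2\<close>, where the constant \<open>\<theta>\<^sub>1\<close> makes \<open>g\<close> reach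
  \<open>1\<close> at time \<open>1\<close>.\<close>

lemma geodesic_exists_if_segment_lifts:
  assumes q: "q \<in> simplex_int" and r: "r \<in> simplex_int"
    and z: "continuous_on {0..1} z" "z ` {0..1} \<subseteq> simplex_int"
    and seg: "\<And>l. l \<in> {0..1} \<Longrightarrow> \<exists>c. X (z l) = c *\<^sub>R ((1 - l) *\<^sub>R X q + l *\<^sub>R X r)"
  shows "\<exists>\<sigma>. embedded_geodesic X q r \<sigma>"
proof -
  note nb = at_within_unit_interval_neq_bot
  have zs: "smooth_within {0..1} z" by (rule smooth_segment_lift[OF q r z seg])
  have in_S: "z l \<in> simplex_int" if "l \<in> {0..1}" for l using z(2) that by auto
  define b where "b l = (1 - l) *\<^sub>R X q + l *\<^sub>R X r" for l
  have bw: "b l \<bullet> Y q > 0" if "l \<in> {0..1}" for l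
    unfolding b_def by (rule segment_pairing_pos[OF q r that])
  define f where "f l = (X (z l) \<bullet> Y q) * inverse (b l \<bullet> Y q)" for l
  have f_pos: "f l > 0" if "l \<in> {0..1}" for l
    using pairing_positive[OF in_S[OF that] q] bw[OF that] by (simp add: f_def)
  have Xz: "X (z l) = f l *\<^sub>R b l" if "l \<in> {0..1}" for l
  proof -
    obtain c where c: "X (z l) = c *\<^sub>R b l" using seg[OF \<open>l \<in> {0..1}\<close>] by (auto simp: b_def)
    then have "c = f l" using bw[OF that] by (simp add: f_def)
    then show ?thesis using c by simp
  qed
  have fs: "smooth_within {0..1} f"
  proof -
    have "smooth_within {0..1} (\<lambda>l. X (z l))" using smooth_embedded_curve[OF zs z(2)] by (simp add: o_def)
    then show ?thesis unfolding f_def[abs_def] b_def using bw[unfolded b_def]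
      by (intro smooth_within_mult smooth_within_inverse smooth_within_inner smooth_within_add
          smooth_within_scaleR smooth_within_diff smooth_within_const smooth_within_id) force+
  qed
  have z_ends: "z 0 = q" "z 1 = r"
    using proportional_imp_eq[OF in_S q, of 0] proportional_imp_eq[OF in_S r, of 1] seg[of 0] seg[of 1]
    by auto
  have cont: "continuous_on {0..1} (\<lambda>l. (f l)\<^sup>2)"
    by (intro continuous_intros smooth_within_continuous_on fs)
  define \<theta> where "\<theta> l = integral {0..l} (\<lambda>l. (f l)\<^sup>2)" for l
  have \<theta>: "(\<theta> has_real_derivative (f l)\<^sup>2) (at l within {0..1})" if "l \<in> {0..1}" for l
    using integral_has_vector_derivative[OF cont that]
    by (simp add: \<theta>_def[abs_def] has_real_derivative_iff_has_vector_derivative)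
  have \<theta>0: "\<theta> 0 = 0" by (simp add: \<theta>_def)
  have "strict_mono_on {0..1} \<theta>"
    using \<theta> f_pos by (intro strict_mono_on_if_derivative_pos) (force simp: is_interval_cc)+
  then have \<theta>1: "\<theta> 1 > 0" using \<theta>0 by (auto dest: strict_mono_onD[of _ _ 0 1])
  define A where "A l = \<theta> l / \<theta> 1" for l
  have A: "(A has_real_derivative (f l)\<^sup>2 / \<theta> 1) (at l within {0..1})" if "l \<in> {0..1}" for l
    unfolding A_def[abs_def] by (intro DERIV_cdivide \<theta> that)
  have A_pos: "(f l)\<^sup>2 / \<theta> 1 > 0" if "l \<in> {0..1}" for l using f_pos[OF that] \<theta>1 by simp
  have A_mono: "strict_mono_on {0..1} A"
    by (rule strict_mono_on_if_derivative_pos[OF is_interval_cc A A_pos])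
  have A_cont: "continuous_on {0..1} A" using A by (rule DERIV_continuous_on)
  have A_ends: "A 0 = 0" "A 1 = 1" using \<theta>0 \<theta>1 by (auto simp: A_def)
  obtain g where g: "continuous_on {0..1} g" "strict_mono_on {0..1} g" "g ` {0..1} \<subseteq> {0..1}"
    "\<And>t. t \<in> {0..1} \<Longrightarrow> g (A t) = t" "\<And>y. y \<in> {0..1} \<Longrightarrow> A (g y) = y" "g 0 = 0" "g 1 = 1"
    using unit_interval_inverse[OF A_mono A_cont A_ends] by blast
  have g01: "g t \<in> {0..1}" if "t \<in> {0..1}" for t using g(3) that by blast
  define F where "F t = f (g t)" for t
  have F_pos: "F t > 0" if "t \<in> {0..1}" for t using f_pos[OF g01[OF that]] by (simp add: F_def)
  have gd: "(g has_derivative (\<lambda>v. (\<theta> 1 * (inverse (F t) * inverse (F t))) * v)) (at t within {0..1})"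
    if t: "t \<in> {0..1}" for t
  proof (rule has_derivative_lift[where N = A and L = "(*) ((f (g t))\<^sup>2 / \<theta> 1)" and T = "{0..1}"
        and P = "(*) (\<theta> 1 * (inverse (F t) * inverse (F t)))" and h = "\<lambda>v. v"])
    show "(A has_derivative (*) ((f (g t))\<^sup>2 / \<theta> 1)) (at (g t) within {0..1})"
      using A[OF g01[OF t]] unfolding has_field_derivative_def .
    show "bounded_linear ((*) (\<theta> 1 * (inverse (F t) * inverse (F t))))" by (rule bounded_linear_mult_right)
    show "\<theta> 1 * (inverse (F t) * inverse (F t)) * ((f (g t))\<^sup>2 / \<theta> 1 * v) = v" for v
      using F_pos[OF t] \<theta>1 by (simp add: F_def power2_eq_square field_simps)
    show "continuous (at t within {0..1}) g"
      using g(1) t by (simp add: continuous_on_eq_continuous_within)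
    have "((\<lambda>b. b) has_derivative (\<lambda>v. v)) (at t within {0..1})" by simp
    then show "((\<lambda>b. A (g b)) has_derivative (\<lambda>v. v)) (at t within {0..1})"
      by (rule has_derivative_transform[rotated 2]) (use t g(5) in auto)
  qed (use g(3) t in auto)
  have gk: "Ck_within k {0..1} g" for k
  proof (induction k)
    case 0
    then show ?case using g(1) by simp
  next
    case (Suc k)
    have "Ck_within k {0..1} F" unfolding F_def[abs_def]
      by (rule Ck_within_compose[OF g(3) _ Suc]) (use fs in \<open>simp add: smooth_within_def\<close>)
    then have "Ck_within k {0..1} (\<lambda>t. inverse (F t))"
      using F_pos by (intro Ck_within_inverse) force
    then have "Ck_within k {0..1} (\<lambda>t. (\<theta> 1 * (inverse (F t) * inverse (F t))) * v)" for v
      by (intro Ck_within_mult Ck_within_const)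
    then show ?case using gd unfolding Ck_within.simps
      by (intro exI[of _ "\<lambda>t v. (\<theta> 1 * (inverse (F t) * inverse (F t))) * v"]) blast
  qed
  then have gs: "smooth_within {0..1} g" by (simp add: smooth_within_def)
  have \<sigma>s: "smooth_within {0..1} (z \<circ> g)" unfolding o_def by (rule smooth_within_compose[OF zs gs g(3)])
  have Fs: "smooth_within {0..1} F" unfolding F_def[abs_def] by (rule smooth_within_compose[OF fs gs g(3)])
  define F1 where "F1 t = vector_derivative F (at t within {0..1})" for t
  define F2 where "F2 t = vector_derivative F1 (at t within {0..1})" for t
  have F1: "(F has_real_derivative F1 t) (at t within {0..1})" if "t \<in> {0..1}" for t
    using smooth_within_vector_derivative(1)[OF nb Fs that]
    by (simp add: F1_def has_real_derivative_iff_has_vector_derivative)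
  have "smooth_within {0..1} F1"
    using smooth_within_vector_derivative(2)[OF nb Fs] by (simp add: F1_def[abs_def])
  then have F2: "(F1 has_real_derivative F2 t) (at t within {0..1})" if "t \<in> {0..1}" for t
    using smooth_within_vector_derivative(1)[OF nb _ that]
    by (simp add: F2_def has_real_derivative_iff_has_vector_derivative)
  define d where "d = X r - X q"
  define g' where "g' t = \<theta> 1 / (F t)\<^sup>2" for t
  have g': "(g has_real_derivative g' t) (at t within {0..1})" if "t \<in> {0..1}" for t
    using gd[OF that] by (simp add: has_field_derivative_def g'_def divide_inverse power2_eq_square)
  have bg: "((\<lambda>t. b (g t)) has_vector_derivative g' t *\<^sub>R d) (at t within {0..1})" if t: "t \<in> {0..1}" for t
  proof -
    have "b l = X q + l *\<^sub>R d" for l by (simp add: b_def d_def algebra_simps)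
    moreover have "((\<lambda>t. X q + g t *\<^sub>R d) has_vector_derivative 0 + (g t *\<^sub>R 0 + g' t *\<^sub>R d)) (at t within {0..1})"
      by (intro has_vector_derivative_add has_vector_derivative_scaleR g' t has_vector_derivative_const)
    ultimately show ?thesis by simp
  qed
  have Xs: "X (z (g t)) = F t *\<^sub>R b (g t)" if "t \<in> {0..1}" for t
    using Xz[OF g01[OF that]] by (simp add: F_def)
  define v1 where "v1 t = F1 t *\<^sub>R b (g t) + (\<theta> 1 / F t) *\<^sub>R d" for t
  have v: "((X \<circ> (z \<circ> g)) has_vector_derivative v1 t) (at t within {0..1})" if t: "t \<in> {0..1}" for t
  proof -
    have "((\<lambda>t. F t *\<^sub>R b (g t)) has_vector_derivative F t *\<^sub>R (g' t *\<^sub>R d) + F1 t *\<^sub>R b (g t)) (at t within {0..1})"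
      by (intro has_vector_derivative_scaleR F1 bg t)
    moreover have "F t *\<^sub>R (g' t *\<^sub>R d) + F1 t *\<^sub>R b (g t) = v1 t"
      using F_pos[OF t] by (simp add: v1_def g'_def power2_eq_square)
    ultimately have "((\<lambda>t. F t *\<^sub>R b (g t)) has_vector_derivative v1 t) (at t within {0..1})" by simp
    then show ?thesis by (rule has_vector_derivative_transform[OF t, rotated]) (simp add: Xs)
  qed
  have v1: "(v1 has_vector_derivative F2 t *\<^sub>R b (g t)) (at t within {0..1})" if t: "t \<in> {0..1}" for t
  proof -
    have i: "((\<lambda>t. \<theta> 1 / F t) has_real_derivative - (\<theta> 1 * F1 t / (F t)\<^sup>2)) (at t within {0..1})"
      using F_pos[OF t] by (auto intro!: derivative_eq_intros F1 t simp: power2_eq_square)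
    have "(v1 has_vector_derivative (F1 t *\<^sub>R (g' t *\<^sub>R d) + F2 t *\<^sub>R b (g t))
        + ((\<theta> 1 / F t) *\<^sub>R 0 + (- (\<theta> 1 * F1 t / (F t)\<^sup>2)) *\<^sub>R d)) (at t within {0..1})"
      unfolding v1_def[abs_def]
      by (intro has_vector_derivative_add has_vector_derivative_scaleR F2 bg i t has_vector_derivative_const)
    then show ?thesis by (simp add: g'_def mult.commute)
  qed
  have "velocity {0..1} (velocity {0..1} (X \<circ> (z \<circ> g))) t = (F2 t / F t) *\<^sub>R X ((z \<circ> g) t)"
    if t: "t \<in> {0..1}" for t
  proof -
    have "velocity {0..1} (X \<circ> (z \<circ> g)) s = v1 s" if "s \<in> {0..1}" for s
      by (rule velocity_eq[OF v[OF that] nb[OF that]])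
    then have "(velocity {0..1} (X \<circ> (z \<circ> g)) has_vector_derivative F2 t *\<^sub>R b (g t)) (at t within {0..1})"
      using v1[OF t] by (rule has_vector_derivative_transform[OF t])
    then have "velocity {0..1} (velocity {0..1} (X \<circ> (z \<circ> g))) t = F2 t *\<^sub>R b (g t)"
      by (rule velocity_eq[OF _ nb[OF t]])
    then show ?thesis using F_pos[OF t] by (simp add: Xs[OF t])
  qed
  moreover have "(z \<circ> g) ` {0..1} \<subseteq> simplex_int" using z(2) g01 by auto
  ultimately have "embedded_geodesic X q r (z \<circ> g)"
    using \<sigma>s by (auto simp: embedded_geodesic_def g(6,7) z_ends)
  then show ?thesis by blast
qed

text \<open>Pairing the normal form of the flow with \<open>Y (\<gamma> t)\<close> gives \<open>K t (X r \<bullet> Y (\<gamma> t)) \<le> e\<^sup>t \<le> K t + c\<close>, so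
  \<open>X r \<bullet> Y (\<gamma> t)\<close> tends to its minimum \<open>1\<close>, which \<open>proper\<close> makes well separated.\<close>

lemma flow_converges:
  assumes fl: "embedded_flow X Y r q \<gamma>" and r: "r \<in> simplex_int"
    and proper: "\<And>e. e > 0 \<Longrightarrow> \<exists>d>0. \<forall>y\<in>simplex_int. X r \<bullet> Y y < 1 + d \<longrightarrow> dist y r < e"
  shows "(\<gamma> \<longlongrightarrow> r) at_top"
proof -
  obtain K where "continuous_on {0..} K" "strict_mono_on {0..} K" "K 0 = 0"
    and flow: "\<And>t. t \<ge> 0 \<Longrightarrow> exp t *\<^sub>R X (\<gamma> t) = X q + K t *\<^sub>R X r"
    and K_ge: "\<And>t. t \<ge> 0 \<Longrightarrow> exp t - X q \<bullet> Y r \<le> K t" and K_lim: "filterlim K at_top at_top"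
    using flow_normal_form[OF fl r] by blast
  have \<gamma>: "\<gamma> 0 = q" "\<gamma> ` {0..} \<subseteq> simplex_int" using fl by (auto simp: embedded_flow_def)
  have in_S: "\<gamma> t \<in> simplex_int" if "t \<ge> 0" for t using \<gamma>(2) that by auto
  have q: "q \<in> simplex_int" using in_S[of 0] \<gamma>(1) by simp
  define c where "c = X q \<bullet> Y r"
  show ?thesis
  proof (rule tendstoI)
    fix e :: real assume "e > 0"
    then obtain d where d: "d > 0" "\<And>y. y \<in> simplex_int \<Longrightarrow> X r \<bullet> Y y < 1 + d \<Longrightarrow> dist y r < e"
      using proper by blast
    have "\<forall>\<^sub>F t in at_top. max 0 (c / d) < K t"
      using filterlim_at_top_dense[THEN iffD1, OF K_lim] by blast
    then show "\<forall>\<^sub>F t in at_top. dist (\<gamma> t) r < e"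
      using eventually_ge_at_top[of 0]
    proof eventually_elim
      case (elim t)
      have K: "K t > 0" "c < d * K t" using elim(1) d(1) by (auto simp: field_simps)
      have "exp t * (X (\<gamma> t) \<bullet> Y (\<gamma> t)) = X q \<bullet> Y (\<gamma> t) + K t * (X r \<bullet> Y (\<gamma> t))"
        using arg_cong[OF flow[OF elim(2)], of "\<lambda>v. v \<bullet> Y (\<gamma> t)"] by (simp add: inner_add_left)
      then have "K t * (X r \<bullet> Y (\<gamma> t)) \<le> exp t"
        using pairing_self[OF in_S[OF elim(2)]] pairing_positive[OF q in_S[OF elim(2)]] by simp
      also have "exp t \<le> K t + c" using K_ge[OF elim(2)] by (simp add: c_def)
      also have "\<dots> < K t * (1 + d)" using K(2) by (simp add: algebra_simps)
      finally have "X r \<bullet> Y (\<gamma> t) < 1 + d" using K(1) by simp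
      then show ?case using d(2) in_S[OF elim(2)] by blast
    qed
  qed
qed

text \<open>The flow with its limit added is a curve over the compact interval, and its position on the
  segment from \<open>X q\<close> to \<open>X r\<close> is the increasing function \<open>K / (K + 1)\<close>.\<close>

lemma geodesic_exists_if_flow_converges:
  assumes fl: "embedded_flow X Y r q \<gamma>" and r: "r \<in> simplex_int" and lim: "(\<gamma> \<longlongrightarrow> r) at_top"
  shows "\<exists>\<sigma>. embedded_geodesic X q r \<sigma>"
proof -
  obtain K where K: "continuous_on {0..} K" "strict_mono_on {0..} K" "K 0 = 0"
    and flow: "\<And>t. t \<ge> 0 \<Longrightarrow> exp t *\<^sub>R X (\<gamma> t) = X q + K t *\<^sub>R X r"
    and "\<And>t. t \<ge> 0 \<Longrightarrow> exp t - X q \<bullet> Y r \<le> K t" and K_lim: "filterlim K at_top at_top"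
    using flow_normal_form[OF fl r] by blast
  have \<gamma>: "\<gamma> 0 = q" "continuous_on {0..} \<gamma>" "\<gamma> ` {0..} \<subseteq> simplex_int"
    using fl by (auto simp: embedded_flow_def)
  have in_S: "\<gamma> t \<in> simplex_int" if "t \<ge> 0" for t using \<gamma>(3) that by auto
  have q: "q \<in> simplex_int" using in_S[of 0] \<gamma>(1) by simp
  have K_nonneg: "K t \<ge> 0" if "t \<ge> 0" for t
    using strict_mono_on_leD[OF K(2), of 0 t] that K(3) by simp
  define Z where "Z u = (if u < 1 then \<gamma> (u / (1 - u)) else r)" for u :: real
  define \<psi> where "\<psi> u = (if u < 1 then K (u / (1 - u)) / (K (u / (1 - u)) + 1) else 1)" for u :: real
  have Z_cont: "continuous_on {0..1} Z" unfolding Z_def[abs_def]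
    by (rule continuous_on_compactified_half_line[OF \<gamma>(2) lim])
  have "continuous_on {0..} (\<lambda>t. K t / (K t + 1))"
    using K_nonneg by (intro continuous_intros K(1)) force
  then have \<psi>_cont: "continuous_on {0..1} \<psi>" unfolding \<psi>_def[abs_def]
    by (rule continuous_on_compactified_half_line) (rule tendsto_ratio_1[OF K_lim])
  have t_nonneg: "u / (1 - u) \<ge> 0" if "0 \<le> u" "u < 1" for u :: real using that by simp
  have \<psi>_mono: "strict_mono_on {0..1} \<psi>"
  proof (rule strict_mono_onI)
    fix a b :: real assume ab: "a \<in> {0..1}" "b \<in> {0..1}" "a < b"
    define s where "s = a / (1 - a)"
    have s: "s \<ge> 0" using ab by (simp add: s_def)
    have \<psi>a: "\<psi> a = K s / (K s + 1)" using ab by (simp add: \<psi>_def s_def)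
    show "\<psi> a < \<psi> b"
    proof (cases "b < 1")
      case True
      have "s < b / (1 - b)" using ab True by (simp add: s_def divide_simps algebra_simps)
      then have "K s < K (b / (1 - b))" using strict_mono_onD[OF K(2)] s by simp
      then have "K s / (K s + 1) < K (b / (1 - b)) / (K (b / (1 - b)) + 1)"
        by (rule ratio_strict_mono[OF K_nonneg[OF s]]) simp
      moreover have "\<psi> b = K (b / (1 - b)) / (K (b / (1 - b)) + 1)" using True by (simp add: \<psi>_def)
      ultimately show ?thesis unfolding \<psi>a by metis
    next
      case False
      then show ?thesis using K_nonneg[OF s] by (simp add: \<psi>a) (simp add: \<psi>_def)
    qed
  qed
  have \<psi>_ends: "\<psi> 0 = 0" "\<psi> 1 = 1" using K(3) by (auto simp: \<psi>_def)
  obtain g where g: "continuous_on {0..1} g" "strict_mono_on {0..1} g" "g ` {0..1} \<subseteq> {0..1}"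
    "\<And>t. t \<in> {0..1} \<Longrightarrow> g (\<psi> t) = t" "\<And>y. y \<in> {0..1} \<Longrightarrow> \<psi> (g y) = y" "g 0 = 0" "g 1 = 1"
    using unit_interval_inverse[OF \<psi>_mono \<psi>_cont \<psi>_ends] by blast
  have g01: "g l \<in> {0..1}" if "l \<in> {0..1}" for l using g(3) that by blast
  have Z_S: "Z u \<in> simplex_int" if "u \<in> {0..1}" for u
    using in_S[OF t_nonneg] r that by (auto simp: Z_def)
  have seg: "\<exists>c. X (Z u) = c *\<^sub>R ((1 - \<psi> u) *\<^sub>R X q + \<psi> u *\<^sub>R X r)" if u: "u \<in> {0..1}" for u
  proof (cases "u < 1")
    case True
    define t where "t = u / (1 - u)"
    have t: "t \<ge> 0" using u True by (simp add: t_def)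
    have Kt: "K t + 1 > 0" using K_nonneg[OF t] by simp
    have \<psi>u: "\<psi> u = K t / (K t + 1)" "1 - \<psi> u = 1 / (K t + 1)"
      using True Kt by (auto simp: \<psi>_def t_def field_simps)
    have "X (Z u) = exp (- t) *\<^sub>R (exp t *\<^sub>R X (\<gamma> t))"
      using True by (simp add: Z_def t_def flip: exp_add)
    also have "\<dots> = (exp (- t) * (K t + 1)) *\<^sub>R ((1 - \<psi> u) *\<^sub>R X q + \<psi> u *\<^sub>R X r)"
      unfolding flow[OF t] \<psi>u(2) unfolding \<psi>u(1) using Kt by (simp add: scaleR_add_right)
    finally show ?thesis by blast
  next
    case False
    then have "X (Z u) = 1 *\<^sub>R ((1 - \<psi> u) *\<^sub>R X q + \<psi> u *\<^sub>R X r)" by (simp add: Z_def \<psi>_def)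
    then show ?thesis by blast
  qed
  show ?thesis
  proof (rule geodesic_exists_if_segment_lifts[OF q r])
    show "continuous_on {0..1} (\<lambda>l. Z (g l))"
      by (rule continuous_on_compose2[OF Z_cont g(1,3)])
    show "(\<lambda>l. Z (g l)) ` {0..1} \<subseteq> simplex_int" using Z_S g01 by blast
    show "\<exists>c. X (Z (g l)) = c *\<^sub>R ((1 - l) *\<^sub>R X q + l *\<^sub>R X r)" if "l \<in> {0..1}" for l
      using seg[OF g01[OF that]] g(5)[OF that] by simp
  qed
qed

end

section \<open>The embeddings of an exponentially concave function\<close>

definition primal_embedding :: "(real ^ 'n::finite \<Rightarrow> real) \<Rightarrow> real ^ 'n \<Rightarrow> real ^ 'n" where
  "primal_embedding \<phi> p = exp (- \<phi> p) *\<^sub>R p"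

text \<open>The entries of the dual embedding are the values at the vertices of the tangent plane of
  \<open>e\<^sup>\<phi>\<close> at \<open>p\<close>.\<close>

definition dual_embedding :: "(real ^ 'n::finite \<Rightarrow> real) \<Rightarrow> real ^ 'n \<Rightarrow> real ^ 'n" where
  "dual_embedding \<phi> p = (\<chi> i. exp (\<phi> p) * (1 + dirderiv \<phi> p (axis i 1 - p)))"

text \<open>The locale fixes an affine chart, in which derivatives of functions on the simplex become
  derivatives on an open set.\<close>

locale exp_concave =
  fixes \<phi> :: "real ^ 'n::finite \<Rightarrow> real" and c :: "real ^ 'n" and L :: "real ^ 'm::finite \<Rightarrow> real ^ 'n"
    and P :: "real ^ 'n \<Rightarrow> real ^ 'm" and \<Omega> :: "(real ^ 'm) set"
  assumes card_n: "CARD('n) \<ge> 2" and card_m: "CARD('m) = CARD('n) - 1"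
    and linear_L: "linear L" and linear_P: "linear P"
    and P_chart: "\<And>a. P (c + L a) = a"
    and chart_P: "\<And>p. (\<Sum>i\<in>UNIV. p $ i) = 1 \<Longrightarrow> c + L (P p) = p"
    and L_tangent: "\<And>a. L a \<in> tangent_space"
    and L_P: "\<And>v. v \<in> tangent_space \<Longrightarrow> L (P v) = v"
    and open_\<Omega>: "open \<Omega>" and convex_\<Omega>: "convex \<Omega>"
    and image_\<Omega>: "(\<lambda>a. c + L a) ` \<Omega> = simplex_int"
    and coordinate_system_\<Omega>: "coordinate_system \<Omega> (\<lambda>a. c + L a) P"
    and smooth_\<phi>: "smooth_on_simplex TYPE('m) \<phi>"
    and concave_exp: "concave_on simplex_int (\<lambda>a. exp (\<phi> a))"
    and hess_negative: "\<forall>a\<in>simplex_int. \<forall>v\<in>tangent_space. v \<noteq> 0 \<longrightarrow> hess (\<lambda>b. exp (\<phi> b)) a v v < 0"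
begin

definition x :: "real ^ 'm \<Rightarrow> real ^ 'n" where "x a = c + L a"
definition \<psi> :: "real ^ 'm \<Rightarrow> real" where "\<psi> a = exp (\<phi> (x a))"

abbreviation "D\<psi> a \<equiv> frechet_derivative \<psi> (at a)"

lemma x_in: "a \<in> \<Omega> \<Longrightarrow> x a \<in> simplex_int"
  using image_\<Omega> by (auto simp: x_def)

lemma P_x: "P (x a) = a"
  by (simp add: x_def P_chart)

lemma sum_simplex: "p \<in> simplex_int \<Longrightarrow> (\<Sum>i\<in>UNIV. p $ i) = 1"
  by (simp add: simplex_int_def)

lemma x_P: "p \<in> simplex_int \<Longrightarrow> x (P p) = p"
  by (simp add: x_def chart_P sum_simplex)

lemma P_in:
  assumes "p \<in> simplex_int"
  shows "P p \<in> \<Omega>"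
proof -
  have "p \<in> (\<lambda>a. c + L a) ` \<Omega>" unfolding image_\<Omega> by (rule assms)
  then obtain a where "a \<in> \<Omega>" "p = c + L a" by blast
  then show ?thesis by (simp add: P_chart)
qed

lemma sum_x: "(\<Sum>i\<in>UNIV. x a $ i) = 1"
proof -
  have "(\<Sum>i\<in>UNIV. axis k (1::real) $ i) = 1" for k :: 'n by (simp add: axis_def)
  then have "c + L (P (axis k 1)) = axis k 1" for k :: 'n by (rule chart_P)
  then have "(\<Sum>i\<in>UNIV. (c + L (P (axis (undefined::'n) 1))) $ i) = 1" by (simp add: axis_def)
  then have "(\<Sum>i\<in>UNIV. c $ i) = 1"
    using L_tangent[of "P (axis (undefined::'n) 1)"] by (simp add: tangent_space_def sum.distrib)
  then show ?thesis using L_tangent[of a] by (simp add: x_def sum.distrib tangent_space_def)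
qed

lemma bounded_linear_L: "bounded_linear L" and bounded_linear_P: "bounded_linear P"
  using linear_L linear_P by (simp_all add: linear_conv_bounded_linear)

lemma x_derivative: "(x has_derivative L) (at a)"
  unfolding x_def[abs_def]
  using bounded_linear_imp_has_derivative[OF bounded_linear_L] by (auto intro!: derivative_eq_intros)

lemma smooth_x: "smooth_within \<Omega> x"
  unfolding x_def[abs_def]
  by (rule smooth_on_imp_smooth_within[OF open_\<Omega>])
    (use coordinate_system_\<Omega> in \<open>simp add: coordinate_system_def\<close>)

lemma smooth_\<phi>_x: "smooth_within \<Omega> (\<lambda>a. \<phi> (x a))"
  unfolding x_def
  by (rule smooth_on_imp_smooth_within[OF open_\<Omega>])
    (use smooth_\<phi> coordinate_system_\<Omega> in \<open>unfold smooth_on_simplex_def, blast\<close>)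

lemma smooth_\<psi>: "smooth_within \<Omega> \<psi>"
  unfolding \<psi>_def[abs_def] by (rule smooth_within_exp[OF smooth_\<phi>_x])

lemma \<psi>_pos: "\<psi> a > 0" by (simp add: \<psi>_def)

lemmas \<psi>_derivative = smooth_within_has_derivative[OF open_\<Omega> smooth_\<psi>]
lemmas \<psi>_derivative2 = smooth_within_has_derivative2[OF open_\<Omega> smooth_\<psi>]
lemmas linear_D\<psi> = linear_frechet_derivative[OF open_\<Omega> smooth_\<psi>]

lemma D\<psi>_sum: "a \<in> \<Omega> \<Longrightarrow> D\<psi> a v = (\<Sum>j\<in>UNIV. v $ j * D\<psi> a (axis j 1))"
  using linear_axis_sum[OF linear_D\<psi>, of a v] by simp

lemma dirderiv_chart:
  assumes "((\<lambda>a. g (x a)) has_derivative g') (at a)" and v: "v \<in> tangent_space"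
  shows "dirderiv g (x a) v = g' (P v)"
proof -
  have "x (a + h *\<^sub>R P v) = x a + h *\<^sub>R v" for h
    by (simp add: x_def linear_add[OF linear_L] linear_scale[OF linear_L] L_P[OF v])
  moreover have "((\<lambda>h. g (x (a + h *\<^sub>R P v))) has_real_derivative g' (P v)) (at 0)"
    by (rule has_real_derivative_along_line[where f = "\<lambda>a. g (x a)"]) (simp add: assms(1))
  ultimately show ?thesis unfolding dirderiv_def by (simp add: DERIV_imp_deriv)
qed

lemma D\<psi>_eq: "a \<in> \<Omega> \<Longrightarrow> D\<psi> a v = \<psi> a * frechet_derivative (\<lambda>a. \<phi> (x a)) (at a) v"
proof -
  assume a: "a \<in> \<Omega>"
  have "(\<psi> has_derivative (\<lambda>v. \<psi> a * frechet_derivative (\<lambda>a. \<phi> (x a)) (at a) v)) (at a)"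
    unfolding \<psi>_def[abs_def] using smooth_within_has_derivative[OF open_\<Omega> smooth_\<phi>_x a]
    by (auto intro!: derivative_eq_intros)
  then show ?thesis by (metis frechet_derivative_at)
qed

lemma dirderiv_\<phi>:
  assumes "a \<in> \<Omega>" "v \<in> tangent_space"
  shows "\<psi> a * dirderiv \<phi> (x a) v = D\<psi> a (P v)"
  using dirderiv_chart[OF smooth_within_has_derivative[OF open_\<Omega> smooth_\<phi>_x assms(1)] assms(2)]
    D\<psi>_eq[OF assms(1)] by simp

lemma dual_embedding_x:
  assumes a: "a \<in> \<Omega>"
  shows "dual_embedding \<phi> (x a) = (\<chi> i. \<psi> a + D\<psi> a (P (axis i 1) - a))"
proof -
  have "(\<Sum>j\<in>UNIV. (axis i 1 - x a) $ j) = 0" for i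
    using sum_x[of a] by (simp add: sum_subtractf axis_def)
  then have "axis i 1 - x a \<in> tangent_space" for i by (simp add: tangent_space_def)
  from dirderiv_\<phi>[OF a this] show ?thesis
    by (simp add: dual_embedding_def vec_eq_iff \<psi>_def[symmetric] distrib_left
        linear_diff[OF linear_P] P_x)
qed

text \<open>The tangent plane is affine, so averaging its values at the vertices with barycentric weights gives
  its value at \<open>b\<close>, also when some weights are negative.\<close>

lemma inner_dual_embedding:
  assumes a: "a \<in> \<Omega>"
  shows "x b \<bullet> dual_embedding \<phi> (x a) = \<psi> a + D\<psi> a (b - a)"
proof -
  have Psum: "P (x b) = (\<Sum>i\<in>UNIV. x b $ i *\<^sub>R P (axis i 1))" by (rule linear_axis_sum[OF linear_P])
  have "x b \<bullet> dual_embedding \<phi> (x a) = (\<Sum>i\<in>UNIV. x b $ i * (\<psi> a + D\<psi> a (P (axis i 1) - a)))"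
    by (simp add: dual_embedding_x[OF a] inner_vec_def)
  also have "\<dots> = (\<Sum>i\<in>UNIV. x b $ i * (\<psi> a - D\<psi> a a) + x b $ i * D\<psi> a (P (axis i 1)))"
    by (intro sum.cong refl) (simp add: linear_diff[OF linear_D\<psi>[OF a]] algebra_simps)
  also have "\<dots> = (\<Sum>i\<in>UNIV. x b $ i) * (\<psi> a - D\<psi> a a) + D\<psi> a (\<Sum>i\<in>UNIV. x b $ i *\<^sub>R P (axis i 1))"
    by (simp add: sum.distrib sum_distrib_right linear_sum[OF linear_D\<psi>[OF a]]
        linear_scale[OF linear_D\<psi>[OF a]])
  also have "\<dots> = \<psi> a + D\<psi> a (b - a)"
    by (simp add: sum_x Psum[symmetric] P_x linear_diff[OF linear_D\<psi>[OF a]])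
  finally show ?thesis .
qed

lemma pairing_chart:
  assumes a: "a \<in> \<Omega>"
  shows "primal_embedding \<phi> (x b) \<bullet> dual_embedding \<phi> (x a) = (\<psi> a + D\<psi> a (b - a)) / \<psi> b"
  by (simp add: primal_embedding_def inner_dual_embedding[OF a] \<psi>_def exp_minus divide_inverse mult.commute)

lemma deriv2_negative:
  assumes a: "a \<in> \<Omega>" and v: "v \<noteq> 0"
  shows "deriv2 \<psi> a v v < 0"
proof -
  define w where "w = L v"
  have w: "w \<in> tangent_space" "P w = v"
  proof -
    show "w \<in> tangent_space" by (simp add: w_def L_tangent)
    have "P w = P (c + L v) - P (c + L 0)"
      by (simp add: w_def linear_add[OF linear_P] linear_0[OF linear_L])
    then show "P w = v" by (simp add: P_chart)
  qed
  have "w \<noteq> 0" using w(2) v linear_0[OF linear_P] by auto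
  have 1: "dirderiv (\<lambda>b. exp (\<phi> b)) (x b) w = D\<psi> b v" if "b \<in> \<Omega>" for b
    using dirderiv_chart[of "\<lambda>b. exp (\<phi> b)", OF _ w(1)] \<psi>_derivative[OF that]
    by (simp add: \<psi>_def[abs_def] w(2))
  have "((\<lambda>b. D\<psi> b v) has_derivative (\<lambda>u. deriv2 \<psi> a u v)) (at a)" by (rule \<psi>_derivative2[OF a])
  then have "((\<lambda>b. dirderiv (\<lambda>b. exp (\<phi> b)) (x b) w) has_derivative (\<lambda>u. deriv2 \<psi> a u v)) (at a)"
    by (rule has_derivative_transform_within_open[OF _ open_\<Omega> a]) (simp add: 1)
  then have "hess (\<lambda>b. exp (\<phi> b)) (x a) w w = deriv2 \<psi> a v v"
    unfolding hess_def
    using dirderiv_chart[of "\<lambda>p. dirderiv (\<lambda>b. exp (\<phi> b)) p w", OF _ w(1)] by (simp add: w(2))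
  then show ?thesis using hess_negative x_in[OF a] w(1) \<open>w \<noteq> 0\<close> by metis
qed

lemma tangent_plane_above:
  assumes a: "a \<in> \<Omega>" and b: "b \<in> \<Omega>" and ne: "b \<noteq> a"
  shows "\<psi> b < \<psi> a + D\<psi> a (b - a)"
proof -
  have in_\<Omega>: "a + s *\<^sub>R (b - a) \<in> \<Omega>" if "0 \<le> s" "s \<le> 1" for s
    using convexD_alt[OF convex_\<Omega> a b that] by (simp add: algebra_simps)
  have h: "DERIV (\<lambda>s. \<psi> (a + s *\<^sub>R (b - a))) s :> D\<psi> (a + s *\<^sub>R (b - a)) (b - a)" if "0 \<le> s" "s \<le> 1" for s
    by (rule has_real_derivative_along_line[OF \<psi>_derivative[OF in_\<Omega>[OF that]]])
  have h': "DERIV (\<lambda>s. D\<psi> (a + s *\<^sub>R (b - a)) (b - a)) s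
      :> deriv2 \<psi> (a + s *\<^sub>R (b - a)) (b - a) (b - a)" if "0 \<le> s" "s \<le> 1" for s
    by (rule has_real_derivative_along_line[OF \<psi>_derivative2[OF in_\<Omega>[OF that]]])
  obtain s where s: "0 < s" "s < 1"
    "\<psi> (a + 1 *\<^sub>R (b - a)) - \<psi> (a + 0 *\<^sub>R (b - a)) = (1 - 0) * D\<psi> (a + s *\<^sub>R (b - a)) (b - a)"
    using MVT2[OF zero_less_one h] by blast
  have "DERIV (\<lambda>s. D\<psi> (a + s *\<^sub>R (b - a)) (b - a)) t
      :> deriv2 \<psi> (a + t *\<^sub>R (b - a)) (b - a) (b - a)" if "0 \<le> t" "t \<le> s" for t
    using h' that s by simp
  from MVT2[OF s(1) this] obtain t where t: "0 < t" "t < s"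
    "D\<psi> (a + s *\<^sub>R (b - a)) (b - a) - D\<psi> (a + 0 *\<^sub>R (b - a)) (b - a)
      = (s - 0) * deriv2 \<psi> (a + t *\<^sub>R (b - a)) (b - a) (b - a)" by blast
  have "deriv2 \<psi> (a + t *\<^sub>R (b - a)) (b - a) (b - a) < 0"
    using t s ne by (intro deriv2_negative in_\<Omega>) auto
  then have "s * deriv2 \<psi> (a + t *\<^sub>R (b - a)) (b - a) (b - a) < 0" using s(1) by (simp add: mult_pos_neg)
  then show ?thesis using s(3) t(3) by simp
qed

lemma pairing_ge_1:
  assumes y: "y \<in> simplex_int" and z: "z \<in> simplex_int"
  shows "1 \<le> primal_embedding \<phi> y \<bullet> dual_embedding \<phi> z"
    and "primal_embedding \<phi> y \<bullet> dual_embedding \<phi> z = 1 \<longleftrightarrow> y = z"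
proof -
  let ?p = "primal_embedding \<phi> y \<bullet> dual_embedding \<phi> z"
  have p: "?p = (\<psi> (P z) + D\<psi> (P z) (P y - P z)) / \<psi> (P y)"
    using pairing_chart[OF P_in[OF z], of "P y"] by (simp add: x_P y z)
  have eq: "?p = 1" if "y = z"
    using that p \<psi>_pos[of "P y"] by (simp add: linear_0[OF linear_D\<psi>[OF P_in[OF z]]])
  have gt: "?p > 1" if "y \<noteq> z"
  proof -
    have "P y \<noteq> P z" using x_P[OF y] x_P[OF z] that by metis
    from tangent_plane_above[OF P_in[OF z] P_in[OF y] this] show ?thesis
      unfolding p using \<psi>_pos[of "P y"] by simp
  qed
  show "1 \<le> ?p" by (cases "y = z") (use eq gt in \<open>simp_all add: less_imp_le\<close>)
  show "?p = 1 \<longleftrightarrow> y = z" by (cases "y = z") (use eq gt in \<open>simp_all add: less_imp_neq[symmetric]\<close>)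
qed

lemma L_div_eq_ln_pairing:
  assumes q: "q \<in> simplex_int" and p: "p \<in> simplex_int"
  shows "L_div \<phi> q p = ln (primal_embedding \<phi> q \<bullet> dual_embedding \<phi> p)"
proof -
  have t: "q - p \<in> tangent_space" using sum_simplex[OF q] sum_simplex[OF p]
    by (simp add: tangent_space_def sum_subtractf)
  have "\<psi> (P p) * (1 + dirderiv \<phi> p (q - p)) = \<psi> (P p) + D\<psi> (P p) (P q - P p)"
    using dirderiv_\<phi>[OF P_in[OF p] t] by (simp add: x_P[OF p] distrib_left linear_diff[OF linear_P])
  then have eq: "primal_embedding \<phi> q \<bullet> dual_embedding \<phi> p = exp (\<phi> p - \<phi> q) * (1 + dirderiv \<phi> p (q - p))"
    using pairing_chart[OF P_in[OF p], of "P q"] by (simp add: x_P q p \<psi>_def exp_diff)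
  have "exp (\<phi> p - \<phi> q) * (1 + dirderiv \<phi> p (q - p)) > 0"
    using pairing_ge_1(1)[OF q p] unfolding eq by linarith
  then have "1 + dirderiv \<phi> p (q - p) > 0" by (simp add: zero_less_mult_iff)
  then show ?thesis unfolding eq by (simp add: L_div_def ln_mult)
qed

lemma smooth_primal_x: "smooth_within \<Omega> (\<lambda>a. primal_embedding \<phi> (x a))"
proof -
  have "smooth_within \<Omega> (\<lambda>a. - \<phi> (x a))"
    using smooth_within_diff[OF smooth_within_const smooth_\<phi>_x, of 0] by simp
  then show ?thesis unfolding primal_embedding_def
    by (intro smooth_within_scaleR smooth_within_exp smooth_x)
qed

lemma smooth_dual_x: "smooth_within \<Omega> (\<lambda>a. dual_embedding \<phi> (x a))"
proof (rule smooth_within_cong)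
  have D: "smooth_within \<Omega> (\<lambda>a. D\<psi> a v)" for v
    by (rule smooth_within_frechet_derivative(2)[OF open_\<Omega> smooth_\<psi>])
  show "smooth_within \<Omega> (\<lambda>a. \<chi> i. \<psi> a + (D\<psi> a (P (axis i 1)) - (\<Sum>j\<in>UNIV. a $ j * D\<psi> a (axis j 1))))"
    by (intro smooth_within_vec smooth_within_add smooth_within_diff smooth_within_sum smooth_within_mult
        smooth_within_nth smooth_within_id smooth_\<psi> D) auto
  fix a assume a: "a \<in> \<Omega>"
  show "(\<chi> i. \<psi> a + (D\<psi> a (P (axis i 1)) - (\<Sum>j\<in>UNIV. a $ j * D\<psi> a (axis j 1)))) = dual_embedding \<phi> (x a)"
    by (simp add: dual_embedding_x[OF a] linear_diff[OF linear_D\<psi>[OF a]] D\<psi>_sum[OF a, of a])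
qed

text \<open>For fixed \<open>b\<close> differentiate \<open>x b \<bullet> Y (x a) = \<psi> a + D\<psi> a (b - a)\<close> in \<open>a\<close> along \<open>u\<close>: the first derivatives
  of \<open>\<psi>\<close> cancel and \<open>deriv2 \<psi> a u (b - a)\<close> remains.  This is affine in \<open>b\<close>, so the pairing of the two
  derivatives is \<open>deriv2 \<psi> a u u / \<psi> a\<close>.\<close>

lemma derivatives_negative:
  assumes a: "a \<in> \<Omega>" and u: "u \<noteq> 0"
  shows "frechet_derivative (\<lambda>a. primal_embedding \<phi> (x a)) (at a) u
    \<bullet> frechet_derivative (\<lambda>a. dual_embedding \<phi> (x a)) (at a) u < 0"
proof -
  let ?G = "frechet_derivative (\<lambda>a. dual_embedding \<phi> (x a)) (at a)"
  let ?F = "frechet_derivative (\<lambda>a. primal_embedding \<phi> (x a)) (at a)"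
  have G: "x b \<bullet> ?G u = deriv2 \<psi> a u (b - a)" for b
  proof -
    have "((\<lambda>a. x b \<bullet> dual_embedding \<phi> (x a)) has_derivative (\<lambda>u. x b \<bullet> ?G u)) (at a)"
      by (intro has_derivative_inner_right smooth_within_has_derivative[OF open_\<Omega> smooth_dual_x] a)
    then have 1: "((\<lambda>a. \<psi> a + (D\<psi> a b - D\<psi> a a)) has_derivative (\<lambda>u. x b \<bullet> ?G u)) (at a)"
      by (rule has_derivative_transform_within_open[OF _ open_\<Omega> a])
        (simp add: inner_dual_embedding linear_diff[OF linear_D\<psi>])
    have "((\<lambda>d. \<Sum>j\<in>UNIV. d $ j * D\<psi> d (axis j 1)) has_derivative
        (\<lambda>u. \<Sum>j\<in>UNIV. a $ j * deriv2 \<psi> a u (axis j 1) + u $ j * D\<psi> a (axis j 1))) (at a)"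
      by (intro has_derivative_sum has_derivative_mult \<psi>_derivative2 a
          bounded_linear_imp_has_derivative bounded_linear_vec_nth)
    then have "((\<lambda>d. D\<psi> d d) has_derivative
        (\<lambda>u. \<Sum>j\<in>UNIV. a $ j * deriv2 \<psi> a u (axis j 1) + u $ j * D\<psi> a (axis j 1))) (at a)"
      by (rule has_derivative_transform_within_open[OF _ open_\<Omega> a]) (simp add: D\<psi>_sum)
    moreover have "(\<Sum>j\<in>UNIV. a $ j * deriv2 \<psi> a u (axis j 1) + u $ j * D\<psi> a (axis j 1))
        = deriv2 \<psi> a u a + D\<psi> a u" for u
      using linear_axis_sum[OF linear_deriv2_right[OF open_\<Omega> smooth_\<psi> a], of u a] D\<psi>_sum[OF a, of u]
      by (simp add: sum.distrib)
    ultimately have "((\<lambda>d. D\<psi> d d) has_derivative (\<lambda>u. deriv2 \<psi> a u a + D\<psi> a u)) (at a)" by simp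
    then have "((\<lambda>a. \<psi> a + (D\<psi> a b - D\<psi> a a)) has_derivative
        (\<lambda>u. D\<psi> a u + (deriv2 \<psi> a u b - (deriv2 \<psi> a u a + D\<psi> a u)))) (at a)"
      by (intro has_derivative_add has_derivative_diff \<psi>_derivative \<psi>_derivative2 a)
    from has_derivative_unique[OF 1 this]
    have "x b \<bullet> ?G u = D\<psi> a u + (deriv2 \<psi> a u b - (deriv2 \<psi> a u a + D\<psi> a u))" by metis
    then show ?thesis by (simp add: linear_diff[OF linear_deriv2_right[OF open_\<Omega> smooth_\<psi> a]])
  qed
  have xG: "x a \<bullet> ?G u = 0" using G[of a] linear_0[OF linear_deriv2_right[OF open_\<Omega> smooth_\<psi> a]] by simp
  have "L u = x (a + u) - x a" by (simp add: x_def linear_add[OF linear_L])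
  then have LG: "L u \<bullet> ?G u = deriv2 \<psi> a u u" using G[of "a + u"] xG by (simp add: inner_diff_left)
  have "((\<lambda>a. exp (- \<phi> (x a))) has_derivative
      (\<lambda>u. exp (- \<phi> (x a)) * - frechet_derivative (\<lambda>a. \<phi> (x a)) (at a) u)) (at a)"
    using smooth_within_has_derivative[OF open_\<Omega> smooth_\<phi>_x a] by (auto intro!: derivative_eq_intros)
  then have "((\<lambda>a. exp (- \<phi> (x a)) *\<^sub>R x a) has_derivative
      (\<lambda>u. exp (- \<phi> (x a)) *\<^sub>R L u + (exp (- \<phi> (x a)) * - frechet_derivative (\<lambda>a. \<phi> (x a)) (at a) u) *\<^sub>R x a)) (at a)"
    by (intro has_derivative_scaleR x_derivative)
  note F' = fun_cong[OF frechet_derivative_at[OF this], of u, symmetric]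
  have "?F u = exp (- \<phi> (x a)) *\<^sub>R L u + (exp (- \<phi> (x a)) * - frechet_derivative (\<lambda>a. \<phi> (x a)) (at a) u) *\<^sub>R x a"
    unfolding primal_embedding_def by (rule F')
  then have "?F u \<bullet> ?G u = exp (- \<phi> (x a)) * deriv2 \<psi> a u u"
    by (simp add: inner_add_left inner_diff_left LG xG)
  then show ?thesis using deriv2_negative[OF a u] by (simp add: mult_pos_neg)
qed

text \<open>Any other chart differs from the affine one by the smooth transition map \<open>\<kappa>\<close>, whose derivative is
  injective.\<close>

lemma chart_conjugate_immersions:
  fixes \<Omega>' :: "(real ^ 'm) set"
  assumes cs: "coordinate_system \<Omega>' x' \<xi>'"
  shows "conjugate_immersions \<Omega>' (\<lambda>a. primal_embedding \<phi> (x' a)) (\<lambda>a. dual_embedding \<phi> (x' a))"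
proof -
  have open': "open \<Omega>'" and op: "openin (top_of_set simplex_int) (x' ` \<Omega>')" and s': "smooth_on \<Omega>' x'"
    and inj': "\<And>a. a \<in> \<Omega>' \<Longrightarrow> inj (frechet_derivative x' (at a))"
    using cs by (auto simp: coordinate_system_def)
  have sub: "x' ` \<Omega>' \<subseteq> simplex_int" using openin_imp_subset[OF op] .
  have sx': "smooth_within \<Omega>' x'" by (rule smooth_on_imp_smooth_within[OF open' s'])
  have in_S: "x' a \<in> simplex_int" if "a \<in> \<Omega>'" for a using sub that by auto
  define \<kappa> where "\<kappa> a = P (x' a)" for a
  have \<kappa>_in: "\<kappa> a \<in> \<Omega>" if "a \<in> \<Omega>'" for a using P_in[OF in_S[OF that]] by (simp add: \<kappa>_def)
  have x\<kappa>: "x (\<kappa> a) = x' a" if "a \<in> \<Omega>'" for a using x_P[OF in_S[OF that]] by (simp add: \<kappa>_def)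
  have s\<kappa>: "smooth_within \<Omega>' \<kappa>" unfolding \<kappa>_def[abs_def]
    by (rule smooth_within_bounded_linear[OF bounded_linear_P sx'])
  note d\<kappa> = smooth_within_has_derivative[OF open' s\<kappa>]
  have smooth: "smooth_within \<Omega>' (\<lambda>a. E (x' a))"
    if "smooth_within \<Omega> (\<lambda>a. E (x a))" for E :: "real ^ 'n \<Rightarrow> real ^ 'n"
    using smooth_within_cong[OF smooth_within_compose[OF that s\<kappa>]] \<kappa>_in x\<kappa> by (simp add: image_subset_iff)
  have chain: "frechet_derivative (\<lambda>a. E (x' a)) (at a) v
      = frechet_derivative (\<lambda>a. E (x a)) (at (\<kappa> a)) (frechet_derivative \<kappa> (at a) v)"
    if E: "smooth_within \<Omega> (\<lambda>a. E (x a))" and a: "a \<in> \<Omega>'" for E :: "real ^ 'n \<Rightarrow> real ^ 'n" and a v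
  proof -
    have "((\<lambda>a. E (x (\<kappa> a))) has_derivative
        (\<lambda>v. frechet_derivative (\<lambda>a. E (x a)) (at (\<kappa> a)) (frechet_derivative \<kappa> (at a) v))) (at a)"
      using d\<kappa>[OF a] by (rule has_derivative_compose)
        (rule smooth_within_has_derivative[OF open_\<Omega> E \<kappa>_in[OF a]])
    then have "((\<lambda>a. E (x' a)) has_derivative
        (\<lambda>v. frechet_derivative (\<lambda>a. E (x a)) (at (\<kappa> a)) (frechet_derivative \<kappa> (at a) v))) (at a)"
      by (rule has_derivative_transform_within_open[OF _ open' a]) (simp add: x\<kappa>)
    from fun_cong[OF frechet_derivative_at[OF this], of v, symmetric] show ?thesis .
  qed
  have \<kappa>_inj: "frechet_derivative \<kappa> (at a) v \<noteq> 0" if a: "a \<in> \<Omega>'" and v: "v \<noteq> 0" for a v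
  proof
    assume 0: "frechet_derivative \<kappa> (at a) v = 0"
    have lin: "linear (frechet_derivative x' (at a))" by (rule linear_frechet_derivative[OF open' sx' a])
    have "frechet_derivative x' (at a) v = frechet_derivative x (at (\<kappa> a)) 0"
      using chain[of "\<lambda>y. y", OF smooth_x a, of v] by (simp add: 0)
    also have "\<dots> = 0" by (rule linear_0[OF linear_frechet_derivative[OF open_\<Omega> smooth_x \<kappa>_in[OF a]]])
    finally show False using inj'[OF a] v linear_injective_0[OF lin] by blast
  qed
  show ?thesis
  proof (rule conjugate_immersions.intro)
    show "CARD('n) = Suc CARD('m)" using card_n card_m by simp
    show "1 \<le> primal_embedding \<phi> (x' a) \<bullet> dual_embedding \<phi> (x' b)" if "a \<in> \<Omega>'" "b \<in> \<Omega>'" for a b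
      by (rule pairing_ge_1(1)[OF in_S[OF that(1)] in_S[OF that(2)]])
    show "primal_embedding \<phi> (x' a) \<bullet> dual_embedding \<phi> (x' a) = 1" if "a \<in> \<Omega>'" for a
      using pairing_ge_1(2)[OF in_S[OF that] in_S[OF that]] by simp
    show "frechet_derivative (\<lambda>a. primal_embedding \<phi> (x' a)) (at a) v
        \<bullet> frechet_derivative (\<lambda>a. dual_embedding \<phi> (x' a)) (at a) v < 0" if "a \<in> \<Omega>'" "v \<noteq> 0" for a v
      unfolding chain[OF smooth_primal_x that(1)] chain[OF smooth_dual_x that(1)]
      by (rule derivatives_negative[OF \<kappa>_in[OF that(1)] \<kappa>_inj[OF that]])
  qed (fact open' smooth[OF smooth_primal_x] smooth[OF smooth_dual_x])+
qed

lemma divergence_pair: "divergence_pair TYPE('m) (primal_embedding \<phi>) (dual_embedding \<phi>)"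
  by (rule divergence_pair.intro) (fact card_n card_m pairing_ge_1 chart_conjugate_immersions)+

text \<open>The gap between the tangent plane at \<open>a\<close> and \<open>\<psi>\<close> is convex and vanishes at \<open>a\<close>, so outside a
  sphere of radius \<open>\<rho>\<close> around \<open>a\<close> it is at least the distance from \<open>a\<close> times \<open>\<mu> / \<rho>\<close>, where \<open>\<mu>\<close> is
  its minimum on the sphere.  As \<open>\<psi>\<close> grows at most linearly there, the quotient of the gap by \<open>\<psi>\<close>,
  which is the pairing minus \<open>1\<close>, stays away from \<open>0\<close>.\<close>

lemma pairing_proper:
  assumes p: "p \<in> simplex_int" and e: "e > 0"
  shows "\<exists>d>0. \<forall>y\<in>simplex_int. dual_embedding \<phi> p \<bullet> primal_embedding \<phi> y < 1 + d \<longrightarrow> dist y p < e"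
proof -
  define a where "a = P p"
  have a: "a \<in> \<Omega>" and xa: "x a = p" using P_in[OF p] x_P[OF p] by (auto simp: a_def)
  obtain M where M: "M > 0" "\<And>v. norm (L v) \<le> norm v * M"
    using bounded_linear.pos_bounded[OF bounded_linear_L] by blast
  obtain \<rho>0 where \<rho>0: "\<rho>0 > 0" "cball a \<rho>0 \<subseteq> \<Omega>" using open_\<Omega> a open_contains_cball by blast
  define \<rho> where "\<rho> = min \<rho>0 (e / M)"
  have \<rho>: "\<rho> > 0" "\<rho> \<le> \<rho>0" "\<rho> * M \<le> e" using \<rho>0 e M by (auto simp: \<rho>_def min_def field_simps)
  have sph: "sphere a \<rho> \<subseteq> \<Omega>" using \<rho>0(2) \<rho>(2) by (auto simp: sphere_def cball_def)
  define gap where "gap b = \<psi> a + D\<psi> a (b - a) - \<psi> b" for b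
  have blD: "bounded_linear (D\<psi> a)" using \<psi>_derivative[OF a] has_derivative_bounded_linear by blast
  obtain B where B: "B > 0" "\<And>v. norm (D\<psi> a v) \<le> norm v * B"
    using bounded_linear.pos_bounded[OF blD] by blast
  have "\<exists>\<mu>>0. \<forall>b\<in>sphere a \<rho>. \<mu> \<le> gap b"
  proof (cases "sphere a \<rho> = {}")
    case False
    have "continuous_on (sphere a \<rho>) gap" unfolding gap_def
      by (intro continuous_intros bounded_linear.continuous_on[OF blD]
          continuous_on_subset[OF smooth_within_continuous_on[OF smooth_\<psi>] sph])
    then obtain b where b: "b \<in> sphere a \<rho>" "\<And>b'. b' \<in> sphere a \<rho> \<Longrightarrow> gap b \<le> gap b'"
      using continuous_attains_inf[OF compact_sphere False] by blast
    have "b \<noteq> a" using b(1) \<rho>(1) by auto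
    then have "gap b > 0" using tangent_plane_above[OF a, of b] b(1) sph by (auto simp: gap_def)
    then show ?thesis using b(2) by blast
  qed (auto intro: exI[of _ 1])
  then obtain \<mu> where \<mu>: "\<mu> > 0" "\<And>b. b \<in> sphere a \<rho> \<Longrightarrow> \<mu> \<le> gap b" by blast
  define d where "d = \<mu> / (\<psi> a + B * \<rho>)"
  have den: "\<psi> a + B * \<rho> > 0" using \<psi>_pos[of a] B(1) \<rho>(1) by (simp add: add_pos_pos)
  have d: "d > 0" using \<mu>(1) den by (simp add: d_def)
  have "dist y p < e" if y: "y \<in> simplex_int" and lt: "dual_embedding \<phi> p \<bullet> primal_embedding \<phi> y < 1 + d" for y
  proof (rule ccontr)
    assume far: "\<not> dist y p < e"
    define b where "b = P y"
    have b: "b \<in> \<Omega>" and xb: "x b = y" using P_in[OF y] x_P[OF y] by (auto simp: b_def)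
    have "y - p = L (b - a)" by (simp add: xb[symmetric] xa[symmetric] x_def linear_diff[OF linear_L])
    then have "e \<le> norm (b - a) * M" using far M(2)[of "b - a"] by (simp add: dist_norm)
    then have "\<rho> * M \<le> norm (b - a) * M" using \<rho>(3) by simp
    then have n: "\<rho> \<le> norm (b - a)" using M(1) by simp
    define n where "n = norm (b - a)"
    have n_pos: "n > 0" and n_ge: "\<rho> \<le> n" using n \<rho>(1) by (auto simp: n_def)
    define s where "s = \<rho> / n"
    have s: "0 < s" "s \<le> 1" using n_pos n_ge \<rho>(1) by (auto simp: s_def)
    define b' where "b' = a + s *\<^sub>R (b - a)"
    have "norm (b' - a) = \<rho>" using n_pos \<rho>(1) by (simp add: b'_def s_def n_def[symmetric])
    then have b': "b' \<in> sphere a \<rho>" by (simp add: dist_norm norm_minus_commute)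
    have "x b' = (1 - s) *\<^sub>R p + s *\<^sub>R y"
      by (simp add: b'_def xa[symmetric] xb[symmetric] x_def linear_add[OF linear_L] linear_scale[OF linear_L]
          linear_diff[OF linear_L] algebra_simps)
    then have conc: "\<psi> b' \<ge> (1 - s) * \<psi> a + s * \<psi> b"
      using concave_onD[OF concave_exp, of s p y] s p y by (simp add: \<psi>_def xa xb)
    have "D\<psi> a (b' - a) = s * D\<psi> a (b - a)" by (simp add: b'_def linear_scale[OF linear_D\<psi>[OF a]])
    then have "gap b' \<le> s * gap b" using conc by (simp add: gap_def algebra_simps)
    then have "\<mu> \<le> s * gap b" using \<mu>(2)[OF b'] by simp
    then have 1: "\<mu> * n \<le> \<rho> * gap b" using n_pos by (simp add: s_def field_simps)
    have "0 < \<rho> * gap b" using 1 mult_pos_pos[OF \<mu>(1) n_pos] by linarith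
    then have "gap b \<ge> 0" using \<rho>(1) by (simp add: zero_less_mult_iff)
    then have "\<psi> b \<le> \<psi> a + D\<psi> a (b - a)" by (simp add: gap_def)
    also have "\<dots> \<le> \<psi> a + n * B" using B(2)[of "b - a"] by (simp add: n_def abs_le_iff)
    finally have "\<psi> b * \<rho> \<le> (\<psi> a + n * B) * \<rho>" using \<rho>(1) by simp
    also have "\<dots> \<le> (\<psi> a + B * \<rho>) * n"
      using mult_left_mono[OF n_ge less_imp_le[OF \<psi>_pos[of a]]] by (simp add: algebra_simps)
    finally have "d * (\<psi> b * \<rho>) \<le> d * ((\<psi> a + B * \<rho>) * n)" using d by simp
    also have "\<dots> = \<mu> * n" using den by (simp add: d_def)
    also have "\<dots> \<le> gap b * \<rho>" using 1 by (simp add: mult.commute)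
    finally have "d * \<psi> b \<le> gap b" using \<rho>(1) by (simp add: mult.assoc[symmetric])
    then have "(1 + d) * \<psi> b \<le> \<psi> a + D\<psi> a (b - a)" by (simp add: gap_def algebra_simps)
    then have "1 + d \<le> primal_embedding \<phi> (x b) \<bullet> dual_embedding \<phi> (x a)"
      unfolding pairing_chart[OF a] using \<psi>_pos[of b] by (simp add: pos_le_divide_eq)
    then show False using lt by (simp add: xa xb inner_commute)
  qed
  then show ?thesis using d by blast
qed

end

section \<open>Existence of primal geodesics and the time change\<close>

text \<open>The normalised segment between the embedded points is the segment between the points.\<close>

lemma (in exp_concave) primal_geodesic_exists:
  assumes q: "q \<in> simplex_int" and r: "r \<in> simplex_int"
  shows "\<exists>\<sigma>. embedded_geodesic (primal_embedding \<phi>) q r \<sigma>"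
proof -
  interpret divergence_pair "primal_embedding \<phi>" "dual_embedding \<phi>" by (rule divergence_pair)
  define S where "S l = (1 - l) * exp (- \<phi> q) + l * exp (- \<phi> r)" for l
  define z where "z l = ((1 - l) * exp (- \<phi> q) / S l) *\<^sub>R q + (l * exp (- \<phi> r) / S l) *\<^sub>R r" for l
  have S: "S l > 0" if "l \<in> {0..1}" for l
  proof (cases "l = 0")
    case False
    then have "0 < l * exp (- \<phi> r)" "0 \<le> (1 - l) * exp (- \<phi> q)" using that by auto
    then show ?thesis by (simp add: S_def)
  qed (simp add: S_def)
  show ?thesis
  proof (rule geodesic_exists_if_segment_lifts[OF q r])
    have "\<forall>l\<in>{0..1}. S l \<noteq> 0" using S by force
    then show "continuous_on {0..1} z" unfolding z_def S_def by (intro continuous_intros) auto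
    show "z ` {0..1} \<subseteq> simplex_int"
    proof (rule image_subsetI)
      fix l :: real assume l: "l \<in> {0..1}"
      show "z l \<in> simplex_int" unfolding z_def
      proof (rule convexD[OF convex_simplex_int q r])
        show "(1 - l) * exp (- \<phi> q) / S l + l * exp (- \<phi> r) / S l = 1"
          using S[OF l] by (simp add: add_divide_distrib[symmetric]) (simp add: S_def)
      qed (use S[OF l] l in auto)
    qed
    fix l :: real assume l: "l \<in> {0..1}"
    have "primal_embedding \<phi> (z l) = (exp (- \<phi> (z l)) / S l) *\<^sub>R
        ((1 - l) *\<^sub>R primal_embedding \<phi> q + l *\<^sub>R primal_embedding \<phi> r)"
      by (simp add: primal_embedding_def z_def scaleR_add_right mult_ac)
    then show "\<exists>c. primal_embedding \<phi> (z l) =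
        c *\<^sub>R ((1 - l) *\<^sub>R primal_embedding \<phi> q + l *\<^sub>R primal_embedding \<phi> r)" by blast
  qed
qed

theorem theorem5p5:
  fixes \<phi> :: "real ^ 'n::finite \<Rightarrow> real" and p q r :: "real ^ 'n"
  assumes "CARD('n) \<ge> 2"
    and "CARD('m::finite) = CARD('n) - 1"
    and "smooth_on_simplex TYPE('m) \<phi>"
    and "concave_on simplex_int (\<lambda>a. exp (\<phi> a))"
    and "\<forall>a\<in>simplex_int. \<forall>v\<in>tangent_space. v \<noteq> 0 \<longrightarrow> hess (\<lambda>b. exp (\<phi> b)) a v v < 0"
    and "p \<in> simplex_int" "q \<in> simplex_int" "r \<in> simplex_int"
  shows
    "((\<exists>\<gamma>. primal_flow TYPE('m) \<phi> r q \<gamma>) \<and>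
      (\<exists>\<sigma>. primal_geodesic_from_to TYPE('m) \<phi> q r \<sigma>) \<and>
      (\<forall>\<gamma> \<sigma>. primal_flow TYPE('m) \<phi> r q \<gamma> \<longrightarrow>
         primal_geodesic_from_to TYPE('m) \<phi> q r \<sigma> \<longrightarrow> time_change \<gamma> \<sigma>)) \<and>
     (((\<exists>\<gamma>. dual_flow TYPE('m) \<phi> p q \<gamma>) \<longleftrightarrow>
       (\<exists>\<sigma>. dual_geodesic_from_to TYPE('m) \<phi> q p \<sigma>)) \<and>
      (\<forall>\<gamma> \<sigma>. dual_flow TYPE('m) \<phi> p q \<gamma> \<longrightarrow>
         dual_geodesic_from_to TYPE('m) \<phi> q p \<sigma> \<longrightarrow> time_change \<gamma> \<sigma>))"
proof -
  obtain L :: "real ^ 'm \<Rightarrow> real ^ 'n" and P c \<Omega>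
    where chart: "linear L" "linear P" "\<And>a. P (c + L a) = a"
      "\<And>p. (\<Sum>i\<in>UNIV. p $ i) = 1 \<Longrightarrow> c + L (P p) = p" "\<And>a. L a \<in> tangent_space"
      "\<And>v. v \<in> tangent_space \<Longrightarrow> L (P v) = v" "open \<Omega>" "convex \<Omega>"
      "(\<lambda>a. c + L a) ` \<Omega> = simplex_int" "coordinate_system \<Omega> (\<lambda>a. c + L a) P"
    by (rule affine_chart_exists[OF assms(1,2)]) (rule that; assumption)
  interpret E: exp_concave \<phi> c L P \<Omega>
    by (rule exp_concave.intro) (fact assms(1-5) chart)+
  interpret X: divergence_pair "primal_embedding \<phi>" "dual_embedding \<phi>"
    by (rule E.divergence_pair)
  interpret Y: divergence_pair "dual_embedding \<phi>" "primal_embedding \<phi>"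
    by (rule X.swap_pair)
  have T: "\<forall>y\<in>simplex_int. \<forall>z\<in>simplex_int.
      L_div \<phi> y z = ln (primal_embedding \<phi> y \<bullet> dual_embedding \<phi> z)"
    using E.L_div_eq_ln_pairing by blast
  note pf = X.primal_flow_iff[OF T \<open>r \<in> simplex_int\<close>] and df = X.dual_flow_iff[OF T \<open>p \<in> simplex_int\<close>]
    and pg = X.primal_geodesic_iff[OF T] and dg = X.dual_geodesic_iff[OF T]
  have primal_geo: "\<exists>\<sigma>. embedded_geodesic (primal_embedding \<phi>) q r \<sigma>"
    by (rule E.primal_geodesic_exists[OF \<open>q \<in> simplex_int\<close> \<open>r \<in> simplex_int\<close>])
  then have primal_fl: "\<exists>\<gamma>. embedded_flow (primal_embedding \<phi>) (dual_embedding \<phi>) r q \<gamma>"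
    using X.flow_exists_if_geodesic_exists by blast
  have dual_geo: "\<exists>\<sigma>. embedded_geodesic (dual_embedding \<phi>) q p \<sigma>"
    if fl: "embedded_flow (dual_embedding \<phi>) (primal_embedding \<phi>) p q \<gamma>" for \<gamma>
    by (rule Y.geodesic_exists_if_flow_converges[OF fl \<open>p \<in> simplex_int\<close>
          Y.flow_converges[OF fl \<open>p \<in> simplex_int\<close> E.pairing_proper[OF \<open>p \<in> simplex_int\<close>]]])
  show ?thesis
    unfolding pf df pg dg
    using primal_geo primal_fl dual_geo Y.flow_exists_if_geodesic_exists
      X.flow_is_time_change Y.flow_is_time_change by blast
qed

end
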